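(* Let $n\geqslant2$ and $\sigma>0$. For a probability density function $f$ on $\mathbb{S}$ define $\mathcal H(f)=\|f-1\|^2_{\widetilde H^{-\frac{n-1}2}}$ and $\widetilde{\mathcal D}(f)=2\sigma\|f-1\|^2_{\widetilde H^{-\frac{n-3}2}}-\frac{2}{(n-2)!}|J[f]|^2$, where $J[f]=\int_{\mathbb{S}}\omega f\,\mathrm d\omega$. Then for any solution $f$ of the Doi equation $\partial_t f=-\nabla_\omega\cdot((\mathrm{Id}-\omega\otimes\omega)J[f]f)+\sigma\Delta_\omega f$ (with initial datum a probability measure) one has the conservation relation $$\frac{\mathrm d}{\mathrm dt}\mathcal H(f)+\widetilde{\mathcal D}(f)=0.$$ When $\sigma\geqslant\frac1n$, $\widetilde{\mathcal D}(f)\geqslant0$, so $\mathcal H(f)$ is nonincreasing in time. Furthermore, if $\sigma>\frac1n$ and $s\geqslant-\frac{n-1}2$, there is a constant $C$ depending only on $s$ such that for every initial condition $f_0\in H^s(\mathbb{S})$ (a probability measure), the solution satisfies for all $t\geqslant0$ $$\|f(t)-1\|_{H^s}\leqslant C\|f_0-1\|_{H^s}e^{-(n-1)(\sigma-\frac1n)t}.$$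
   Context: $\mathbb{S}$ is the unit sphere of $\mathbb{R}^n$ with the rotation-invariant probability measure $\mathrm d\omega$; $\nabla_\omega,\Delta_\omega$ are the tangential gradient and Laplace–Beltrami operator. $H^s$ and $\dot H^s$ are the Sobolev spaces defined spectrally: for mean-zero $g=\sum_{\ell\ge1}g_\ell$ (degree-$\ell$ spherical harmonic components), $\|g\|^2_{\dot H^s}=\sum_{\ell\ge1}(\ell(\ell+n-2))^s\|g_\ell\|^2_{L^2}$, and $\|f\|^2_{H^s}=\langle f,1\rangle^2+\|f-\langle f,1\rangle\|^2_{\dot H^s}$. The conformal Laplacian $\widetilde\Delta_{n-1}$ is the operator acting on spherical harmonics $Y_\ell$ of degree $\ell\geqslant1$ by $\widetilde\Delta_{n-1}Y_\ell=\ell(\ell+1)\cdots(\ell+n-2)Y_\ell$. For mean-zero $g$: $\|g\|^2_{\widetilde H^{-\frac{n-1}2}}=\int_{\mathbb{S}}g\,\widetilde\Delta_{n-1}^{-1}g$ and $\|g\|^2_{\widetilde H^{-\frac{n-3}2}}=\int_{\mathbb{S}}(-\Delta_\omega g)\,\widetilde\Delta_{n-1}^{-1}g$. Solutions are the unique global weak solutions of the Doi equation (smooth and positive for $t>0$). *)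

theory Defs
  imports "HOL-Analysis.Analysis"
begin

text \<open>Rotation-invariant probability measure on the unit sphere: push-forward of the
  uniform probability measure on the unit ball under radial projection.\<close>
definition sph :: "(real^'n) measure" where
  "sph = distr (uniform_measure lborel (ball 0 1)) borel (\<lambda>x. x /\<^sub>R norm x)"

definition pd :: "'n::finite \<Rightarrow> (real^'n \<Rightarrow> real) \<Rightarrow> real^'n \<Rightarrow> real" where
  "pd i \<phi> = (\<lambda>x. deriv (\<lambda>h. \<phi> (x + h *\<^sub>R axis i 1)) 0)"

definition grad :: "(real^'n::finite \<Rightarrow> real) \<Rightarrow> real^'n \<Rightarrow> real^'n" where
  "grad \<phi> x = (\<chi> i. pd i \<phi> x)"

definition lap :: "(real^'n::finite \<Rightarrow> real) \<Rightarrow> real^'n \<Rightarrow> real" where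
  "lap \<phi> x = (\<Sum>i\<in>UNIV. pd i (pd i \<phi>) x)"

text \<open>Tangential gradient on the sphere (evaluated at points x with norm x = 1).\<close>
definition gradS :: "(real^'n::finite \<Rightarrow> real) \<Rightarrow> real^'n \<Rightarrow> real^'n" where
  "gradS \<phi> x = grad \<phi> x - (x \<bullet> grad \<phi> x) *\<^sub>R x"

text \<open>Laplace--Beltrami operator on the sphere (evaluated at points x with norm x = 1):
  Delta_S phi = Delta phi - x^T (D^2 phi) x - (n-1) x . grad phi.\<close>
definition lapS :: "(real^'n::finite \<Rightarrow> real) \<Rightarrow> real^'n \<Rightarrow> real" where
  "lapS \<phi> x = lap \<phi> x - (\<Sum>i\<in>UNIV. \<Sum>j\<in>UNIV. x$i * x$j * pd i (pd j \<phi>) x)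
               - (real CARD('n) - 1) * (x \<bullet> grad \<phi> x)"

text \<open>Spherical harmonics of degree l: (restrictions to the sphere of) homogeneous harmonic
  polynomials of degree l.\<close>
definition sph_harm :: "nat \<Rightarrow> (real^'n::finite \<Rightarrow> real) set" where
  "sph_harm l = {Y. real_polynomial_function Y \<and> (\<forall>c x. Y (c *\<^sub>R x) = c ^ l * Y x)
                    \<and> (\<forall>x. lap Y x = 0)}"

text \<open>A (generalized) function g on the sphere is represented by its pairing functional
  L Z = <g, Z>, for Z polynomial.  The degree-l component g_l is the unique element of
  sph_harm l representing L on sph_harm l in L^2(d omega).\<close>
definition harm_comp :: "((real^'n::finite \<Rightarrow> real) \<Rightarrow> real) \<Rightarrow> nat \<Rightarrow> real^'n \<Rightarrow> real" where
  "harm_comp L l = (THE Y. Y \<in> sph_harm l \<and>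
      (\<forall>Z\<in>sph_harm l. (\<integral>x. Y x * Z x \<partial>sph) = L Z))"

definition comp_sq :: "((real^'n::finite \<Rightarrow> real) \<Rightarrow> real) \<Rightarrow> nat \<Rightarrow> real" where
  "comp_sq L l = (\<integral>x. (harm_comp L l x)^2 \<partial>sph)"

definition eig :: "'n::finite itself \<Rightarrow> nat \<Rightarrow> real" where
  "eig _ l = real l * (real l + real CARD('n) - 2)"

definition Hdot_sq :: "real \<Rightarrow> ((real^'n::finite \<Rightarrow> real) \<Rightarrow> real) \<Rightarrow> ennreal" where
  "Hdot_sq s L = (\<Sum>l. if l = 0 then 0
       else ennreal ((eig TYPE('n) l) powr s * comp_sq L l))"

definition Hs_sq :: "real \<Rightarrow> ((real^'n::finite \<Rightarrow> real) \<Rightarrow> real) \<Rightarrow> ennreal" where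
  "Hs_sq s L = ennreal ((L (\<lambda>_. 1))^2) + Hdot_sq s L"

text \<open>Eigenvalue l(l+1)...(l+n-2) of the conformal Laplacian.\<close>
definition conf_eig :: "'n::finite itself \<Rightarrow> nat \<Rightarrow> real" where
  "conf_eig _ l = pochhammer (real l) (CARD('n) - 1)"

definition tildeA_sq :: "((real^'n::finite \<Rightarrow> real) \<Rightarrow> real) \<Rightarrow> real" where
  "tildeA_sq L = (\<Sum>l. if l = 0 then 0 else comp_sq L l / conf_eig TYPE('n) l)"

definition tildeB_sq :: "((real^'n::finite \<Rightarrow> real) \<Rightarrow> real) \<Rightarrow> real" where
  "tildeB_sq L = (\<Sum>l. if l = 0 then 0 else eig TYPE('n) l * comp_sq L l / conf_eig TYPE('n) l)"

definition dens_fun :: "(real^'n::finite \<Rightarrow> real) \<Rightarrow> (real^'n \<Rightarrow> real) \<Rightarrow> real" where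
  "dens_fun f Z = (\<integral>x. Z x * f x \<partial>sph) - (\<integral>x. Z x \<partial>sph)"

definition meas_fun :: "(real^'n::finite) measure \<Rightarrow> (real^'n \<Rightarrow> real) \<Rightarrow> real" where
  "meas_fun \<mu> Z = (\<integral>x. Z x \<partial>\<mu>) - (\<integral>x. Z x \<partial>sph)"

definition Jf :: "(real^'n::finite \<Rightarrow> real) \<Rightarrow> real^'n" where
  "Jf f = (\<chi> i. \<integral>x. x$i * f x \<partial>sph)"

definition Hent :: "(real^'n::finite \<Rightarrow> real) \<Rightarrow> real" where
  "Hent f = tildeA_sq (dens_fun f)"

definition Dtil :: "real \<Rightarrow> (real^'n::finite \<Rightarrow> real) \<Rightarrow> real" where
  "Dtil \<sigma> f = 2 * \<sigma> * tildeB_sq (dens_fun f)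
      - 2 / fact (CARD('n) - 2) * (Jf f \<bullet> Jf f)"

definition doi_solution :: "real \<Rightarrow> (real^'n::finite) measure \<Rightarrow> (real \<Rightarrow> real^'n \<Rightarrow> real) \<Rightarrow> bool" where
  "doi_solution \<sigma> \<mu>0 f \<longleftrightarrow>
     emeasure \<mu>0 (space \<mu>0) = 1 \<and> sets \<mu>0 = sets borel \<and> emeasure \<mu>0 (- sphere 0 1) = 0 \<and>
     (\<forall>t>0. (\<forall>x\<in>sphere 0 1. f t x > 0) \<and> continuous_on (sphere 0 1) (f t) \<and>
            integrable sph (f t) \<and> (\<integral>x. f t x \<partial>sph) = 1) \<and>
     (\<forall>\<phi>. real_polynomial_function \<phi> \<longrightarrow>
        ((\<lambda>t. \<integral>x. \<phi> x * f t x \<partial>sph) \<longlongrightarrow> (\<integral>x. \<phi> x \<partial>\<mu>0)) (at_right 0) \<and>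
        (\<forall>t>0. ((\<lambda>\<tau>. \<integral>x. \<phi> x * f \<tau> x \<partial>sph) has_real_derivative
           (\<integral>x. (Jf (f t) \<bullet> gradS \<phi> x + \<sigma> * lapS \<phi> x) * f t x \<partial>sph)) (at t)))"

definition sol_fun :: "(real^'n::finite) measure \<Rightarrow> (real \<Rightarrow> real^'n \<Rightarrow> real) \<Rightarrow> real \<Rightarrow> (real^'n \<Rightarrow> real) \<Rightarrow> real" where
  "sol_fun \<mu>0 f t = (if t = 0 then meas_fun \<mu>0 else dens_fun (f t))"

end

theory Submission
  imports Defs
begin

text \<open>
  Write $c_l$ for the squared $L^2$ norm of the degree-$l$ component $g_l$ of $f - 1$. On spherical
  harmonics of degree $l$, the field $J \cdot \nabla_\omega$ only couples the degrees $l - 1$ and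
  $l + 1$, so the Doi equation becomes the hierarchy
  $c_l' = - 2 \sigma l (l + n - 2) c_l - 2 l m_l + 2 (l + n - 2) m_{l-1}$, where
  $m_l = \int (J \cdot \omega) g_l g_{l+1}$ and $m_0 = |J|^2 = c_1 / n$. Weighted by the inverse
  eigenvalues $w_l$ of the conformal Laplacian, which satisfy $l w_l = (l + n - 1) w_{l+1}$, the
  $m_l$ telescope and only the $m_0$ term survives: this is the conservation relation.

  Since $f$ is only a probability measure initially, $c_l$ is a priori only polynomially bounded in
  $l$ (by the mean value property of harmonic polynomials). For positive times, Duhamel's formula gains
  one power of $l$ at a time, which justifies termwise differentiation. Near time zero the weights are
  damped by $r^l$ with $r < 1$, and the estimates, being uniform in $r$, survive the limit
  $r \to 1$. For a general Sobolev weight the coupling terms are absorbed by the diffusion except for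
  finitely many low modes, which are controlled by the exponentially decaying entropy.
\<close>

subsection \<open>Partial derivatives of polynomial functions\<close>

text \<open>The threshold 1/n is an effect of the first mode. The one coupling term that survives
  the telescoping is at most \<open>2/n\<close> times \<open>Q\<close>, the sum of
  \<open>w l * lam l * c l\<close>, because its counterpart in \<open>Q\<close> is the summand of
  degree one. The dissipation is thus at least \<open>2 (\<sigma> - 1/n) Q\<close>, and
  \<open>lam l \<ge> n - 1\<close> gives the rate. Damping by \<open>r ^ l\<close> spoils the
  cancellation: the coupling sum comes back with a factor \<open>1 - r\<close>. It is bounded by a
  multiple of the damped \<open>Q\<close>, so it costs a part of the rate that vanishes as r tends
  to 1.

  In the Sobolev estimate the constant must not depend on \<sigma>. Diffusion is therefore split as
  \<open>2 \<sigma> lam = 2 (\<sigma> - 1/n) lam + (2/n) lam\<close>: the first part pays for the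
  full rate, the second is free of \<sigma> and absorbs the coupling of the high modes.

  Calculus on the sphere is derived from integrals over balls: scaling of homogeneous polynomials
  converts ball averages into sphere means, and integration by parts takes place in flat
  space.\<close>

abbreviation rpoly :: "(real^'n::finite \<Rightarrow> real) \<Rightarrow> bool" where
  "rpoly \<equiv> real_polynomial_function"

lemma rpoly_const [simp]: "rpoly (\<lambda>x. c)"
  and rpoly_coord [simp]: "rpoly (\<lambda>x. x $ i)"
  by (auto intro: real_polynomial_function.intros bounded_linear_vec_nth)

lemma rpoly_add [simp]: "rpoly p \<Longrightarrow> rpoly q \<Longrightarrow> rpoly (\<lambda>x. p x + q x)"
  and rpoly_diff [simp]: "rpoly p \<Longrightarrow> rpoly q \<Longrightarrow> rpoly (\<lambda>x. p x - q x)"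
  and rpoly_uminus [simp]: "rpoly p \<Longrightarrow> rpoly (\<lambda>x. - p x)"
  and rpoly_mult [simp]: "rpoly p \<Longrightarrow> rpoly q \<Longrightarrow> rpoly (\<lambda>x. p x * q x)"
  and rpoly_divide [simp]: "rpoly p \<Longrightarrow> rpoly (\<lambda>x. p x / c)"
  and rpoly_power [simp]: "rpoly p \<Longrightarrow> rpoly (\<lambda>x. p x ^ m)"
  and rpoly_sum [simp]: "(\<And>k. k \<in> A \<Longrightarrow> rpoly (g k)) \<Longrightarrow> rpoly (\<lambda>x. \<Sum>k\<in>A. g k x)"
  by (auto intro: real_polynomial_function.intros real_polynomial_function_sum
      simp: real_polynomial_function_divide) (cases "finite A", auto)

lemma rpoly_inner [simp]: "rpoly (\<lambda>x. v \<bullet> x)"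
  by (simp add: inner_vec_def)

lemma rpoly_inner_self [simp]: "rpoly (\<lambda>x. x \<bullet> x)"
  by (simp add: inner_vec_def)

lemma rpoly_affine: "rpoly p \<Longrightarrow> rpoly (\<lambda>x. p (a + r *\<^sub>R x))"
proof (induction rule: real_polynomial_function.induct)
  case (linear f)
  have "f (a + r *\<^sub>R x) = f a + r * f x" for x
    using linear by (simp add: bounded_linear.linear linear_add linear_scale)
  then show ?case using linear by (simp add: real_polynomial_function.intros(1))
qed auto

lemma rpoly_continuous: "rpoly p \<Longrightarrow> continuous_on S p"
  by (simp add: continuous_on_polymonial_function real_polynomial_function_eq)

text \<open>\<open>pd\<close> rests on \<open>deriv\<close>, which carries no information where no
  derivative exists. Most rules for \<open>pd\<close> below exhibit a total derivative and read off
  its coefficients through this lemma.\<close>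

lemma pd_eqI:
  assumes "(p has_derivative (\<lambda>h. \<Sum>i\<in>UNIV. h $ i * D i)) (at x)"
  shows "pd i p x = D i"
proof -
  have "((\<lambda>h. x + h *\<^sub>R axis i 1) has_derivative (\<lambda>h. h *\<^sub>R axis i 1)) (at 0)"
    by (auto intro!: derivative_eq_intros)
  then have "(p \<circ> (\<lambda>h. x + h *\<^sub>R axis i 1) has_derivative
      (\<lambda>h. \<Sum>i\<in>UNIV. h $ i * D i) \<circ> (\<lambda>h. h *\<^sub>R axis i 1)) (at 0)"
    by (rule diff_chain_at) (use assms in simp)
  moreover have "(\<lambda>h. \<Sum>i\<in>UNIV. h $ i * D i) \<circ> (\<lambda>h. h *\<^sub>R axis i 1) = (*) (D i)"
    by (auto simp: fun_eq_iff axis_def if_distrib if_distribR sum.delta cong: if_cong)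
  ultimately have "((\<lambda>h. p (x + h *\<^sub>R axis i 1)) has_real_derivative D i) (at 0)"
    by (simp add: has_field_derivative_def o_def)
  then show ?thesis by (simp add: pd_def DERIV_imp_deriv)
qed

lemma bounded_linear_vec_expand:
  fixes f :: "real^'n::finite \<Rightarrow> real"
  assumes "bounded_linear f"
  shows "f = (\<lambda>h. \<Sum>i\<in>UNIV. h $ i * f (axis i 1))"
proof
  fix h
  have "f h = f (\<Sum>i\<in>UNIV. h $ i *\<^sub>R axis i 1)"
    using basis_expansion[of h] by (simp add: scalar_mult_eq_scaleR)
  then show "f h = (\<Sum>i\<in>UNIV. h $ i * f (axis i 1))"
    using assms by (simp add: bounded_linear.linear linear_sum linear_scale)
qed

text \<open>Total differentiability and polynomial coefficients have to be produced together by the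
  induction; only afterwards can the coefficients be identified with \<open>pd\<close>.\<close>

lemma rpoly_has_derivative_ex:
  "rpoly p \<Longrightarrow> \<exists>D. (\<forall>i. rpoly (D i)) \<and>
     (\<forall>x. (p has_derivative (\<lambda>h. \<Sum>i\<in>UNIV. h $ i * D i x)) (at x))"
proof (induction rule: real_polynomial_function.induct)
  case (linear f)
  note bounded_linear_vec_expand[OF linear]
  moreover have "(f has_derivative f) (at x)" for x
    using linear by (rule bounded_linear_imp_has_derivative)
  ultimately show ?case
    by (intro exI[of _ "\<lambda>i x. f (axis i 1)"]) auto
next
  case (const c)
  show ?case by (intro exI[of _ "\<lambda>i x. 0"]) auto
next
  case (add f g)
  then obtain D E where
    "\<And>i. rpoly (D i)" "\<And>x. (f has_derivative (\<lambda>h. \<Sum>i\<in>UNIV. h $ i * D i x)) (at x)"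
    "\<And>i. rpoly (E i)" "\<And>x. (g has_derivative (\<lambda>h. \<Sum>i\<in>UNIV. h $ i * E i x)) (at x)"
    by blast
  then show ?case
    by (intro exI[of _ "\<lambda>i x. D i x + E i x"])
      (auto intro!: derivative_eq_intros simp: algebra_simps sum.distrib)
next
  case (mult f g)
  then obtain D E where
    "\<And>i. rpoly (D i)" "\<And>x. (f has_derivative (\<lambda>h. \<Sum>i\<in>UNIV. h $ i * D i x)) (at x)"
    "\<And>i. rpoly (E i)" "\<And>x. (g has_derivative (\<lambda>h. \<Sum>i\<in>UNIV. h $ i * E i x)) (at x)"
    by blast
  then show ?case using mult
    by (intro exI[of _ "\<lambda>i x. D i x * g x + f x * E i x"])
      (auto intro!: derivative_eq_intros
        simp: algebra_simps sum.distrib sum_distrib_left sum_distrib_right)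
qed

lemma
  assumes "rpoly p"
  shows rpoly_pd [simp]: "rpoly (pd i p)"
    and rpoly_has_derivative:
      "(p has_derivative (\<lambda>h. \<Sum>i\<in>UNIV. h $ i * pd i p x)) (at x)"
proof -
  obtain D where D: "\<And>i. rpoly (D i)"
    "\<And>x. (p has_derivative (\<lambda>h. \<Sum>i\<in>UNIV. h $ i * D i x)) (at x)"
    using rpoly_has_derivative_ex[OF assms] by blast
  have "pd i p = D i" for i
    using pd_eqI[OF D(2)] by blast
  with D show "rpoly (pd i p)" "(p has_derivative (\<lambda>h. \<Sum>i\<in>UNIV. h $ i * pd i p x)) (at x)"
    by simp_all
qed

lemma pd_const [simp]: "pd i (\<lambda>x. c) = (\<lambda>x. 0)"
  by (simp add: pd_def)

lemma pd_add [simp]: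
  "rpoly p \<Longrightarrow> rpoly q \<Longrightarrow> pd i (\<lambda>x. p x + q x) = (\<lambda>x. pd i p x + pd i q x)"
  by (rule ext, rule pd_eqI)
    (auto intro!: derivative_eq_intros rpoly_has_derivative simp: algebra_simps sum.distrib)

lemma pd_mult [simp]:
  "rpoly p \<Longrightarrow> rpoly q \<Longrightarrow> pd i (\<lambda>x. p x * q x) = (\<lambda>x. pd i p x * q x + p x * pd i q x)"
  by (rule ext, rule pd_eqI)
    (auto intro!: derivative_eq_intros rpoly_has_derivative
      simp: algebra_simps sum.distrib sum_distrib_left sum_distrib_right)

lemma pd_uminus [simp]: "rpoly p \<Longrightarrow> pd i (\<lambda>x. - p x) = (\<lambda>x. - pd i p x)"
  using pd_mult[of "\<lambda>x. -1" p i] by simp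

lemma pd_diff [simp]:
  "rpoly p \<Longrightarrow> rpoly q \<Longrightarrow> pd i (\<lambda>x. p x - q x) = (\<lambda>x. pd i p x - pd i q x)"
  using pd_add[of p "\<lambda>x. - q x" i] by simp

lemma pd_sum [simp]:
  assumes "\<And>k. k \<in> A \<Longrightarrow> rpoly (g k)"
  shows "pd i (\<lambda>x. \<Sum>k\<in>A. g k x) = (\<lambda>x. \<Sum>k\<in>A. pd i (g k) x)"
  using assms by (induction A rule: infinite_finite_induct) auto

lemma pd_coord [simp]: "pd i (\<lambda>x. x $ j) = (\<lambda>x. if i = j then 1 else 0)"
  by (rule ext, rule pd_eqI)
    (auto intro!: derivative_eq_intros bounded_linear_imp_has_derivative bounded_linear_vec_nth
      simp: if_distrib sum.delta cong: if_cong)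

lemma pd_inner [simp]: "pd i (\<lambda>x. v \<bullet> x) = (\<lambda>x. v $ i)"
  by (simp add: inner_vec_def sum.delta if_distrib cong: if_cong)

lemma pd_inner_self [simp]: "pd i (\<lambda>x. x \<bullet> x) = (\<lambda>x. 2 * x $ i)"
  by (simp add: inner_vec_def sum.delta if_distrib if_distribR sum.distrib cong: if_cong)

lemma pd_commute: "rpoly p \<Longrightarrow> pd i (pd j p) = pd j (pd i p)"
proof (induction rule: real_polynomial_function.induct)
  case (linear f)
  have "pd k f = (\<lambda>x. f (axis k 1))" for k
  proof (rule ext, rule pd_eqI)
    show "(f has_derivative (\<lambda>h. \<Sum>i\<in>UNIV. h $ i * f (axis i 1))) (at x)" for x
      using bounded_linear_imp_has_derivative[OF linear] bounded_linear_vec_expand[OF linear] by simp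
  qed
  then show ?case by simp
qed (auto simp: algebra_simps)

lemma pd_affine:
  assumes "rpoly p"
  shows "pd i (\<lambda>x. p (a + r *\<^sub>R x)) = (\<lambda>x. r * pd i p (a + r *\<^sub>R x))"
proof (rule ext, rule pd_eqI)
  fix x
  have "((\<lambda>x. a + r *\<^sub>R x) has_derivative (\<lambda>h. r *\<^sub>R h)) (at x)"
    by (auto intro!: derivative_eq_intros)
  from diff_chain_at[OF this rpoly_has_derivative[OF assms]]
  show "((\<lambda>x. p (a + r *\<^sub>R x)) has_derivative
      (\<lambda>h. \<Sum>i\<in>UNIV. h $ i * (r * pd i p (a + r *\<^sub>R x)))) (at x)"
    by (simp add: o_def algebra_simps)
qed

lemma lap_affine: "rpoly p \<Longrightarrow> lap (\<lambda>x. p (a + r *\<^sub>R x)) x = r\<^sup>2 * lap p (a + r *\<^sub>R x)"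
  by (simp add: lap_def pd_affine rpoly_affine sum_distrib_left power2_eq_square algebra_simps)

lemma lap_add: "rpoly p \<Longrightarrow> rpoly q \<Longrightarrow> lap (\<lambda>x. p x + q x) x = lap p x + lap q x"
  and lap_diff: "rpoly p \<Longrightarrow> rpoly q \<Longrightarrow> lap (\<lambda>x. p x - q x) x = lap p x - lap q x"
  and lap_cmult: "rpoly p \<Longrightarrow> lap (\<lambda>x. c * p x) x = c * lap p x"
  by (simp_all add: lap_def sum.distrib sum_subtractf sum_distrib_left)

lemma lap_const [simp]: "lap (\<lambda>x. c) x = 0"
  by (simp add: lap_def)

lemma lap_mult:
  "rpoly p \<Longrightarrow> rpoly q \<Longrightarrow>
    lap (\<lambda>x. p x * q x) x = lap p x * q x + 2 * (\<Sum>i\<in>UNIV. pd i p x * pd i q x) + p x * lap q x"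
  by (simp add: lap_def sum.distrib sum_distrib_left sum_distrib_right algebra_simps)

lemma lap_sum:
  "(\<And>k. k \<in> A \<Longrightarrow> rpoly (g k)) \<Longrightarrow> lap (\<lambda>x. \<Sum>k\<in>A. g k x) x = (\<Sum>k\<in>A. lap (g k) x)"
  by (induction A rule: infinite_finite_induct) (simp_all add: lap_add)

lemma lap_pd: "rpoly p \<Longrightarrow> lap (pd i p) = pd i (lap p)"
proof
  fix x assume p: "rpoly p"
  have "pd j (pd j (pd i p)) = pd i (pd j (pd j p))" for j
    using p pd_commute[of p] pd_commute[of "pd j p"] by simp
  then show "lap (pd i p) x = pd i (lap p) x"
    using p by (simp add: lap_def[abs_def])
qed

subsection \<open>Homogeneous polynomials\<close>

definition homog :: "nat \<Rightarrow> (real^'n::finite \<Rightarrow> real) \<Rightarrow> bool" where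
  "homog k p \<longleftrightarrow> rpoly p \<and> (\<forall>c x. p (c *\<^sub>R x) = c ^ k * p x)"

lemma homog_rpoly [simp]: "homog k p \<Longrightarrow> rpoly p"
  and homogD: "homog k p \<Longrightarrow> p (c *\<^sub>R x) = c ^ k * p x"
  by (auto simp: homog_def)

lemma homog_0_const: "homog 0 p \<Longrightarrow> p x = p 0"
  using homogD[of 0 p 0 x] by simp

lemma homog_at_0: "homog k p \<Longrightarrow> k > 0 \<Longrightarrow> p 0 = 0"
  using homogD[of k p 0 0] by (auto simp: power_0_left)

lemma homog_zero [simp]: "homog k (\<lambda>x. 0)"
  and homog_const [simp]: "homog 0 (\<lambda>x. c)"
  and homog_coord [simp]: "homog (Suc 0) (\<lambda>x. x $ i)"
  and homog_inner [simp]: "homog (Suc 0) (\<lambda>x. v \<bullet> x)"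
  and homog_inner_self [simp]: "homog 2 (\<lambda>x. x \<bullet> x)"
  by (auto simp: homog_def power2_eq_square)

lemma homog_add: "homog k p \<Longrightarrow> homog k q \<Longrightarrow> homog k (\<lambda>x. p x + q x)"
  and homog_diff: "homog k p \<Longrightarrow> homog k q \<Longrightarrow> homog k (\<lambda>x. p x - q x)"
  and homog_cmult: "homog k p \<Longrightarrow> homog k (\<lambda>x. c * p x)"
  and homog_mult: "homog k p \<Longrightarrow> homog m q \<Longrightarrow> homog (k + m) (\<lambda>x. p x * q x)"
  by (auto simp: homog_def algebra_simps power_add)

lemma homog_sum: "(\<And>i. i \<in> A \<Longrightarrow> homog k (g i)) \<Longrightarrow> homog k (\<lambda>x. \<Sum>i\<in>A. g i x)"
  by (induction A rule: infinite_finite_induct) (simp_all add: homog_add)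

text \<open>Euler's identity: differentiate \<open>p (c x) = c ^ k p x\<close> in c at c =
  1.\<close>

lemma euler:
  assumes "homog k p"
  shows "(\<Sum>i\<in>UNIV. x $ i * pd i p x) = real k * p x"
proof -
  have "((\<lambda>c::real. c *\<^sub>R x) has_derivative (\<lambda>c. c *\<^sub>R x)) (at 1)"
    by (auto intro!: derivative_eq_intros)
  from diff_chain_at[OF this rpoly_has_derivative]
  have "((\<lambda>c. p (c *\<^sub>R x)) has_derivative (\<lambda>c. \<Sum>i\<in>UNIV. (c *\<^sub>R x) $ i * pd i p (1 *\<^sub>R x))) (at 1)"
    using assms by (simp add: o_def)
  moreover have "(\<lambda>c. \<Sum>i\<in>UNIV. (c *\<^sub>R x) $ i * pd i p (1 *\<^sub>R x))
      = (*) (\<Sum>i\<in>UNIV. x $ i * pd i p x)"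
    by (auto simp: fun_eq_iff sum_distrib_left mult_ac)
  ultimately have "((\<lambda>c. p (c *\<^sub>R x)) has_real_derivative (\<Sum>i\<in>UNIV. x $ i * pd i p x)) (at 1)"
    by (simp add: has_field_derivative_def)
  moreover have "((\<lambda>c. c ^ k * p x) has_real_derivative (real k * p x)) (at 1)"
    by (auto intro!: derivative_eq_intros)
  ultimately show ?thesis
    using homogD[OF assms] by (simp add: DERIV_unique)
qed

lemma homog_pd_scale:
  assumes "homog k p"
  shows "c * pd i p (c *\<^sub>R x) = c ^ k * pd i p x"
proof -
  have "(\<lambda>x. p (c *\<^sub>R x)) = (\<lambda>x. c ^ k * p x)"
    using homogD[OF assms] by simp
  then have "pd i (\<lambda>x. p (c *\<^sub>R x)) x = pd i (\<lambda>x. c ^ k * p x) x"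
    by simp
  then show ?thesis
    using assms pd_affine[of p i 0 c] by simp
qed

text \<open>In \<open>homog_pd_scale\<close> the factor c can be cancelled only for nonzero c.
  Homogeneity includes c = 0, which is reached by continuity, the nonzero reals being dense.\<close>

lemma homog_pd:
  assumes "homog (Suc k) p"
  shows "homog k (pd i p)"
proof -
  have "pd i p (c *\<^sub>R x) = c ^ k * pd i p x" for c x
  proof -
    have cont: "continuous_on UNIV (\<lambda>c. pd i p (c *\<^sub>R x) - c ^ k * pd i p x)"
      using assms by (intro continuous_intros continuous_on_compose2[OF rpoly_continuous[of "pd i p" UNIV]]) auto
    have "closed {c \<in> UNIV. pd i p (c *\<^sub>R x) - c ^ k * pd i p x = 0}"
      by (rule continuous_closed_preimage_constant[OF cont]) simp
    moreover have "- {0::real} \<subseteq> {c \<in> UNIV. pd i p (c *\<^sub>R x) - c ^ k * pd i p x = 0}"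
      using homog_pd_scale[OF assms] by auto
    ultimately have "closure (- {0::real}) \<subseteq> {c \<in> UNIV. pd i p (c *\<^sub>R x) - c ^ k * pd i p x = 0}"
      by (rule closure_minimal[rotated])
    then show ?thesis by (auto simp: closure_complement)
  qed
  with assms show ?thesis by (simp add: homog_def)
qed

lemma homog_pd_0: "homog 0 p \<Longrightarrow> pd i p = (\<lambda>x. 0)"
  using pd_const[of i "p 0"] homog_0_const[of p] by (metis ext)

lemma lap_homog_scale:
  assumes "homog k p"
  shows "c\<^sup>2 * lap p (c *\<^sub>R x) = c ^ k * lap p x"
proof -
  have "(\<lambda>x. p (c *\<^sub>R x)) = (\<lambda>x. c ^ k * p x)"
    using homogD[OF assms] by simp
  then have "lap (\<lambda>x. p (c *\<^sub>R x)) x = lap (\<lambda>x. c ^ k * p x) x"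
    by simp
  then show ?thesis
    using assms lap_affine[of p 0 c x] by (simp add: lap_cmult)
qed

text \<open>The vanishing of \<open>q k\<close> beyond N is carried along because sums of different
  lengths have to be padded and the product is a Cauchy product of the two families.\<close>

lemma rpoly_homog_decomp:
  "rpoly p \<Longrightarrow> \<exists>N q. (\<forall>k. homog k (q k)) \<and> (\<forall>k>N. q k = (\<lambda>x. 0)) \<and>
     p = (\<lambda>x. \<Sum>k\<le>N. q k x)"
proof (induction rule: real_polynomial_function.induct)
  case (linear f)
  have "homog (Suc 0) f"
    using linear by (simp add: homog_def real_polynomial_function.intros(1)
        bounded_linear.linear linear_scale)
  then show ?case
    by (intro exI[of _ 1] exI[of _ "\<lambda>k. if k = Suc 0 then f else (\<lambda>x. 0)"]) auto
next
  case (const c)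
  then show ?case
    by (intro exI[of _ 0] exI[of _ "\<lambda>k. if k = 0 then (\<lambda>x. c) else (\<lambda>x. 0)"]) auto
next
  case (add f g)
  obtain N q where q: "\<forall>k. homog k (q k)" "\<forall>k>N. q k = (\<lambda>x. 0)" "f = (\<lambda>x. \<Sum>k\<le>N. q k x)"
    using add.IH(1) by blast
  obtain M r where r: "\<forall>k. homog k (r k)" "\<forall>k>M. r k = (\<lambda>x. 0)" "g = (\<lambda>x. \<Sum>k\<le>M. r k x)"
    using add.IH(2) by blast
  have *: "homog k (q k)" "k > N \<Longrightarrow> q k = (\<lambda>x. 0)" "f = (\<lambda>x. \<Sum>k\<le>N. q k x)"
    "homog k (r k)" "k > M \<Longrightarrow> r k = (\<lambda>x. 0)" "g = (\<lambda>x. \<Sum>k\<le>M. r k x)" for k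
    using q r by auto
  have "(\<Sum>k\<le>N. q k x) = (\<Sum>k\<le>N + M. q k x)" "(\<Sum>k\<le>M. r k x) = (\<Sum>k\<le>N + M. r k x)" for x
    using *(2,5) by (auto intro!: sum.mono_neutral_left simp flip: not_less)
  then show ?case
    using * by (intro exI[of _ "N + M"] exI[of _ "\<lambda>k x. q k x + r k x"])
      (auto simp: homog_add sum.distrib)
next
  case (mult f g)
  obtain N q where q: "\<forall>k. homog k (q k)" "\<forall>k>N. q k = (\<lambda>x. 0)" "f = (\<lambda>x. \<Sum>k\<le>N. q k x)"
    using mult.IH(1) by blast
  obtain M r where r: "\<forall>k. homog k (r k)" "\<forall>k>M. r k = (\<lambda>x. 0)" "g = (\<lambda>x. \<Sum>k\<le>M. r k x)"
    using mult.IH(2) by blast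
  have *: "homog k (q k)" "k > N \<Longrightarrow> q k = (\<lambda>x. 0)" "f = (\<lambda>x. \<Sum>k\<le>N. q k x)"
    "homog k (r k)" "k > M \<Longrightarrow> r k = (\<lambda>x. 0)" "g = (\<lambda>x. \<Sum>k\<le>M. r k x)" for k
    using q r by auto
  \<comment> \<open>\<open>polynomial_product\<close> evaluated at the point 1 is the Cauchy product
    of two finite sums.\<close>
  have eq: "f x * g x = (\<Sum>k\<le>N + M. \<Sum>i\<le>k. q i x * r (k - i) x)" for x
    using polynomial_product[of N "\<lambda>i. q i x" M "\<lambda>i. r i x" 1] * by simp
  have hom: "homog k (\<lambda>x. \<Sum>i\<le>k. q i x * r (k - i) x)" for k
  proof (rule homog_sum)
    fix i assume "i \<in> {..k}"
    then show "homog k (\<lambda>x. q i x * r (k - i) x)"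
      using homog_mult[OF *(1)[of i] *(4)[of "k - i"]] by simp
  qed
  have van: "(\<lambda>x. \<Sum>i\<le>k. q i x * r (k - i) x) = (\<lambda>x. 0)" if "k > N + M" for k
  proof
    fix x
    have "q i x * r (k - i) x = 0" for i
      using that *(2)[of i] *(5)[of "k - i"] by (cases "i > N") auto
    then show "(\<Sum>i\<le>k. q i x * r (k - i) x) = 0" by (intro sum.neutral) blast
  qed
  show ?case
    using hom van eq by (intro exI[of _ "N + M"] exI[of _ "\<lambda>k x. \<Sum>i\<le>k. q i x * r (k - i) x"]) auto
qed

subsection \<open>Harmonic polynomials\<close>

lemma sph_harm_iff: "Y \<in> sph_harm l \<longleftrightarrow> homog l Y \<and> (\<forall>x. lap Y x = 0)"
  by (auto simp: sph_harm_def homog_def)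

lemma sph_harm_homog: "Y \<in> sph_harm l \<Longrightarrow> homog l Y"
  and sph_harm_rpoly [simp]: "Y \<in> sph_harm l \<Longrightarrow> rpoly Y"
  and sph_harm_lap: "Y \<in> sph_harm l \<Longrightarrow> lap Y x = 0"
  by (auto simp: sph_harm_iff)

lemma sph_harm_zero [simp]: "(\<lambda>x. 0) \<in> sph_harm l"
  by (simp add: sph_harm_iff)

lemma sph_harm_add: "Y \<in> sph_harm l \<Longrightarrow> Z \<in> sph_harm l \<Longrightarrow> (\<lambda>x. Y x + Z x) \<in> sph_harm l"
  and sph_harm_diff: "Y \<in> sph_harm l \<Longrightarrow> Z \<in> sph_harm l \<Longrightarrow> (\<lambda>x. Y x - Z x) \<in> sph_harm l"
  and sph_harm_cmult: "Y \<in> sph_harm l \<Longrightarrow> (\<lambda>x. c * Y x) \<in> sph_harm l"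
  by (auto simp: sph_harm_iff homog_add homog_diff homog_cmult lap_add lap_diff lap_cmult)

lemma sph_harm_sum:
  "(\<And>i. i \<in> A \<Longrightarrow> g i \<in> sph_harm l) \<Longrightarrow> (\<lambda>x. \<Sum>i\<in>A. g i x) \<in> sph_harm l"
  by (induction A rule: infinite_finite_induct) (simp_all add: sph_harm_add)

lemma sph_harm_inner: "(\<lambda>x. v \<bullet> x) \<in> sph_harm 1"
  by (simp add: sph_harm_iff lap_def)

lemma sph_harm_const: "(\<lambda>x. c) \<in> sph_harm 0"
  by (simp add: sph_harm_iff)

lemma sph_harm_pd:
  assumes Y: "Y \<in> sph_harm (Suc l)"
  shows "pd i Y \<in> sph_harm l"
proof -
  from Y have "lap Y = (\<lambda>x. 0)" by (auto simp: sph_harm_lap)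
  with Y lap_pd[of Y i] show ?thesis by (simp add: sph_harm_iff homog_pd)
qed

section \<open>Directional derivatives and multiplication by a linear form\<close>

definition dird :: "real^'n \<Rightarrow> (real^'n::finite \<Rightarrow> real) \<Rightarrow> real^'n \<Rightarrow> real" where
  "dird v p x = (\<Sum>i\<in>UNIV. v $ i * pd i p x)"

lemma sph_harm_dird: "Y \<in> sph_harm (Suc l) \<Longrightarrow> dird v Y \<in> sph_harm l"
  unfolding dird_def[abs_def] by (intro sph_harm_sum sph_harm_cmult sph_harm_pd)

lemma rpoly_dird [simp]: "rpoly p \<Longrightarrow> rpoly (dird v p)"
  unfolding dird_def[abs_def] by simp

text \<open>The part of degree \<open>l + 1\<close> of the product \<open>(v . x) Y\<close>. On the
  unit sphere the remainder is a multiple of \<open>dird v Y\<close>, of degree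
  \<open>l - 1\<close>; this is why a linear form couples neighbouring degrees only.\<close>

definition raise :: "real^'n \<Rightarrow> nat \<Rightarrow> (real^'n::finite \<Rightarrow> real) \<Rightarrow> real^'n \<Rightarrow> real" where
  "raise v l Y x = (v \<bullet> x) * Y x - (x \<bullet> x) * dird v Y x / (real CARD('n) + 2 * real l - 2)"

lemma sph_harm_raise:
  fixes Y :: "real^'n::finite \<Rightarrow> real"
  assumes Y: "Y \<in> sph_harm (Suc l)" and n: "CARD('n) \<ge> 2"
  shows "raise v (Suc l) Y \<in> sph_harm (Suc (Suc l))"
proof -
  define W where "W = dird v Y"
  define m where "m = real CARD('n) + 2 * real (Suc l) - 2"
  have m: "m > 0" using n by (simp add: m_def)
  have W: "W \<in> sph_harm l" unfolding W_def by (rule sph_harm_dird[OF Y])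
  have eq: "raise v (Suc l) Y = (\<lambda>x. (v \<bullet> x) * Y x - (1 / m) * ((x \<bullet> x) * W x))"
    by (simp add: raise_def[abs_def] W_def m_def)
  have "homog (Suc 0 + Suc l) (\<lambda>x. (v \<bullet> x) * Y x)"
    by (intro homog_mult homog_inner sph_harm_homog Y)
  moreover have "homog (2 + l) (\<lambda>x. (x \<bullet> x) * W x)"
    by (intro homog_mult homog_inner_self sph_harm_homog W)
  ultimately have hom: "homog (Suc (Suc l)) (raise v (Suc l) Y)"
    unfolding eq by (intro homog_diff homog_cmult) auto
  have l1: "lap (\<lambda>x. (v \<bullet> x) * Y x) x = 2 * W x" for x
    using Y by (simp add: lap_mult sph_harm_lap sph_harm_lap[OF sph_harm_inner] W_def dird_def)
  have l2: "lap (\<lambda>x. x \<bullet> x) x = 2 * real CARD('n)" for x :: "real^'n"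
    by (simp add: lap_def)
  have "lap (\<lambda>x. (x \<bullet> x) * W x) x = 2 * real CARD('n) * W x + 2 * (\<Sum>i\<in>UNIV. 2 * x $ i * pd i W x)" for x
    using W by (simp add: lap_mult sph_harm_lap l2)
  moreover have "(\<Sum>i\<in>UNIV. 2 * x $ i * pd i W x) = 2 * (real l * W x)" for x
    using euler[OF sph_harm_homog[OF W], of x] by (simp add: sum_distrib_left[symmetric] mult.assoc)
  \<comment> \<open>The dimension contributes 2 n and Euler's identity for W contributes 4 l;
    together this is twice the denominator of \<open>raise\<close>, which is what cancels
    \<open>l1\<close>.\<close>
  ultimately have l3: "lap (\<lambda>x. (x \<bullet> x) * W x) x = 2 * m * W x" for x
    by (simp add: m_def algebra_simps)
  have "lap (raise v (Suc l) Y) x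
      = lap (\<lambda>x. (v \<bullet> x) * Y x) x - (1 / m) * lap (\<lambda>x. (x \<bullet> x) * W x) x" for x
    unfolding eq using Y W by (subst lap_diff; simp add: lap_cmult del: times_divide_eq_left)
  then have "lap (raise v (Suc l) Y) x = 0" for x
    using m by (simp add: l1 l3)
  with hom show ?thesis by (simp add: sph_harm_iff)
qed

text \<open>Euler's identity and its derivative evaluate the Hessian term as
  \<open>l (l - 1) Y\<close> and the radial term as \<open>(n - 1) l Y\<close>; they add up to the
  eigenvalue.\<close>

lemma lapS_sph_harm:
  fixes Y :: "real^'n::finite \<Rightarrow> real"
  assumes Y: "Y \<in> sph_harm l"
  shows "lapS Y x = - eig TYPE('n) l * Y x"
proof -
  have h: "homog l Y" by (rule sph_harm_homog[OF Y])
  have "(\<lambda>x. \<Sum>j\<in>UNIV. x $ j * pd j Y x) = (\<lambda>x. real l * Y x)"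
    using euler[OF h] by blast
  then have "pd i (\<lambda>x. \<Sum>j\<in>UNIV. x $ j * pd j Y x) x = real l * pd i Y x" for i
    using h by simp
  then have 1: "pd i Y x + (\<Sum>j\<in>UNIV. x $ j * pd i (pd j Y) x) = real l * pd i Y x" for i
    using Y by (simp add: sum.distrib if_distribR sum.delta if_distrib[of "\<lambda>a. a * _"] cong: if_cong)
  have "(\<Sum>i\<in>UNIV. \<Sum>j\<in>UNIV. x $ i * x $ j * pd i (pd j Y) x)
      = (\<Sum>i\<in>UNIV. x $ i * (real l * pd i Y x - pd i Y x))"
  proof (rule sum.cong)
    fix i
    have "(\<Sum>j\<in>UNIV. x $ i * x $ j * pd i (pd j Y) x) = x $ i * (\<Sum>j\<in>UNIV. x $ j * pd i (pd j Y) x)"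
      by (simp add: sum_distrib_left mult.assoc)
    then show "(\<Sum>j\<in>UNIV. x $ i * x $ j * pd i (pd j Y) x) = x $ i * (real l * pd i Y x - pd i Y x)"
      using 1[of i] by simp
  qed simp
  also have "\<dots> = (real l - 1) * (\<Sum>i\<in>UNIV. x $ i * pd i Y x)"
    by (simp add: sum_distrib_left algebra_simps)
  also have "\<dots> = (real l - 1) * (real l * Y x)"
    by (simp add: euler[OF h])
  finally show ?thesis
    using Y euler[OF h, of x]
    by (simp add: lapS_def sph_harm_lap eig_def grad_def inner_vec_def algebra_simps)
qed

lemma gradS_sph_harm:
  assumes "Y \<in> sph_harm l"
  shows "v \<bullet> gradS Y x = dird v Y x - real l * ((v \<bullet> x) * Y x)"
proof -
  have "x \<bullet> grad Y x = real l * Y x" "v \<bullet> grad Y x = dird v Y x"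
    using euler[OF sph_harm_homog[OF assms], of x] by (simp_all add: grad_def inner_vec_def dird_def)
  then show ?thesis
    by (simp add: gradS_def inner_diff_right)
qed

subsection \<open>Integrals over balls\<close>

definition ballint :: "real \<Rightarrow> (real^'n::finite \<Rightarrow> real) \<Rightarrow> real" where
  "ballint r g = (\<integral>x. indicat_real (ball 0 r) x * g x \<partial>lborel)"

text \<open>A class of integrands that contains the polynomials and also their compositions with the
  radial projection, which are in general discontinuous at the origin.\<close>

definition ballbdd :: "(real^'n::finite \<Rightarrow> real) \<Rightarrow> bool" where
  "ballbdd g \<longleftrightarrow> g \<in> borel_measurable borel \<and> (\<forall>r. \<exists>B. \<forall>x\<in>ball 0 r. \<bar>g x\<bar> \<le> B)"

lemma rpoly_measurable: "rpoly p \<Longrightarrow> p \<in> borel_measurable borel"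
  by (simp add: borel_measurable_continuous_onI rpoly_continuous)

lemma rpoly_bounded_ball: "rpoly p \<Longrightarrow> \<exists>B. \<forall>x\<in>cball 0 r. \<bar>p x\<bar> \<le> B"
proof -
  assume "rpoly p"
  then have "compact (p ` cball 0 r)"
    by (intro compact_continuous_image rpoly_continuous) auto
  then have "bounded (p ` cball 0 r)" by (rule compact_imp_bounded)
  then show ?thesis by (auto simp: bounded_iff)
qed

lemma ballbdd_rpoly [simp]: "rpoly p \<Longrightarrow> ballbdd p"
  unfolding ballbdd_def by (metis rpoly_bounded_ball rpoly_measurable ball_subset_cball subset_iff)

lemma ballbdd_radial [simp]:
  assumes "rpoly p"
  shows "ballbdd (\<lambda>x. p (x /\<^sub>R norm x))"
proof -
  obtain B where B: "\<And>x. x \<in> cball 0 1 \<Longrightarrow> \<bar>p x\<bar> \<le> B"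
    using rpoly_bounded_ball[OF assms, of 1] by blast
  have "\<bar>p (x /\<^sub>R norm x)\<bar> \<le> B" for x
    by (rule B) (cases "x = 0", auto)
  moreover have "(\<lambda>x. p (x /\<^sub>R norm x)) \<in> borel_measurable borel"
    using rpoly_measurable[OF assms] by measurable
  ultimately show ?thesis unfolding ballbdd_def by blast
qed

lemma ballbdd_abs: "ballbdd g \<Longrightarrow> ballbdd (\<lambda>x. \<bar>g x\<bar>)"
  by (auto simp: ballbdd_def intro: borel_measurable_abs)

lemma ballbdd_integrable:
  assumes "ballbdd g"
  shows "integrable lborel (\<lambda>x. indicat_real (ball 0 r) x * g x)"
proof -
  obtain B where B: "\<And>x. x \<in> ball 0 r \<Longrightarrow> \<bar>g x\<bar> \<le> B" and [measurable]: "g \<in> borel_measurable borel"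
    using assms unfolding ballbdd_def by metis
  show ?thesis
  proof (rule Bochner_Integration.integrable_bound)
    show "integrable lborel (\<lambda>x::real^'n. indicat_real (ball 0 r) x * B)"
      using emeasure_lborel_ball_finite[of "0::real^'n" r]
      by (intro integrable_mult_left) (simp add: integrable_indicator_iff)
    show "AE x in lborel. norm (indicat_real (ball 0 r) x * g x) \<le> norm (indicat_real (ball 0 r) x * B)"
      using B by (auto intro!: AE_I2 simp: indicator_def) fastforce
  qed (auto intro!: borel_measurable_times borel_measurable_indicator)
qed

lemma ballint_add: "ballbdd f \<Longrightarrow> ballbdd g \<Longrightarrow> ballint r (\<lambda>x. f x + g x) = ballint r f + ballint r g"
  and ballint_diff: "ballbdd f \<Longrightarrow> ballbdd g \<Longrightarrow> ballint r (\<lambda>x. f x - g x) = ballint r f - ballint r g"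
  and ballint_cmult: "ballint r (\<lambda>x. c * g x) = c * ballint r g"
  using ballbdd_integrable[of f r] ballbdd_integrable[of g r]
  by (simp_all add: ballint_def algebra_simps flip: integral_mult_right_zero)

lemma lborel_integral_affine:
  fixes g :: "real^'n::finite \<Rightarrow> real"
  assumes "c > 0" "g \<in> borel_measurable borel"
  shows "(\<integral>x. g x \<partial>lborel) = c ^ CARD('n) * (\<integral>x. g (a + c *\<^sub>R x) \<partial>lborel)"
proof -
  have "(\<integral>x. g x \<partial>lborel) = (\<integral>x. g x \<partial>density (distr lborel borel (\<lambda>x. a + c *\<^sub>R x)) (\<lambda>_. c ^ CARD('n)))"
    using lborel_affine[of c a] assms(1) by simp
  also have "\<dots> = (\<integral>x. c ^ CARD('n) * g (a + c *\<^sub>R x) \<partial>lborel)"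
    using assms by (subst integral_density) (auto simp: integral_distr)
  finally show ?thesis by simp
qed

lemma ballint_scale:
  fixes g :: "real^'n::finite \<Rightarrow> real"
  assumes "r > 0" "g \<in> borel_measurable borel"
  shows "ballint r g = r ^ CARD('n) * ballint 1 (\<lambda>x. g (r *\<^sub>R x))"
proof -
  have "indicat_real (ball 0 r) (r *\<^sub>R x) = indicat_real (ball 0 1) x" for x :: "real^'n"
    using assms(1) by (simp add: indicator_def)
  with assms show ?thesis
    unfolding ballint_def by (subst lborel_integral_affine[of r _ 0])
      (auto intro!: borel_measurable_times borel_measurable_indicator)
qed

lemma ballint_homog:
  fixes g :: "real^'n::finite \<Rightarrow> real"
  assumes "r > 0" "homog m g"
  shows "ballint r g = r ^ (CARD('n) + m) * ballint 1 g"
  using ballint_scale[OF assms(1), of g] assms by (simp add: rpoly_measurable homogD ballint_cmult power_add)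

definition ballvol :: "'n::finite itself \<Rightarrow> real" where
  "ballvol _ = measure lborel (ball (0::real^'n) 1)"

lemma ballvol_pos: "ballvol TYPE('n::finite) > 0"
  unfolding ballvol_def by (simp add: content_ball_pos)

definition sph_mean :: "(real^'n::finite \<Rightarrow> real) \<Rightarrow> real" where
  "sph_mean g = (\<integral>x. g x \<partial>sph)"

definition ballavg :: "(real^'n::finite \<Rightarrow> real) \<Rightarrow> real" where
  "ballavg g = ballint 1 g / ballvol TYPE('n)"

lemma sph_measurable_projection [measurable]:
  "(\<lambda>x::real^'n::finite. x /\<^sub>R norm x) \<in> uniform_measure lborel (ball 0 1) \<rightarrow>\<^sub>M borel"
  by (auto simp: uniform_measure_def)

lemma sets_sph [simp, measurable_cong]: "sets (sph :: (real^'n::finite) measure) = sets borel"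
  and space_sph [simp]: "space (sph :: (real^'n::finite) measure) = UNIV"
  by (simp_all add: sph_def)

lemma emeasure_unit_ball: "emeasure lborel (ball (0::real^'n::finite) 1) = ennreal (ballvol TYPE('n))"
  using emeasure_lborel_ball_finite[of "0::real^'n" 1]
  by (simp add: ballvol_def emeasure_eq_ennreal_measure)

lemma sph_mean_ballavg:
  fixes g :: "real^'n::finite \<Rightarrow> real"
  assumes g: "g \<in> borel_measurable borel"
  shows "sph_mean g = ballavg (\<lambda>x. g (x /\<^sub>R norm x))"
proof -
  let ?V = "ballvol TYPE('n)"
  have [measurable]: "(\<lambda>x. g (x /\<^sub>R norm x)) \<in> borel_measurable borel"
    using g by measurable
  have um: "uniform_measure lborel (ball (0::real^'n) 1)
      = density lborel (\<lambda>x. ennreal (indicat_real (ball 0 1) x / ?V))"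
    unfolding uniform_measure_def emeasure_unit_ball using ballvol_pos[where 'n='n]
    by (intro arg_cong2[where f=density] refl ext)
      (auto simp: indicator_def divide_ennreal[of 1, symmetric])
  have "sph_mean g = (\<integral>x. g (x /\<^sub>R norm x) \<partial>uniform_measure lborel (ball 0 1))"
    unfolding sph_mean_def sph_def using g by (simp add: integral_distr)
  also have "\<dots> = (\<integral>x. indicat_real (ball 0 1) x / ?V * g (x /\<^sub>R norm x) \<partial>lborel)"
    unfolding um using ballvol_pos[where 'n='n] by (subst integral_density)
      (auto intro!: borel_measurable_divide borel_measurable_indicator)
  also have "\<dots> = ballavg (\<lambda>x. g (x /\<^sub>R norm x))"
    by (simp add: ballavg_def ballint_def)
  finally show ?thesis .
qed

lemma prob_space_sph: "emeasure sph (space (sph :: (real^'n::finite) measure)) = 1"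
proof -
  have "emeasure sph (space (sph :: (real^'n) measure))
      = emeasure (uniform_measure lborel (ball (0::real^'n) 1)) UNIV"
    unfolding sph_def by (subst emeasure_distr) auto
  also have "\<dots> = 1"
    using ballvol_pos[where 'n='n]
    by (simp add: emeasure_uniform_measure emeasure_unit_ball divide_ennreal ennreal_divide_self)
  finally show ?thesis .
qed

lemma AE_sph: "AE x in (sph :: (real^'n::finite) measure). x \<in> sphere 0 1"
proof -
  \<comment> \<open>The radial projection maps the origin to 0, which is off the sphere.\<close>
  have "AE x in lborel. x \<noteq> (0::real^'n)"
    by (rule AE_lborel_singleton)
  then have "AE x in uniform_measure lborel (ball (0::real^'n) 1). x /\<^sub>R norm x \<in> sphere 0 1"
    by (intro AE_uniform_measureI) (auto elim!: eventually_mono)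
  then show ?thesis
    unfolding sph_def by (subst AE_distr_iff) auto
qed

text \<open>This replaces polar coordinates. Q and its radial projection h scale with exponents n +
  m and n. On the shell between radii r and 1 they differ by at most the factor
  \<open>1 - r ^ m\<close>, so their shell integrals agree to first order as r tends to 1; comparing
  the leading terms gives the identity.\<close>

lemma ballint_eq_sph_mean:
  fixes Q :: "real^'n::finite \<Rightarrow> real"
  assumes Q: "homog m Q"
  shows "(real CARD('n) + real m) * ballavg Q = real CARD('n) * sph_mean Q"
proof -
  define n where "n = CARD('n)"
  define h where "h = (\<lambda>x. Q (x /\<^sub>R norm x))"
  have h: "ballbdd h" "ballbdd (\<lambda>x. \<bar>h x\<bar>)" "ballbdd Q"
    using Q by (auto simp: h_def ballbdd_abs)
  then have hm: "h \<in> borel_measurable borel" by (simp add: ballbdd_def)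
  have Qh: "Q x = norm x ^ m * h x" for x
    using homogD[OF Q, of "norm x" "x /\<^sub>R norm x"] by (cases "x = 0") (auto simp: h_def)
  have hr: "h (r *\<^sub>R x) = h x" if "r > 0" for r x
    using that by (simp add: h_def field_simps)
  have sc: "ballint r Q = r ^ (n + m) * ballint 1 Q" "ballint r h = r ^ n * ballint 1 h"
      "ballint r (\<lambda>x. \<bar>h x\<bar>) = r ^ n * ballint 1 (\<lambda>x. \<bar>h x\<bar>)" if "r > 0" for r
    using ballint_homog[OF that Q] ballint_scale[OF that, of h] ballint_scale[OF that, of "\<lambda>x. \<bar>h x\<bar>"] that hm
    by (simp_all add: hr n_def)
  let ?s = "\<lambda>k r. \<Sum>i<k. (r::real) ^ i"
  let ?A = "ballint 1 Q" and ?B = "ballint 1 h" and ?C = "ballint 1 (\<lambda>x. \<bar>h x\<bar>)"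
  have key: "\<bar>?s (n + m) r * ?A - ?s n r * ?B\<bar> \<le> (1 - r ^ m) * ?s n r * ?C" if r: "0 < r" "r < 1" for r
  proof -
    let ?I = "\<lambda>r x. indicat_real (ball 0 r) (x::real^'n)"
    have int: "integrable lborel (\<lambda>x. ?I r x * g x)" if "ballbdd g" for r g
      using ballbdd_integrable[OF that] .
    have "(?A - ballint r Q) - (?B - ballint r h)
        = (\<integral>x. (?I 1 x - ?I r x) * (Q x - h x) \<partial>lborel)"
      unfolding ballint_def using int[OF h(1)] int[OF h(3)]
      by (simp add: algebra_simps)
    also have "\<bar>\<dots>\<bar> \<le> (\<integral>x. \<bar>(?I 1 x - ?I r x) * (Q x - h x)\<bar> \<partial>lborel)"
      by (rule integral_abs_bound)
    also have "\<dots> \<le> (\<integral>x. (1 - r ^ m) * ((?I 1 x - ?I r x) * \<bar>h x\<bar>) \<partial>lborel)"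
    proof (rule integral_mono)
      show "integrable lborel (\<lambda>x. \<bar>(?I 1 x - ?I r x) * (Q x - h x)\<bar>)"
        using int[OF h(1)] int[OF h(3)] by (simp add: algebra_simps)
      show "integrable lborel (\<lambda>x. (1 - r ^ m) * ((?I 1 x - ?I r x) * \<bar>h x\<bar>))"
        using int[OF h(2)] by (intro integrable_mult_right) (simp add: algebra_simps)
      fix x :: "real^'n"
      show "\<bar>(?I 1 x - ?I r x) * (Q x - h x)\<bar> \<le> (1 - r ^ m) * ((?I 1 x - ?I r x) * \<bar>h x\<bar>)"
      proof (cases "norm x < 1 \<and> \<not> norm x < r")
        case True
        have "r ^ m \<le> norm x ^ m" "norm x ^ m \<le> 1"
          using True r by (auto intro: power_mono power_le_one)
        moreover have "Q x - h x = - ((1 - norm x ^ m) * h x)"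
          by (simp add: Qh algebra_simps)
        ultimately have "\<bar>Q x - h x\<bar> \<le> (1 - r ^ m) * \<bar>h x\<bar>"
          by (simp add: abs_mult mult_right_mono)
        with True show ?thesis by simp
      next
        case False
        with r show ?thesis by (auto simp: indicator_def)
      qed
    qed
    also have "\<dots> = (1 - r ^ m) * (?C - ballint r (\<lambda>x. \<bar>h x\<bar>))"
      unfolding ballint_def integral_mult_right_zero left_diff_distrib[of "?I 1 _"]
      by (subst Bochner_Integration.integral_diff[OF int[OF h(2)] int[OF h(2)]]) (rule refl)
    finally have "\<bar>(1 - r ^ (n + m)) * ?A - (1 - r ^ n) * ?B\<bar> \<le> (1 - r ^ m) * ((1 - r ^ n) * ?C)"
      unfolding sc[OF r(1)] by (simp add: algebra_simps)
    \<comment> \<open>Factoring 1 - r out of the differences of powers leaves geometric sums, whose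
      values at r = 1 are the numbers n + m and n.\<close>
    then have "\<bar>(1 - r) * (?s (n + m) r * ?A - ?s n r * ?B)\<bar> \<le> (1 - r) * ((1 - r ^ m) * ?s n r * ?C)"
      by (simp only: one_diff_power_eq[of r "n + m"] one_diff_power_eq[of r n]) (simp add: algebra_simps)
    with r show ?thesis by (simp add: abs_mult)
  qed
  have "((\<lambda>r. \<bar>?s (n + m) r * ?A - ?s n r * ?B\<bar>) \<longlongrightarrow> \<bar>?s (n + m) 1 * ?A - ?s n 1 * ?B\<bar>) (at_left 1)"
    by (intro tendsto_intros)
  moreover have "((\<lambda>r. (1 - r ^ m) * ?s n r * ?C) \<longlongrightarrow> (1 - 1 ^ m) * ?s n 1 * ?C) (at_left 1)"
    by (intro tendsto_intros)
  moreover have "\<forall>\<^sub>F r in at_left 1. \<bar>?s (n + m) r * ?A - ?s n r * ?B\<bar> \<le> (1 - r ^ m) * ?s n r * ?C"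
    using key by (intro eventually_at_leftI[of 0]) auto
  ultimately have "\<bar>?s (n + m) 1 * ?A - ?s n 1 * ?B\<bar> \<le> (1 - 1 ^ m) * ?s n 1 * ?C"
    by (intro tendsto_le[of "at_left (1::real)"]) auto
  then have "(real n + real m) * ?A = real n * ?B" by simp
  then show ?thesis
    using Q by (simp add: rpoly_measurable sph_mean_ballavg ballavg_def h_def n_def)
qed

subsection \<open>States: normalised positive functionals on polynomials over the sphere\<close>

text \<open>The common form of the initial measure and of the later densities. Positivity is
  required for polynomials that are nonnegative on the sphere, so a state cannot distinguish
  polynomials that agree there (\<open>state_cong\<close>).\<close>

definition state :: "((real^'n::finite \<Rightarrow> real) \<Rightarrow> real) \<Rightarrow> bool" where
  "state \<Lambda> \<longleftrightarrow> (\<forall>p q. rpoly p \<longrightarrow> rpoly q \<longrightarrow> \<Lambda> (\<lambda>x. p x + q x) = \<Lambda> p + \<Lambda> q)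
     \<and> (\<forall>p c. rpoly p \<longrightarrow> \<Lambda> (\<lambda>x. c * p x) = c * \<Lambda> p)
     \<and> (\<forall>p. rpoly p \<longrightarrow> (\<forall>x\<in>sphere 0 1. 0 \<le> p x) \<longrightarrow> 0 \<le> \<Lambda> p) \<and> \<Lambda> (\<lambda>x. 1) = 1"

context
  fixes \<Lambda> :: "(real^'n::finite \<Rightarrow> real) \<Rightarrow> real"
  assumes st: "state \<Lambda>"
begin

lemma state_add: "rpoly p \<Longrightarrow> rpoly q \<Longrightarrow> \<Lambda> (\<lambda>x. p x + q x) = \<Lambda> p + \<Lambda> q"
  and state_cmult: "rpoly p \<Longrightarrow> \<Lambda> (\<lambda>x. c * p x) = c * \<Lambda> p"
  and state_nonneg: "rpoly p \<Longrightarrow> (\<And>x. norm x = 1 \<Longrightarrow> 0 \<le> p x) \<Longrightarrow> 0 \<le> \<Lambda> p"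
  and state_one: "\<Lambda> (\<lambda>x. 1) = 1"
  using st unfolding state_def by auto

lemma state_const: "\<Lambda> (\<lambda>x. c) = c"
  using state_cmult[of "\<lambda>x. 1" c] state_one by simp

lemma state_diff: "rpoly p \<Longrightarrow> rpoly q \<Longrightarrow> \<Lambda> (\<lambda>x. p x - q x) = \<Lambda> p - \<Lambda> q"
  using state_add[of p "\<lambda>x. -1 * q x"] state_cmult[of q "-1"] by simp

lemma state_sum: "(\<And>k. k \<in> A \<Longrightarrow> rpoly (g k)) \<Longrightarrow> \<Lambda> (\<lambda>x. \<Sum>k\<in>A. g k x) = (\<Sum>k\<in>A. \<Lambda> (g k))"
  by (induction A rule: infinite_finite_induct) (simp_all add: state_const state_add)

lemma state_mono:
  "rpoly p \<Longrightarrow> rpoly q \<Longrightarrow> (\<And>x. norm x = 1 \<Longrightarrow> p x \<le> q x) \<Longrightarrow> \<Lambda> p \<le> \<Lambda> q"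
  using state_nonneg[of "\<lambda>x. q x - p x"] state_diff[of q p] by simp

lemma state_cong:
  "rpoly p \<Longrightarrow> rpoly q \<Longrightarrow> (\<And>x. norm x = 1 \<Longrightarrow> p x = q x) \<Longrightarrow> \<Lambda> p = \<Lambda> q"
  using state_mono[of p q] state_mono[of q p] by (simp add: antisym)

end

text \<open>One construction for three cases: \<open>sph\<close> with density 1, \<open>sph\<close>
  with the density of the solution, and the initial measure with density 1.\<close>

lemma state_integral:
  fixes M :: "(real^'n::finite) measure" and f :: "real^'n \<Rightarrow> real"
  assumes M: "sets M = sets borel" "AE x in M. x \<in> sphere 0 1"
    and f: "integrable M f" "AE x in M. 0 \<le> f x" "(\<integral>x. f x \<partial>M) = 1"
  shows "state (\<lambda>p. \<integral>x. p x * f x \<partial>M)"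
proof -
  have int: "integrable M (\<lambda>x. p x * f x)" if p: "rpoly p" for p
  proof -
    obtain B where B: "\<And>x. x \<in> cball 0 1 \<Longrightarrow> \<bar>p x\<bar> \<le> B"
      using rpoly_bounded_ball[OF p, of 1] by blast
    show ?thesis
    proof (rule Bochner_Integration.integrable_bound)
      show "integrable M (\<lambda>x. B * f x)" using f(1) by simp
      have "p \<in> borel_measurable M"
        using rpoly_measurable[OF p] M(1) by (simp cong: measurable_cong_sets)
      then show "(\<lambda>x. p x * f x) \<in> borel_measurable M" using f(1) by measurable
      show "AE x in M. norm (p x * f x) \<le> norm (B * f x)"
        using M(2)
      proof eventually_elim
        case (elim x)
        then have "\<bar>p x\<bar> \<le> \<bar>B\<bar>" using B[of x] by simp
        then show ?case by (simp add: abs_mult mult_right_mono)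
      qed
    qed
  qed
  have "0 \<le> (\<integral>x. p x * f x \<partial>M)" if "rpoly p" "\<forall>x\<in>sphere 0 1. 0 \<le> p x" for p
    using M(2) f(2) that by (intro integral_nonneg_AE) (auto elim: eventually_elim2)
  then show ?thesis
    unfolding state_def using int f(3) by (auto simp: algebra_simps)
qed

lemma state_sph_mean: "state (sph_mean :: (real^'n::finite \<Rightarrow> real) \<Rightarrow> real)"
proof -
  have "finite_measure (sph :: (real^'n) measure)"
    using prob_space_sph[where 'n='n] by (intro finite_measureI) simp
  moreover have "measure (sph :: (real^'n) measure) UNIV = 1"
    using prob_space_sph[where 'n='n] by (simp add: measure_def)
  ultimately have "state (\<lambda>p. \<integral>x. p x * 1 \<partial>(sph :: (real^'n) measure))"
    using AE_sph by (intro state_integral) (auto simp: finite_measure.integrable_const)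
  then show ?thesis by (simp add: sph_mean_def[abs_def])
qed

lemmas sph_mean_add = state_add[OF state_sph_mean]
  and sph_mean_cmult = state_cmult[OF state_sph_mean]
  and sph_mean_nonneg = state_nonneg[OF state_sph_mean]
  and sph_mean_const [simp] = state_const[OF state_sph_mean]
  and sph_mean_diff = state_diff[OF state_sph_mean]
  and sph_mean_sum = state_sum[OF state_sph_mean]
  and sph_mean_mono = state_mono[OF state_sph_mean]
  and sph_mean_cong = state_cong[OF state_sph_mean]

subsection \<open>Integration by parts on the sphere\<close>

text \<open>Squaring removes the kink of the positive part at 0; this makes the cut-off weight used
  below differentiable across the unit sphere.\<close>

lemma has_derivative_max0_square:
  "((\<lambda>z::real. (max 0 z)\<^sup>2) has_real_derivative 2 * max 0 z) (at z)"
proof -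
  consider "z < 0" | "z = 0" | "z > 0" by linarith
  then show ?thesis
  proof cases
    case 1
    have "((\<lambda>z::real. 0) has_real_derivative 2 * max 0 z) (at z)" using 1 by simp
    then show ?thesis
      by (rule has_field_derivative_transform_within_open[where S="{..<0}"]) (use 1 in auto)
  next
    case 2
    have le: "norm ((max 0 h)\<^sup>2 / h) \<le> \<bar>h\<bar>" for h :: real
      by (cases "h \<le> 0") (auto simp: max_def power2_eq_square)
    have "((\<lambda>h::real. (max 0 h)\<^sup>2 / h) \<longlongrightarrow> 0) (at 0)"
    proof (rule Lim_null_comparison)
      show "\<forall>\<^sub>F h in at 0. norm ((max 0 h)\<^sup>2 / h) \<le> \<bar>h\<bar>"
        by (rule always_eventually) (use le in blast)
      show "((\<lambda>h::real. \<bar>h\<bar>) \<longlongrightarrow> 0) (at 0)"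
        by (rule tendsto_rabs_zero) (rule tendsto_ident_at)
    qed
    with 2 show ?thesis by (simp add: has_field_derivative_iff)
  next
    case 3
    have "((\<lambda>z::real. z\<^sup>2) has_real_derivative 2 * max 0 z) (at z)"
      using 3 by (auto intro!: derivative_eq_intros)
    then show ?thesis
      by (rule has_field_derivative_transform_within_open[where S="{0<..}"]) (use 3 in auto)
  qed
qed

lemma rpoly_line_derivative:
  assumes "rpoly p"
  shows "((\<lambda>t. p (x + t *\<^sub>R axis j 1)) has_real_derivative pd j p (x + t *\<^sub>R axis j 1)) (at t)"
proof -
  have "((\<lambda>t. x + t *\<^sub>R axis j 1) has_derivative (\<lambda>h. h *\<^sub>R axis j 1)) (at t)"
    by (auto intro!: derivative_eq_intros)
  from diff_chain_at[OF this rpoly_has_derivative[OF assms]]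
  have "((\<lambda>t. p (x + t *\<^sub>R axis j 1)) has_derivative
      (\<lambda>h. \<Sum>i\<in>UNIV. (h *\<^sub>R axis j 1) $ i * pd i p (x + t *\<^sub>R axis j 1))) (at t)"
    by (simp add: o_def)
  moreover have "(\<lambda>h. \<Sum>i\<in>UNIV. (h *\<^sub>R axis j 1) $ i * pd i p (x + t *\<^sub>R axis j 1))
      = (*) (pd j p (x + t *\<^sub>R axis j 1))"
    by (auto simp: fun_eq_iff axis_def if_distrib if_distribR sum.delta cong: if_cong)
  ultimately show ?thesis by (simp add: has_field_derivative_def)
qed

text \<open>The weight $(1-|x|^2)_+^2$ is continuously differentiable with compact support, so the
  integral of a partial derivative of its product with a polynomial vanishes by translation
  invariance.\<close>

lemma ballint_by_parts:
  fixes \<phi> :: "real^'n::finite \<Rightarrow> real"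
  assumes \<phi>: "rpoly \<phi>"
  shows "ballint 1 (\<lambda>x. (1 - x \<bullet> x)\<^sup>2 * pd j \<phi> x) = 4 * ballint 1 (\<lambda>x. (1 - x \<bullet> x) * (x $ j * \<phi> x))"
proof -
  define u where "u = (\<lambda>x::real^'n. max 0 (1 - x \<bullet> x))"
  define \<psi> where "\<psi> = (\<lambda>x. (u x)\<^sup>2 * \<phi> x)"
  \<comment> \<open>The j-th partial derivative of \<open>\<psi>\<close>; the factor 4 comes from
    differentiating the square and then \<open>x . x\<close>.\<close>
  define D where "D = (\<lambda>x. (u x)\<^sup>2 * pd j \<phi> x - 4 * (u x * (x $ j * \<phi> x)))"
  let ?e = "axis j 1 :: real^'n"
  have u0: "u x = 0" if "norm x \<ge> 1" for x
    using one_le_power[OF that, of 2] by (simp add: u_def dot_square_norm)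
  have cont_u: "continuous_on UNIV u"
    unfolding u_def by (intro continuous_intros)
  have cont_D: "continuous_on UNIV D" and cont_\<psi>: "continuous_on UNIV \<psi>"
    unfolding D_def \<psi>_def
    by (intro continuous_on_diff continuous_on_mult continuous_on_power continuous_on_const cont_u
        rpoly_continuous[OF \<phi>] rpoly_continuous[OF rpoly_pd[OF \<phi>]] rpoly_continuous[OF rpoly_coord])+
  have "bounded (D ` cball 0 1)"
    by (intro compact_imp_bounded compact_continuous_image continuous_on_subset[OF cont_D]) auto
  then obtain K where "\<forall>y\<in>D ` cball 0 1. norm y \<le> K"
    unfolding bounded_iff by blast
  then have K: "\<bar>D x\<bar> \<le> K" if "x \<in> cball 0 1" for x
    using that by auto
  have K0: "K \<ge> 0" using K[of 0] by simp
  have DK: "\<bar>D x\<bar> \<le> K" for x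
  proof (cases "norm x \<le> 1")
    case True
    then show ?thesis using K[of x] by simp
  next
    case False
    then show ?thesis using u0[of x] K0 by (simp add: D_def)
  qed
  have der: "((\<lambda>t. \<psi> (x + t *\<^sub>R ?e)) has_real_derivative D (x + t *\<^sub>R ?e)) (at t)" for x t
  proof -
    have "((\<lambda>t. 1 - (x + t *\<^sub>R ?e) \<bullet> (x + t *\<^sub>R ?e)) has_real_derivative - 2 * (x + t *\<^sub>R ?e) $ j) (at t)"
      using rpoly_line_derivative[of "\<lambda>x. 1 - x \<bullet> x" x j t] by simp
    from DERIV_chain2[OF has_derivative_max0_square this]
    have "((\<lambda>t. (u (x + t *\<^sub>R ?e))\<^sup>2) has_real_derivative
        2 * u (x + t *\<^sub>R ?e) * (- 2 * (x + t *\<^sub>R ?e) $ j)) (at t)"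
      by (simp add: u_def)
    from DERIV_mult[OF this rpoly_line_derivative[OF \<phi>, of x j t]]
    show ?thesis by (simp add: \<psi>_def D_def algebra_simps)
  qed
  have lip: "\<bar>\<psi> (x + h *\<^sub>R ?e) - \<psi> x\<bar> \<le> K * h" if "h > 0" for x h
  proof -
    have "\<exists>z>0. z < h \<and> \<psi> (x + h *\<^sub>R ?e) - \<psi> (x + 0 *\<^sub>R ?e) = (h - 0) * D (x + z *\<^sub>R ?e)"
      by (rule MVT2[OF that der])
    then obtain z where "\<psi> (x + h *\<^sub>R ?e) - \<psi> (x + 0 *\<^sub>R ?e) = (h - 0) * D (x + z *\<^sub>R ?e)"
      by blast
    then show ?thesis
      using DK[of "x + z *\<^sub>R ?e"] that by (simp add: abs_mult mult.commute mult_right_mono)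
  qed
  have far: "\<psi> (x + h *\<^sub>R ?e) - \<psi> x = 0" if "norm x \<ge> 2" "0 < h" "h \<le> 1" for x h
  proof -
    have "norm x \<le> norm (x + h *\<^sub>R ?e) + norm (h *\<^sub>R ?e)"
      using norm_triangle_ineq4[of "x + h *\<^sub>R ?e" "h *\<^sub>R ?e"] by simp
    with that have "norm (x + h *\<^sub>R ?e) \<ge> 1" by simp
    with that show ?thesis by (simp add: \<psi>_def u0)
  qed
  \<comment> \<open>Step sizes of at most 1 keep every difference quotient supported in the ball of
    radius 2, where the Lipschitz constant K is an integrable majorant.\<close>
  define H where "H = (\<lambda>k. 1 / real (Suc k))"
  have H: "H k > 0" "H k \<le> 1" for k by (auto simp: H_def)
  have \<psi>m: "\<psi> \<in> borel_measurable borel" and Dm: "D \<in> borel_measurable borel"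
    using cont_\<psi> cont_D by (auto intro: borel_measurable_continuous_onI)
  have \<psi>i: "integrable lborel \<psi>"
  proof -
    have "\<psi> = (\<lambda>x. indicat_real (ball 0 1) x * \<psi> x)"
      using u0 by (auto simp: \<psi>_def indicator_def fun_eq_iff)
    moreover have "ballbdd \<psi>"
      unfolding ballbdd_def
    proof (intro conjI \<psi>m allI)
      fix r
      have "bounded (\<psi> ` cball 0 r)"
        by (intro compact_imp_bounded compact_continuous_image continuous_on_subset[OF cont_\<psi>]) auto
      then obtain B where "\<forall>y\<in>\<psi> ` cball 0 r. norm y \<le> B" unfolding bounded_iff by blast
      then show "\<exists>B. \<forall>x\<in>ball 0 r. \<bar>\<psi> x\<bar> \<le> B"
        by (intro exI[of _ B]) auto
    qed
    ultimately show ?thesis using ballbdd_integrable[of \<psi> 1] by simp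
  qed
  have \<psi>t: "integrable lborel (\<lambda>x. \<psi> (x + a))" "(\<integral>x. \<psi> (x + a) \<partial>lborel) = (\<integral>x. \<psi> x \<partial>lborel)" for a
  proof -
    have "integrable (distr lborel borel ((+) a)) \<psi>"
      using \<psi>i by (simp add: lborel_distr_plus)
    then show "integrable lborel (\<lambda>x. \<psi> (x + a))"
      using \<psi>m by (subst (asm) integrable_distr_eq) (auto simp: add.commute)
    show "(\<integral>x. \<psi> (x + a) \<partial>lborel) = (\<integral>x. \<psi> x \<partial>lborel)"
      using integral_distr[of "(+) a" lborel borel \<psi>] \<psi>m by (simp add: lborel_distr_plus add.commute)
  qed
  have "(\<lambda>k. \<integral>x. (\<psi> (x + H k *\<^sub>R ?e) - \<psi> x) / H k \<partial>lborel) \<longlonglongrightarrow> (\<integral>x. D x \<partial>lborel)"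
  proof (rule integral_dominated_convergence)
    show "integrable lborel (\<lambda>x::real^'n. indicat_real (ball 0 2) x * K)"
      by (rule ballbdd_integrable) simp
    show "AE x in lborel. (\<lambda>k. (\<psi> (x + H k *\<^sub>R ?e) - \<psi> x) / H k) \<longlonglongrightarrow> D x"
    proof (rule AE_I2)
      fix x
      have "((\<lambda>h. (\<psi> (x + h *\<^sub>R ?e) - \<psi> x) / h) \<longlongrightarrow> D x) (at 0)"
        using der[of x 0] by (simp add: has_field_derivative_iff)
      moreover have "filterlim H (at 0) sequentially"
        using H(1) LIMSEQ_inverse_real_of_nat
        by (intro filterlim_atI) (auto simp: H_def inverse_eq_divide)
      ultimately show "(\<lambda>k. (\<psi> (x + H k *\<^sub>R ?e) - \<psi> x) / H k) \<longlonglongrightarrow> D x"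
        by (rule filterlim_compose)
    qed
    show "AE x in lborel. norm ((\<psi> (x + H k *\<^sub>R ?e) - \<psi> x) / H k) \<le> indicat_real (ball 0 2) x * K" for k
    proof (rule AE_I2)
      fix x :: "real^'n"
      show "norm ((\<psi> (x + H k *\<^sub>R ?e) - \<psi> x) / H k) \<le> indicat_real (ball 0 2) x * K"
      proof (cases "norm x < 2")
        case True
        then show ?thesis
          using lip[OF H(1)[of k], of x] H(1)[of k] by (simp add: abs_divide divide_le_eq)
      next
        case False
        then show ?thesis using far[of x "H k"] H[of k] by simp
      qed
    qed
    show "D \<in> borel_measurable lborel" using Dm by simp
    show "(\<lambda>x. (\<psi> (x + H k *\<^sub>R ?e) - \<psi> x) / H k) \<in> borel_measurable lborel" for k
      using \<psi>t(1)[of "H k *\<^sub>R ?e"] \<psi>i by (intro borel_measurable_divide borel_measurable_diff) auto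
  qed
  moreover have "(\<lambda>k. \<integral>x. (\<psi> (x + H k *\<^sub>R ?e) - \<psi> x) / H k \<partial>lborel) = (\<lambda>k. 0)"
    using \<psi>t \<psi>i by simp
  ultimately have "(\<lambda>k. 0) \<longlonglongrightarrow> (\<integral>x. D x \<partial>lborel)"
    by (simp only:)
  then have "(\<integral>x. D x \<partial>lborel) = 0"
    by (simp add: LIMSEQ_const_iff)
  moreover have "D = (\<lambda>x. indicat_real (ball 0 1) x *
      ((1 - x \<bullet> x)\<^sup>2 * pd j \<phi> x - 4 * ((1 - x \<bullet> x) * (x $ j * \<phi> x))))"
  proof
    fix x
    show "D x = indicat_real (ball 0 1) x *
      ((1 - x \<bullet> x)\<^sup>2 * pd j \<phi> x - 4 * ((1 - x \<bullet> x) * (x $ j * \<phi> x)))"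
    proof (cases "norm x < 1")
      case True
      then have "x \<bullet> x \<le> 1" by (simp add: dot_square_norm power_le_one)
      with True show ?thesis by (simp add: D_def u_def)
    next
      case False
      then show ?thesis using u0[of x] by (simp add: D_def)
    qed
  qed
  ultimately have "ballint 1 (\<lambda>x. (1 - x \<bullet> x)\<^sup>2 * pd j \<phi> x - 4 * ((1 - x \<bullet> x) * (x $ j * \<phi> x))) = 0"
    by (simp add: ballint_def)
  then show ?thesis
    using \<phi> by (simp add: ballint_diff ballint_cmult)
qed

lemma ballavg_add: "rpoly f \<Longrightarrow> rpoly g \<Longrightarrow> ballavg (\<lambda>x. f x + g x) = ballavg f + ballavg g"
  and ballavg_diff: "rpoly f \<Longrightarrow> rpoly g \<Longrightarrow> ballavg (\<lambda>x. f x - g x) = ballavg f - ballavg g"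
  and ballavg_cmult: "ballavg (\<lambda>x. c * g x) = c * ballavg g"
  by (simp_all add: ballavg_def ballint_add ballint_diff ballint_cmult add_divide_distrib diff_divide_distrib)

lemma ballavg_const [simp]: "ballavg (\<lambda>x::real^'n::finite. c) = c"
proof -
  have "ballint 1 (\<lambda>x::real^'n. 1) = ballvol TYPE('n)"
    by (simp add: ballint_def ballvol_def)
  then have "ballavg (\<lambda>x::real^'n. 1) = 1"
    using ballvol_pos[where 'n='n] by (simp add: ballavg_def)
  then show ?thesis using ballavg_cmult[of c "\<lambda>x::real^'n. 1"] by simp
qed

text \<open>On the sphere the radial factor is 1, so it only changes the degree that enters
  \<open>ballint_eq_sph_mean\<close>.\<close>

lemma ballavg_homog:
  fixes Q :: "real^'n::finite \<Rightarrow> real"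
  assumes "homog m Q"
  shows "ballavg (\<lambda>x. (x \<bullet> x) ^ a * Q x) = real CARD('n) / (real CARD('n) + real m + 2 * real a) * sph_mean Q"
proof -
  have "homog (2 * a) (\<lambda>x::real^'n. (x \<bullet> x) ^ a)"
    by (auto simp: homog_def power_mult_distrib power_mult power2_eq_square)
  from homog_mult[OF this assms] have h: "homog (2 * a + m) (\<lambda>x. (x \<bullet> x) ^ a * Q x)" .
  have "sph_mean (\<lambda>x. (x \<bullet> x) ^ a * Q x) = sph_mean Q"
    using assms by (intro sph_mean_cong) (simp_all, simp add: dot_square_norm)
  moreover define d where "d = real CARD('n) + real m + 2 * real a"
  moreover have "d > 0" unfolding d_def by (intro add_pos_nonneg) auto
  ultimately show ?thesis
    using ballint_eq_sph_mean[OF h] by (simp add: add_ac field_simps flip: d_def)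
qed

text \<open>The divergence theorem on the sphere in polynomial form. Expanding the weights in
  \<open>ballint_by_parts\<close> into powers of \<open>x . x\<close> reduces both sides to sphere
  means with explicit rational factors.\<close>

lemma sph_mean_pd:
  fixes \<phi> :: "real^'n::finite \<Rightarrow> real"
  assumes \<phi>: "homog k \<phi>"
  shows "sph_mean (pd j \<phi>) = (real CARD('n) + real k - 1) * sph_mean (\<lambda>x. x $ j * \<phi> x)"
proof -
  define n where "n = real CARD('n)"
  have n: "n \<ge> 1" by (simp add: n_def)
  define q where "q = n + real k - 1"
  have q: "q \<ge> 0" using n by (simp add: q_def)
  define \<eta> where "\<eta> = (\<lambda>x. x $ j * \<phi> x)"
  have \<eta>: "homog (Suc k) \<eta>" using homog_mult[OF homog_coord \<phi>] by (simp add: \<eta>_def)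
  have "ballavg (\<lambda>x. (1 - x \<bullet> x) * \<eta> x) = ballavg (\<lambda>x. (x \<bullet> x) ^ 0 * \<eta> x) - ballavg (\<lambda>x. (x \<bullet> x) ^ 1 * \<eta> x)"
    using \<eta> by (simp add: algebra_simps flip: ballavg_diff)
  then have R: "ballavg (\<lambda>x. (1 - x \<bullet> x) * \<eta> x) = (n / (q + 2) - n / (q + 4)) * sph_mean \<eta>"
    unfolding ballavg_homog[OF \<eta>] by (simp add: n_def q_def algebra_simps)
  have sq: "ballavg (\<lambda>x. (1 - x \<bullet> x)\<^sup>2 * pd j \<phi> x) = ballavg (\<lambda>x. (x \<bullet> x) ^ 0 * pd j \<phi> x)
      - 2 * ballavg (\<lambda>x. (x \<bullet> x) ^ 1 * pd j \<phi> x) + ballavg (\<lambda>x. (x \<bullet> x) ^ 2 * pd j \<phi> x)"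
    using \<phi> by (simp add: power2_eq_square algebra_simps flip: ballavg_diff ballavg_add ballavg_cmult)
  have qa: "q * ballavg (\<lambda>x. (x \<bullet> x) ^ a * pd j \<phi> x) = q * (n / (q + 2 * real a) * sph_mean (pd j \<phi>))" for a
  proof (cases k)
    case 0
    then show ?thesis
      using homog_pd_0[of \<phi> j] \<phi> by simp
  next
    case (Suc k')
    then show ?thesis
      using ballavg_homog[OF homog_pd, of k' \<phi> a j] \<phi> by (simp add: n_def q_def algebra_simps)
  qed
  have "q * ballavg (\<lambda>x. (1 - x \<bullet> x)\<^sup>2 * pd j \<phi> x) = q * ballavg (\<lambda>x. (x \<bullet> x) ^ 0 * pd j \<phi> x)
      - 2 * (q * ballavg (\<lambda>x. (x \<bullet> x) ^ 1 * pd j \<phi> x)) + q * ballavg (\<lambda>x. (x \<bullet> x) ^ 2 * pd j \<phi> x)"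
    unfolding sq by argo
  also have "\<dots> = q * ((n / q - 2 * n / (q + 2) + n / (q + 4)) * sph_mean (pd j \<phi>))"
    unfolding qa by (simp add: algebra_simps)
  finally have L: "q * ballavg (\<lambda>x. (1 - x \<bullet> x)\<^sup>2 * pd j \<phi> x)
      = q * ((n / q - 2 * n / (q + 2) + n / (q + 4)) * sph_mean (pd j \<phi>))" .
  have eq: "ballavg (\<lambda>x. (1 - x \<bullet> x)\<^sup>2 * pd j \<phi> x) = 4 * ballavg (\<lambda>x. (1 - x \<bullet> x) * \<eta> x)"
    using ballint_by_parts[of \<phi> j] \<phi> by (simp add: ballavg_def \<eta>_def)
  show ?thesis
  proof (cases "q = 0")
    case True
    then have "k = 0" using n by (simp add: q_def)
    then show ?thesis
      using True homog_pd_0[of \<phi> j] \<phi> by (simp add: q_def n_def)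
  next
    case False
    then have q: "q > 0" using q by simp
    have "(n / q - 2 * n / (q + 2) + n / (q + 4)) * sph_mean (pd j \<phi>)
        = 4 * ((n / (q + 2) - n / (q + 4)) * sph_mean \<eta>)"
      using L eq R False by simp
    \<comment> \<open>A second difference of 1 / q with step 2 on one side, a first difference on
      the other; they differ by exactly the factor q.\<close>
    moreover have "n / q - 2 * n / (q + 2) + n / (q + 4) = 8 * n / (q * (q + 2) * (q + 4))"
      using q by (simp add: divide_simps) (simp add: algebra_simps)
    moreover have "4 * (n / (q + 2) - n / (q + 4)) = 8 * n / (q * (q + 2) * (q + 4)) * q"
      using q by (simp add: divide_simps) (simp add: algebra_simps)
    ultimately have "8 * n / (q * (q + 2) * (q + 4)) * sph_mean (pd j \<phi>)
        = 8 * n / (q * (q + 2) * (q + 4)) * (q * sph_mean \<eta>)"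
      by (metis (no_types, opaque_lifting) mult.assoc)
    moreover have "8 * n / (q * (q + 2) * (q + 4)) \<noteq> 0" using q n by simp
    ultimately have "sph_mean (pd j \<phi>) = q * sph_mean \<eta>"
      using mult_left_cancel by blast
    then show ?thesis by (simp add: q_def n_def \<eta>_def)
  qed
qed

text \<open>As Z is harmonic, the integrand is the divergence of \<open>Y grad Z\<close>. Its
  components have degree \<open>k + l - 1\<close>, so \<open>sph_mean_pd\<close> gives the constant,
  and Euler's identity evaluates the normal component as \<open>l Y Z\<close>.\<close>

lemma sph_mean_grad:
  fixes Y Z :: "real^'n::finite \<Rightarrow> real"
  assumes Y: "homog k Y" and Z: "Z \<in> sph_harm l"
  shows "sph_mean (\<lambda>x. \<Sum>j\<in>UNIV. pd j Y x * pd j Z x)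
    = (real CARD('n) + real k + real l - 2) * real l * sph_mean (\<lambda>x. Y x * Z x)"
proof (cases l)
  case 0
  then have "pd j Z = (\<lambda>x. 0)" for j
    using homog_pd_0 sph_harm_homog[OF Z] by blast
  with 0 show ?thesis by simp
next
  case (Suc l')
  let ?c = "real CARD('n) + real k + real l - 2"
  have h: "homog (k + l') (\<lambda>x. Y x * pd j Z x)" for j
    using Y homog_pd[of l' Z j] sph_harm_homog[OF Z] Suc by (intro homog_mult) auto
  have Zp: "rpoly Z" "rpoly Y" using Z Y by auto
  have "(\<Sum>j\<in>UNIV. pd j Y x * pd j Z x) = (\<Sum>j\<in>UNIV. pd j (\<lambda>x. Y x * pd j Z x) x)" for x
  proof -
    have "(\<Sum>j\<in>UNIV. pd j (\<lambda>x. Y x * pd j Z x) x) = (\<Sum>j\<in>UNIV. pd j Y x * pd j Z x) + Y x * lap Z x"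
      using Zp by (simp add: lap_def sum.distrib sum_distrib_left)
    then show ?thesis by (simp add: sph_harm_lap[OF Z])
  qed
  then have "sph_mean (\<lambda>x. \<Sum>j\<in>UNIV. pd j Y x * pd j Z x) = (\<Sum>j\<in>UNIV. sph_mean (pd j (\<lambda>x. Y x * pd j Z x)))"
    using Zp by (simp add: sph_mean_sum del: pd_mult)
  also have "\<dots> = (\<Sum>j\<in>UNIV. ?c * sph_mean (\<lambda>x. x $ j * (Y x * pd j Z x)))"
    using Suc by (simp add: sph_mean_pd[OF h] algebra_simps del: pd_mult)
  also have "\<dots> = ?c * sph_mean (\<lambda>x. \<Sum>j\<in>UNIV. x $ j * (Y x * pd j Z x))"
    using Zp by (simp add: sph_mean_sum sum_distrib_left)
  also have "(\<lambda>x. \<Sum>j\<in>UNIV. x $ j * (Y x * pd j Z x)) = (\<lambda>x. real l * (Y x * Z x))"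
  proof
    fix x
    have "(\<Sum>j\<in>UNIV. x $ j * (Y x * pd j Z x)) = Y x * (\<Sum>j\<in>UNIV. x $ j * pd j Z x)"
      by (simp add: sum_distrib_left algebra_simps)
    then show "(\<Sum>j\<in>UNIV. x $ j * (Y x * pd j Z x)) = real l * (Y x * Z x)"
      using euler[OF sph_harm_homog[OF Z]] by simp
  qed
  finally show ?thesis using Zp by (simp add: sph_mean_cmult)
qed

text \<open>The left-hand side of \<open>sph_mean_grad\<close> is symmetric in Y and Z while the
  right-hand side carries the factor l or k; the common factor is positive as
  \<open>k + l > 0\<close>.\<close>

lemma sph_harm_orthogonal:
  fixes Y Z :: "real^'n::finite \<Rightarrow> real"
  assumes Y: "Y \<in> sph_harm k" and Z: "Z \<in> sph_harm l" and "k \<noteq> l" and n: "CARD('n) \<ge> 2"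
  shows "sph_mean (\<lambda>x. Y x * Z x) = 0"
proof -
  let ?c = "real CARD('n) + real k + real l - 2"
  have "?c * real l * sph_mean (\<lambda>x. Y x * Z x) = ?c * real k * sph_mean (\<lambda>x. Y x * Z x)"
    using sph_mean_grad[OF sph_harm_homog[OF Y] Z] sph_mean_grad[OF sph_harm_homog[OF Z] Y]
    by (simp add: mult.commute add_ac)
  moreover have "?c > 0" using n \<open>k \<noteq> l\<close> by simp
  ultimately show ?thesis using \<open>k \<noteq> l\<close> by simp
qed

lemma sph_mean_sph_harm:
  fixes Y :: "real^'n::finite \<Rightarrow> real"
  assumes "Y \<in> sph_harm l" "l > 0" "CARD('n) \<ge> 2"
  shows "sph_mean Y = 0"
  using sph_harm_orthogonal[OF assms(1) sph_harm_const[of 1]] assms by simp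

subsection \<open>Mean value property and pointwise bounds for spherical harmonics\<close>

text \<open>The mean value property. Homogeneous parts of positive degree are orthogonal to the
  constants, so only the value at the origin remains.\<close>

lemma ballavg_harmonic:
  fixes p :: "real^'n::finite \<Rightarrow> real"
  assumes p: "rpoly p" and lap: "\<And>x. lap p x = 0" and n: "CARD('n) \<ge> 2"
  shows "ballavg p = p 0"
proof -
  obtain N q where q: "\<And>k. homog k (q k)" and pq: "p = (\<lambda>x. \<Sum>k\<le>N. q k x)"
    using rpoly_homog_decomp[OF p] by blast
  \<comment> \<open>For fixed x, \<open>c\<^sup>2 * lap p (c x)\<close> is a polynomial in c with
    coefficients \<open>lap (q k) x\<close>; it vanishes for all c, hence so do its
    coefficients.\<close>
  have "lap (q k) x = 0" if "k \<le> N" for k x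
  proof -
    have "(\<Sum>k\<le>N. lap (q k) x * c ^ k) = 0" for c
    proof -
      have "(\<Sum>k\<le>N. lap (q k) x * c ^ k) = (\<Sum>k\<le>N. c\<^sup>2 * lap (q k) (c *\<^sub>R x))"
        by (simp add: lap_homog_scale[OF q] mult.commute)
      also have "\<dots> = c\<^sup>2 * lap p (c *\<^sub>R x)"
        unfolding pq by (subst lap_sum) (auto simp: sum_distrib_left homog_rpoly[OF q])
      finally show ?thesis by (simp add: lap)
    qed
    then show ?thesis using that Transcendental.polyfun_eq_0[of "\<lambda>k. lap (q k) x" N] by blast
  qed
  then have qh: "q k \<in> sph_harm k" if "k \<le> N" for k
    using that q by (simp add: sph_harm_iff)
  have avg: "ballavg (q k) = (if k = 0 then p 0 else 0)" if "k \<le> N" for k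
  proof (cases "k = 0")
    case True
    have "p 0 = q 0 0"
      unfolding pq using homog_at_0[OF q] by (subst sum.mono_neutral_right[of _ "{0}"]) auto
    moreover have "q 0 = (\<lambda>x. q 0 0)" using homog_0_const[OF q] by blast
    then have "ballavg (q 0) = ballavg (\<lambda>x::real^'n. q 0 0)" by (rule arg_cong)
    ultimately show ?thesis using True by simp
  next
    case False
    then show ?thesis
      using ballint_eq_sph_mean[OF q, of k] sph_mean_sph_harm[OF qh[OF that]] n by simp
  qed
  have rq: "rpoly (q k)" for k using q[of k] by simp
  have "ballavg (\<lambda>x. \<Sum>k\<le>M. q k x) = (\<Sum>k\<le>M. ballavg (q k))" for M
    by (induction M) (simp_all add: ballavg_add rq)
  then have "ballavg p = (\<Sum>k\<le>N. ballavg (q k))" unfolding pq .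
  then show ?thesis by (simp add: avg)
qed

lemma ballavg_square_le:
  assumes p: "rpoly p"
  shows "(ballavg p)\<^sup>2 \<le> ballavg (\<lambda>x. (p x)\<^sup>2)"
proof -
  let ?a = "ballavg p"
  have "0 \<le> ballavg (\<lambda>x. (p x - ?a)\<^sup>2)"
    unfolding ballavg_def ballint_def using ballvol_pos
    by (intro divide_nonneg_pos integral_nonneg) auto
  also have "(\<lambda>x. (p x - ?a)\<^sup>2) = (\<lambda>x. ((p x)\<^sup>2 - 2 * ?a * p x) + ?a\<^sup>2)"
    by (auto simp: power2_eq_square algebra_simps)
  also have "ballavg \<dots> = ballavg (\<lambda>x. (p x)\<^sup>2) - 2 * ?a * ?a + ?a\<^sup>2"
    using p by (simp add: ballavg_add ballavg_diff ballavg_cmult ballavg_const)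
  finally show ?thesis by (simp add: power2_eq_square)
qed

text \<open>The power comes from averaging over balls of radius 1 / l and from
  \<open>(1 + 1/l) ^ n \<le> 2 ^ n\<close>, the exponential from \<open>(1 + 1/l) ^ (2 * l)\<close>.
  Using l + 1 instead of l includes degree 0.\<close>

definition sup_const :: "'n::finite itself \<Rightarrow> nat \<Rightarrow> real" where
  "sup_const _ l = exp 2 * (2 * (real l + 1)) ^ CARD('n)"

lemma sup_const_ge_1: "sup_const TYPE('n::finite) l \<ge> 1"
proof -
  have "1 * 1 \<le> exp 2 * (2 * (real l + 1)) ^ CARD('n)"
    by (intro mult_mono one_le_power) auto
  then show ?thesis by (simp add: sup_const_def)
qed

text \<open>Average over the ball of radius 1 / l around x, which lies in the ball of radius 1 + 1 /
  l around 0. The square of Y has degree 2 l, so enlarging the unit ball by that amount costs only a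
  bounded factor.\<close>

lemma sph_harm_pointwise:
  fixes Y :: "real^'n::finite \<Rightarrow> real"
  assumes Y: "Y \<in> sph_harm l" and n: "CARD('n) \<ge> 2" and x: "norm x = 1"
  shows "(Y x)\<^sup>2 \<le> sup_const TYPE('n) l * sph_mean (\<lambda>x. (Y x)\<^sup>2)"
proof (cases "l = 0")
  case True
  then have "homog 0 Y" using sph_harm_homog[OF Y] by simp
  moreover define c where "c = Y 0"
  ultimately have "Y = (\<lambda>x. c)" using homog_0_const[of Y] by blast
  then have "sph_mean (\<lambda>x. (Y x)\<^sup>2) = (Y x)\<^sup>2" by simp
  then show ?thesis using sup_const_ge_1[where 'n='n, of l] by (simp add: mult_le_cancel_right1)
next
  case False
  define r where "r = 1 / real l"
  have r: "r > 0" "r \<le> 1" using False by (auto simp: r_def)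
  define p where "p = (\<lambda>y. Y (x + r *\<^sub>R y))"
  have hY: "homog l Y" using sph_harm_homog[OF Y] .
  have h2: "homog (2 * l) (\<lambda>z. (Y z)\<^sup>2)"
    using homog_mult[OF hY hY] by (simp add: power2_eq_square mult_2)
  have p: "rpoly p" using Y by (simp add: p_def rpoly_affine)
  have "Y x = ballavg p"
    using ballavg_harmonic[OF p _ n] Y by (simp add: p_def lap_affine sph_harm_lap)
  then have "(Y x)\<^sup>2 \<le> ballavg (\<lambda>y. (p y)\<^sup>2)"
    using ballavg_square_le[OF p] by simp
  moreover have "r ^ CARD('n) * ballint 1 (\<lambda>y. (p y)\<^sup>2) \<le> ballint (1 + r) (\<lambda>z. (Y z)\<^sup>2)"
  proof -
    have ind: "indicat_real (ball x r) (x + r *\<^sub>R y) = indicat_real (ball 0 1) y" for y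
      using r by (simp add: indicator_def dist_norm)
    have "(\<lambda>z. indicat_real (ball x r) z * (Y z)\<^sup>2) \<in> borel_measurable borel"
      using Y by (intro borel_measurable_times borel_measurable_indicator rpoly_measurable) auto
    from lborel_integral_affine[OF r(1) this, of x]
    have "r ^ CARD('n) * ballint 1 (\<lambda>y. (p y)\<^sup>2) = (\<integral>z. indicat_real (ball x r) z * (Y z)\<^sup>2 \<partial>lborel)"
      by (simp add: ballint_def p_def ind)
    also have "\<dots> \<le> (\<integral>z. indicat_real (ball 0 (1 + r)) z * (Y z)\<^sup>2 \<partial>lborel)"
    proof (rule integral_mono_AE')
      show "integrable lborel (\<lambda>z. indicat_real (ball 0 (1 + r)) z * (Y z)\<^sup>2)"
        using Y by (intro ballbdd_integrable) simp
      have "z \<in> ball 0 (1 + r)" if "z \<in> ball x r" for z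
        using that x norm_triangle_ineq2[of z x] by (simp add: dist_norm norm_minus_commute)
      then show "AE z in lborel. indicat_real (ball x r) z * (Y z)\<^sup>2 \<le> indicat_real (ball 0 (1 + r)) z * (Y z)\<^sup>2"
        by (auto intro!: AE_I2 simp: indicator_def)
    qed auto
    finally show ?thesis by (simp add: ballint_def)
  qed
  moreover have "ballint (1 + r) (\<lambda>z. (Y z)\<^sup>2) = (1 + r) ^ (CARD('n) + 2 * l) * ballint 1 (\<lambda>z. (Y z)\<^sup>2)"
    using r by (intro ballint_homog h2) simp
  ultimately have step: "r ^ CARD('n) * (Y x)\<^sup>2 \<le> (1 + r) ^ (CARD('n) + 2 * l) * ballavg (\<lambda>z. (Y z)\<^sup>2)"
  proof -
    assume 1: "(Y x)\<^sup>2 \<le> ballavg (\<lambda>y. (p y)\<^sup>2)"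
      and 2: "r ^ CARD('n) * ballint 1 (\<lambda>y. (p y)\<^sup>2) \<le> ballint (1 + r) (\<lambda>z. (Y z)\<^sup>2)"
      and 3: "ballint (1 + r) (\<lambda>z. (Y z)\<^sup>2) = (1 + r) ^ (CARD('n) + 2 * l) * ballint 1 (\<lambda>z. (Y z)\<^sup>2)"
    have "r ^ CARD('n) * (Y x)\<^sup>2 \<le> r ^ CARD('n) * ballavg (\<lambda>y. (p y)\<^sup>2)"
      using 1 r by (intro mult_left_mono) auto
    also have "\<dots> \<le> ballint (1 + r) (\<lambda>z. (Y z)\<^sup>2) / ballvol TYPE('n)"
      using 2 ballvol_pos[where 'n='n] by (simp add: ballavg_def divide_right_mono)
    finally show ?thesis unfolding 3 by (simp add: ballavg_def)
  qed
  have avg_le: "ballavg (\<lambda>z. (Y z)\<^sup>2) \<le> sph_mean (\<lambda>x. (Y x)\<^sup>2)"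
  proof -
    have "ballavg (\<lambda>z. (Y z)\<^sup>2) = real CARD('n) / (real CARD('n) + 2 * real l) * sph_mean (\<lambda>x. (Y x)\<^sup>2)"
      using ballavg_homog[OF h2, of 0] by simp
    also have "\<dots> \<le> 1 * sph_mean (\<lambda>x. (Y x)\<^sup>2)"
      using Y by (intro mult_right_mono sph_mean_nonneg) (auto simp: divide_le_eq)
    finally show ?thesis by simp
  qed
  have pow_le: "(1 + r) ^ (CARD('n) + 2 * l) \<le> 2 ^ CARD('n) * exp 2"
  proof -
    have "(1 + r) ^ l \<le> exp r ^ l"
      using r by (intro power_mono) auto
    also have "\<dots> = exp 1" using False by (simp add: r_def flip: exp_of_nat_mult)
    finally have "((1 + r) ^ l)\<^sup>2 \<le> (exp 1)\<^sup>2" using r by (intro power_mono) auto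
    then have "(1 + r) ^ (2 * l) \<le> exp 2"
      by (simp add: power_mult[symmetric] mult.commute flip: exp_double)
    moreover have "(1 + r) ^ CARD('n) \<le> 2 ^ CARD('n)" using r by (intro power_mono) auto
    ultimately show ?thesis unfolding power_add using r by (intro mult_mono) auto
  qed
  have nn: "0 \<le> sph_mean (\<lambda>x. (Y x)\<^sup>2)"
    using Y by (intro sph_mean_nonneg) auto
  note step
  also have "(1 + r) ^ (CARD('n) + 2 * l) * ballavg (\<lambda>z. (Y z)\<^sup>2)
      \<le> (1 + r) ^ (CARD('n) + 2 * l) * sph_mean (\<lambda>x. (Y x)\<^sup>2)"
    using avg_le r by (intro mult_left_mono) auto
  also have "\<dots> \<le> (2 ^ CARD('n) * exp 2) * sph_mean (\<lambda>x. (Y x)\<^sup>2)"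
    using pow_le nn by (rule mult_right_mono)
  finally have "(Y x)\<^sup>2 \<le> exp 2 * (2 * real l) ^ CARD('n) * sph_mean (\<lambda>x. (Y x)\<^sup>2)"
    using False by (simp add: r_def power_mult_distrib power_one_over divide_le_eq mult_ac)
  also have "\<dots> \<le> sup_const TYPE('n) l * sph_mean (\<lambda>x. (Y x)\<^sup>2)"
    unfolding sup_const_def using Y by (intro mult_right_mono mult_left_mono power_mono sph_mean_nonneg) auto
  finally show ?thesis .
qed

lemma sph_harm_eq_0:
  fixes Y :: "real^'n::finite \<Rightarrow> real"
  assumes Y: "Y \<in> sph_harm l" and n: "CARD('n) \<ge> 2" and 0: "sph_mean (\<lambda>x. (Y x)\<^sup>2) = 0"
  shows "Y = (\<lambda>x. 0)"
proof -
  have S: "Y x = 0" if "norm x = 1" for x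
    using sph_harm_pointwise[OF Y n that] 0 by simp
  have nz: "Y x = 0" if "x \<noteq> 0" for x
    using homogD[OF sph_harm_homog[OF Y], of "norm x" "x /\<^sub>R norm x"] S[of "x /\<^sub>R norm x"] that by simp
  \<comment> \<open>In degree 0, homogeneity with c = 0 equates \<open>Y 0\<close> with a value on
    the sphere, as \<open>0 ^ 0 = 1\<close>.\<close>
  have "Y 0 = 0"
    using homogD[OF sph_harm_homog[OF Y], of 0 "axis undefined 1"] S[of "axis undefined 1"] by simp
  with nz show ?thesis by metis
qed

subsection \<open>Orthonormal bases and harmonic components\<close>

definition orthonormal :: "nat \<Rightarrow> (real^'n::finite \<Rightarrow> real) set \<Rightarrow> bool" where
  "orthonormal l E \<longleftrightarrow> finite E \<and> E \<subseteq> sph_harm l \<and>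
     (\<forall>e\<in>E. \<forall>e'\<in>E. sph_mean (\<lambda>x. e x * e' x) = (if e = e' then 1 else 0))"

lemma orthonormal_expand:
  assumes E: "orthonormal l E" and Z: "rpoly Z"
  shows "sph_mean (\<lambda>x. (\<Sum>e\<in>E. a e * e x) * Z x) = (\<Sum>e\<in>E. a e * sph_mean (\<lambda>x. e x * Z x))"
proof -
  have r: "rpoly e" if "e \<in> E" for e
    using that E unfolding orthonormal_def by auto
  have "(\<lambda>x. (\<Sum>e\<in>E. a e * e x) * Z x) = (\<lambda>x. \<Sum>e\<in>E. a e * (e x * Z x))"
    by (simp add: sum_distrib_right mult.assoc)
  then show ?thesis
    using r Z by (simp add: sph_mean_sum sph_mean_cmult)
qed

lemma orthonormal_coeff:
  assumes E: "orthonormal l E" and e': "e' \<in> E"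
  shows "sph_mean (\<lambda>x. (\<Sum>e\<in>E. a e * e x) * e' x) = a e'"
proof -
  have E': "finite E" "\<And>e. e \<in> E \<Longrightarrow> sph_mean (\<lambda>x. e x * e' x) = (if e = e' then 1 else 0)" "rpoly e'"
    using E e' unfolding orthonormal_def by auto
  show ?thesis
  proof -
    have "(\<Sum>e\<in>E. a e * sph_mean (\<lambda>x. e x * e' x)) = (\<Sum>e\<in>E. if e = e' then a e else 0)"
      using E'(2) by (intro sum.cong) auto
    then show ?thesis using E' e' by (simp add: orthonormal_expand[OF E] sum.delta)
  qed
qed

lemma orthonormal_in: "orthonormal l E \<Longrightarrow> (\<lambda>x. \<Sum>e\<in>E. a e * e x) \<in> sph_harm l"
  unfolding orthonormal_def by (intro sph_harm_sum sph_harm_cmult) auto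

lemma orthonormal_parseval:
  assumes E: "orthonormal l E"
  shows "sph_mean (\<lambda>x. (\<Sum>e\<in>E. a e * e x)\<^sup>2) = (\<Sum>e\<in>E. (a e)\<^sup>2)"
proof -
  let ?Y = "\<lambda>x. \<Sum>e\<in>E. a e * e x"
  have "sph_mean (\<lambda>x. e x * ?Y x) = a e" if "e \<in> E" for e
    using orthonormal_coeff[OF E that, of a] by (simp add: mult.commute)
  then show ?thesis
    using orthonormal_expand[OF E sph_harm_rpoly[OF orthonormal_in[OF E, of a]], of a]
    by (simp add: power2_eq_square)
qed

text \<open>A reproducing-kernel argument: the combination with coefficients \<open>e x\<close> has
  value S at x and squared norm S, where S is the sum of the squares of the \<open>e x\<close>. The
  pointwise bound gives \<open>S\<^sup>2 \<le> sup_const * S\<close>; integrating the resulting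
  bound on S counts E.\<close>

lemma orthonormal_card:
  fixes E :: "(real^'n::finite \<Rightarrow> real) set"
  assumes E: "orthonormal l E" and n: "CARD('n) \<ge> 2"
  shows "real (card E) \<le> sup_const TYPE('n) l"
proof -
  have E': "finite E" "E \<subseteq> sph_harm l" "\<And>e. e \<in> E \<Longrightarrow> sph_mean (\<lambda>x. (e x)\<^sup>2) = 1"
    using E unfolding orthonormal_def by (auto simp: power2_eq_square)
  have r: "rpoly e" if "e \<in> E" for e using that E'(2) by auto
  have bound: "(\<Sum>e\<in>E. (e x)\<^sup>2) \<le> sup_const TYPE('n) l" if x: "norm x = 1" for x
  proof -
    let ?S = "\<Sum>e\<in>E. (e x)\<^sup>2"
    have "?S\<^sup>2 \<le> sup_const TYPE('n) l * ?S"
      using sph_harm_pointwise[OF orthonormal_in[OF E, of "\<lambda>e. e x"] n x]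
      unfolding orthonormal_parseval[OF E] by (simp add: power2_eq_square)
    moreover have "?S \<ge> 0" by (simp add: sum_nonneg)
    ultimately show ?thesis
      using sup_const_ge_1[where 'n='n, of l]
      by (cases "?S = 0") (auto simp: power2_eq_square mult_le_cancel_right)
  qed
  have "real (card E) = (\<Sum>e\<in>E. sph_mean (\<lambda>x. (e x)\<^sup>2))"
    using E'(3) by simp
  also have "\<dots> = sph_mean (\<lambda>x. \<Sum>e\<in>E. (e x)\<^sup>2)"
    using r by (simp add: sph_mean_sum)
  also have "\<dots> \<le> sph_mean (\<lambda>x::real^'n. sup_const TYPE('n) l)"
    using r bound by (intro sph_mean_mono) auto
  finally show ?thesis by simp
qed

text \<open>Cardinalities of orthonormal families are bounded, so a largest one exists. It spans: a
  nonzero remainder after projection could be normalised and adjoined.\<close>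

lemma orthonormal_basis_exists:
  assumes n: "CARD('n::finite) \<ge> 2"
  shows "\<exists>E :: (real^'n \<Rightarrow> real) set. orthonormal l E \<and>
    (\<forall>Y\<in>sph_harm l. Y = (\<lambda>x. \<Sum>e\<in>E. sph_mean (\<lambda>z. Y z * e z) * e x))"
proof -
  have "orthonormal l ({} :: (real^'n \<Rightarrow> real) set)" by (simp add: orthonormal_def)
  moreover have "\<forall>E :: (real^'n \<Rightarrow> real) set. orthonormal l E \<longrightarrow> card E < nat \<lceil>sup_const TYPE('n) l\<rceil> + 1"
  proof (intro allI impI)
    fix E :: "(real^'n \<Rightarrow> real) set" assume "orthonormal l E"
    from orthonormal_card[OF this n] show "card E < nat \<lceil>sup_const TYPE('n) l\<rceil> + 1" by linarith
  qed
  ultimately have "\<exists>E :: (real^'n \<Rightarrow> real) set. orthonormal l E \<and> (\<forall>F :: (real^'n \<Rightarrow> real) set. orthonormal l F \<longrightarrow> card F \<le> card E)"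
    by (rule Lattices_Big.ex_has_greatest_nat[of "orthonormal l :: (real^'n \<Rightarrow> real) set \<Rightarrow> bool" "{}" card "nat \<lceil>sup_const TYPE('n) l\<rceil> + 1"])
  then obtain E :: "(real^'n \<Rightarrow> real) set" where E: "orthonormal l E"
    and max': "\<forall>F :: (real^'n \<Rightarrow> real) set. orthonormal l F \<longrightarrow> card F \<le> card E"
    by (elim exE conjE)
  have "Y = (\<lambda>x. \<Sum>e\<in>E. sph_mean (\<lambda>z. Y z * e z) * e x)" if Y: "Y \<in> sph_harm l" for Y
  proof -
    let ?P = "\<lambda>x. \<Sum>e\<in>E. sph_mean (\<lambda>z. Y z * e z) * e x"
    define R where "R = (\<lambda>x. Y x - ?P x)"
    have P: "?P \<in> sph_harm l" by (rule orthonormal_in[OF E])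
    have R: "R \<in> sph_harm l" unfolding R_def by (intro sph_harm_diff Y P)
    have EP: "rpoly e" if "e \<in> E" for e using that E unfolding orthonormal_def by auto
    have orth: "sph_mean (\<lambda>x. R x * e x) = 0" if e: "e \<in> E" for e
    proof -
      have "(\<lambda>x. R x * e x) = (\<lambda>x. Y x * e x - ?P x * e x)"
        by (simp add: R_def left_diff_distrib)
      then have "sph_mean (\<lambda>x. R x * e x) = sph_mean (\<lambda>x. Y x * e x) - sph_mean (\<lambda>x. ?P x * e x)"
        using Y P EP[OF e] by (simp add: sph_mean_diff)
      then show ?thesis by (simp add: orthonormal_coeff[OF E e])
    qed
    have "sph_mean (\<lambda>x. (R x)\<^sup>2) = 0"
    proof (rule ccontr)
      assume neq: "sph_mean (\<lambda>x. (R x)\<^sup>2) \<noteq> 0"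
      define s where "s = sph_mean (\<lambda>x. (R x)\<^sup>2)"
      have s: "s > 0" using neq sph_mean_nonneg[of "\<lambda>x. (R x)\<^sup>2"] R by (simp add: s_def)
      define e' where "e' = (\<lambda>x. (1 / sqrt s) * R x)"
      have e': "e' \<in> sph_harm l" unfolding e'_def by (intro sph_harm_cmult R)
      have o1: "sph_mean (\<lambda>x. e' x * e x) = 0" if "e \<in> E" for e
        using orth[OF that] sph_mean_cmult[of "\<lambda>x. R x * e x" "1 / sqrt s"] EP[OF that] R
        by (simp add: e'_def)
      have "(\<lambda>x. e' x * e' x) = (\<lambda>x. (1 / s) * (R x)\<^sup>2)"
        using s by (auto simp: e'_def power2_eq_square)
      then have o2: "sph_mean (\<lambda>x. e' x * e' x) = 1"
        using sph_mean_cmult[of "\<lambda>x. (R x)\<^sup>2" "1 / s"] R s by (simp add: s_def)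
      have "e' \<notin> E" using o1[of e'] o2 by auto
      moreover have "orthonormal l (insert e' E)"
        unfolding orthonormal_def
      proof (intro conjI ballI)
        have o1': "sph_mean (\<lambda>x. e x * e' x) = 0" if "e \<in> E" for e
          using o1[OF that] by (simp add: mult.commute[of "e _"])
        fix a b assume "a \<in> insert e' E" "b \<in> insert e' E"
        then consider "a = e'" "b = e'" | "a = e'" "b \<in> E" | "a \<in> E" "b = e'" | "a \<in> E" "b \<in> E"
          by blast
        then show "sph_mean (\<lambda>x. a x * b x) = (if a = b then 1 else 0)"
        proof cases
          case 4
          with E show ?thesis unfolding orthonormal_def by blast
        qed (use o1 o1' o2 \<open>e' \<notin> E\<close> in auto)
      qed (use E e' in \<open>auto simp: orthonormal_def\<close>)
      ultimately show False
        using max'[rule_format, of "insert e' E"] E by (simp add: orthonormal_def)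
    qed
    then have "R = (\<lambda>x. 0)" by (rule sph_harm_eq_0[OF R n])
    then have "Y x - ?P x = 0" for x unfolding R_def by (rule fun_cong)
    then show ?thesis by (intro ext) (rule eq_iff_diff_eq_0[THEN iffD2])
  qed
  with E show ?thesis by blast
qed

section \<open>Components of a functional with respect to a fixed orthonormal basis\<close>

definition harm_basis :: "nat \<Rightarrow> (real^'n::finite \<Rightarrow> real) set" where
  "harm_basis l = (SOME E. orthonormal l E \<and>
    (\<forall>Y\<in>sph_harm l. Y = (\<lambda>x. \<Sum>e\<in>E. sph_mean (\<lambda>z. Y z * e z) * e x)))"

lemma
  assumes n: "CARD('n::finite) \<ge> 2"
  shows orthonormal_harm_basis: "orthonormal l (harm_basis l :: (real^'n \<Rightarrow> real) set)"
    and harm_basis_expansion: "\<And>Y :: real^'n \<Rightarrow> real. Y \<in> sph_harm l \<Longrightarrow>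
      Y = (\<lambda>x. \<Sum>e\<in>harm_basis l. sph_mean (\<lambda>z. Y z * e z) * e x)"
  using someI_ex[OF orthonormal_basis_exists[OF n, of l], folded harm_basis_def] by blast+

text \<open>Linearity is restricted to polynomials because the functionals are integrals, which need
  not be additive on arbitrary functions.\<close>

definition poly_linear :: "((real^'n::finite \<Rightarrow> real) \<Rightarrow> real) \<Rightarrow> bool" where
  "poly_linear L \<longleftrightarrow> (\<forall>p q. rpoly p \<longrightarrow> rpoly q \<longrightarrow> L (\<lambda>x. p x + q x) = L p + L q)
     \<and> (\<forall>p c. rpoly p \<longrightarrow> L (\<lambda>x. c * p x) = c * L p)"

lemma poly_linear_sum:
  assumes L: "poly_linear L" and g: "\<And>k. k \<in> A \<Longrightarrow> rpoly (g k)"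
  shows "L (\<lambda>x. \<Sum>k\<in>A. a k * g k x) = (\<Sum>k\<in>A. a k * L (g k))"
proof -
  have L': "rpoly p \<Longrightarrow> rpoly q \<Longrightarrow> L (\<lambda>x. p x + q x) = L p + L q"
    "rpoly p \<Longrightarrow> L (\<lambda>x. c * p x) = c * L p" for p q c
    using L unfolding poly_linear_def by blast+
  have "L (\<lambda>x. 0) = 0" using L'(2)[of "\<lambda>x. 0" 0] by simp
  then show ?thesis
    using g by (induction A rule: infinite_finite_induct) (auto simp: L')
qed

context
  fixes L :: "(real^'n::finite \<Rightarrow> real) \<Rightarrow> real"
  assumes n: "CARD('n) \<ge> 2" and L: "poly_linear L"
begin

lemma harm_basis_pairing:
  assumes Z: "Z \<in> sph_harm l"
  shows "sph_mean (\<lambda>x. (\<Sum>e\<in>harm_basis l. L e * e x) * Z x) = L Z"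
proof -
  note E = orthonormal_harm_basis[OF n, of l]
  have EP: "rpoly e" if "e \<in> harm_basis l" for e :: "real^'n \<Rightarrow> real"
    using that E unfolding orthonormal_def by auto
  have "L Z = L (\<lambda>x. \<Sum>e\<in>harm_basis l. sph_mean (\<lambda>z. Z z * e z) * e x)"
    using harm_basis_expansion[OF n Z] by (rule arg_cong)
  also have "\<dots> = (\<Sum>e\<in>harm_basis l. sph_mean (\<lambda>z. Z z * e z) * L e)"
    by (rule poly_linear_sum[OF L EP])
  finally show ?thesis
    using orthonormal_expand[OF E, of Z L] Z by (simp add: mult.commute)
qed

text \<open>Resolves the definite description in \<open>harm_comp\<close>. Uniqueness follows by
  pairing the difference of two representatives with itself.\<close>

lemma harm_comp_eq: "harm_comp L l = (\<lambda>x. \<Sum>e\<in>harm_basis l. L e * e x)" (is "_ = ?G")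
proof -
  note E = orthonormal_harm_basis[OF n, of l]
  have G: "?G \<in> sph_harm l" by (rule orthonormal_in[OF E])
  note GL = harm_basis_pairing
  have uniq: "Y = ?G" if Y: "Y \<in> sph_harm l" "\<forall>Z\<in>sph_harm l. (\<integral>x. Y x * Z x \<partial>sph) = L Z" for Y
  proof -
    define R where "R = (\<lambda>x. Y x - ?G x)"
    have R: "R \<in> sph_harm l" unfolding R_def by (intro sph_harm_diff Y G)
    have "(\<lambda>x. (R x)\<^sup>2) = (\<lambda>x. Y x * R x - ?G x * R x)"
      by (simp add: R_def power2_eq_square left_diff_distrib)
    then have "sph_mean (\<lambda>x. (R x)\<^sup>2) = sph_mean (\<lambda>x. Y x * R x) - sph_mean (\<lambda>x. ?G x * R x)"
      using Y G R by (simp add: sph_mean_diff)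
    also have "\<dots> = 0" using bspec[OF Y(2) R] GL[OF R] unfolding sph_mean_def by simp
    finally have "R = (\<lambda>x. 0)" by (rule sph_harm_eq_0[OF R n])
    then show ?thesis by (simp add: R_def fun_eq_iff)
  qed
  show ?thesis
    unfolding harm_comp_def
  proof (rule the_equality)
    show "?G \<in> sph_harm l \<and> (\<forall>Z\<in>sph_harm l. (\<integral>x. ?G x * Z x \<partial>sph) = L Z)"
      using G GL unfolding sph_mean_def by blast
    show "Y = ?G" if "Y \<in> sph_harm l \<and> (\<forall>Z\<in>sph_harm l. (\<integral>x. Y x * Z x \<partial>sph) = L Z)" for Y
      using that by (intro uniq) simp_all
  qed
qed

lemma harm_comp_in: "harm_comp L l \<in> sph_harm l"
  unfolding harm_comp_eq by (rule orthonormal_in[OF orthonormal_harm_basis[OF n]])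

text \<open>A finite sum of squares of pairings with fixed polynomials: the form in which a mode can
  be differentiated in time by the weak equation.\<close>

lemma comp_sq_eq_sum: "comp_sq L l = (\<Sum>e\<in>harm_basis l. (L e)\<^sup>2)"
  using orthonormal_parseval[OF orthonormal_harm_basis[OF n, of l], of L]
  by (simp add: comp_sq_def harm_comp_eq sph_mean_def)

lemma harm_comp_represents:
  "Z \<in> sph_harm l \<Longrightarrow> sph_mean (\<lambda>x. harm_comp L l x * Z x) = L Z"
  unfolding harm_comp_eq by (rule harm_basis_pairing)

lemma harm_comp_eqI:
  assumes Y: "Y \<in> sph_harm l" and eq: "\<And>Z. Z \<in> sph_harm l \<Longrightarrow> sph_mean (\<lambda>x. Y x * Z x) = L Z"
  shows "harm_comp L l = Y"
proof -
  have "harm_comp L l = (\<lambda>x. \<Sum>e\<in>harm_basis l. sph_mean (\<lambda>x. Y x * e x) * e x)"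
    unfolding harm_comp_eq using eq orthonormal_harm_basis[OF n, of l]
    unfolding orthonormal_def by (intro ext sum.cong) auto
  then show ?thesis by (rule trans[OF _ harm_basis_expansion[OF n Y, symmetric]])
qed

lemma comp_sq_eq: "comp_sq L l = sph_mean (\<lambda>x. (harm_comp L l x)\<^sup>2)"
  and comp_sq_eq_pairing: "comp_sq L l = L (harm_comp L l)"
  using harm_comp_represents[OF harm_comp_in, of l]
  by (simp_all add: comp_sq_def sph_mean_def power2_eq_square)

lemma comp_sq_nonneg: "comp_sq L l \<ge> 0"
  by (simp add: comp_sq_eq_sum sum_nonneg)

end

subsection \<open>Fluctuation modes of a state\<close>

definition fluct :: "((real^'n::finite \<Rightarrow> real) \<Rightarrow> real) \<Rightarrow> (real^'n \<Rightarrow> real) \<Rightarrow> real" where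
  "fluct \<Lambda> p = \<Lambda> p - sph_mean p"

definition flux :: "((real^'n::finite \<Rightarrow> real) \<Rightarrow> real) \<Rightarrow> real^'n" where
  "flux \<Lambda> = (\<chi> i. \<Lambda> (\<lambda>x. x $ i))"

text \<open>In degree 0 the factor is 1, the component of the full density, and not the zero
  component of the fluctuation: the mean of the density also drives the first mode.\<close>

definition coupling :: "((real^'n::finite \<Rightarrow> real) \<Rightarrow> real) \<Rightarrow> nat \<Rightarrow> real" where
  "coupling \<Lambda> l = sph_mean (\<lambda>x. (if l = 0 then 1 else harm_comp (fluct \<Lambda>) l x) *
     ((flux \<Lambda> \<bullet> x) * harm_comp (fluct \<Lambda>) (Suc l) x))"

definition drift :: "((real^'n::finite \<Rightarrow> real) \<Rightarrow> real) \<Rightarrow> real \<Rightarrow> (real^'n \<Rightarrow> real) \<Rightarrow> real" where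
  "drift \<Lambda> \<sigma> \<phi> = \<Lambda> (\<lambda>x. flux \<Lambda> \<bullet> gradS \<phi> x + \<sigma> * lapS \<phi> x)"

context
  fixes \<Lambda> :: "(real^'n::finite \<Rightarrow> real) \<Rightarrow> real"
  assumes n: "CARD('n) \<ge> 2" and st: "state \<Lambda>"
begin

lemma poly_linear_fluct: "poly_linear (fluct \<Lambda>)"
  unfolding poly_linear_def fluct_def
  by (simp add: state_add[OF st] state_cmult[OF st] sph_mean_add sph_mean_cmult algebra_simps)

lemma fluct_sph_harm: "Y \<in> sph_harm l \<Longrightarrow> l > 0 \<Longrightarrow> fluct \<Lambda> Y = \<Lambda> Y"
  using sph_mean_sph_harm n by (simp add: fluct_def)

lemma fluct_const: "fluct \<Lambda> (\<lambda>x. c) = 0"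
  by (simp add: fluct_def state_const[OF st])

lemma state_square_le:
  assumes p: "rpoly p"
  shows "(\<Lambda> p)\<^sup>2 \<le> \<Lambda> (\<lambda>x. (p x)\<^sup>2)"
proof -
  let ?a = "\<Lambda> p"
  have "0 \<le> \<Lambda> (\<lambda>x. (p x - ?a)\<^sup>2)"
    using p by (intro state_nonneg[OF st]) auto
  also have "(\<lambda>x. (p x - ?a)\<^sup>2) = (\<lambda>x. ((p x)\<^sup>2 - 2 * ?a * p x) + ?a\<^sup>2)"
    by (auto simp: power2_eq_square algebra_simps)
  also have "\<Lambda> \<dots> = \<Lambda> (\<lambda>x. (p x)\<^sup>2) - 2 * ?a * ?a + ?a\<^sup>2"
    using p by (simp add: state_add[OF st] state_diff[OF st] state_cmult[OF st] state_const[OF st])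
  finally show ?thesis by (simp add: power2_eq_square)
qed

lemma comp_sq_0: "comp_sq (fluct \<Lambda>) 0 = 0"
proof -
  have "harm_comp (fluct \<Lambda>) 0 = (\<lambda>x. harm_comp (fluct \<Lambda>) 0 0)"
    using homog_0_const[OF sph_harm_homog[OF harm_comp_in[OF n poly_linear_fluct]]] by blast
  then obtain c where "harm_comp (fluct \<Lambda>) 0 = (\<lambda>x. c)" by blast
  then have "fluct \<Lambda> (harm_comp (fluct \<Lambda>) 0) = 0"
    by (simp add: fluct_const)
  then show ?thesis by (simp add: comp_sq_eq_pairing[OF n poly_linear_fluct])
qed

text \<open>With g the component, c its squared norm and \<open>l > 0\<close>,
  \<open>c = \<Lambda> g\<close>. The variance inequality and the pointwise bound on g give
  \<open>c\<^sup>2 \<le> \<Lambda> (g\<^sup>2) \<le> sup_const * c\<close>.\<close>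

lemma comp_sq_le: "comp_sq (fluct \<Lambda>) l \<le> sup_const TYPE('n) l"
proof (cases "l = 0")
  case True
  then show ?thesis using comp_sq_0 sup_const_ge_1[where 'n='n, of l] by simp
next
  case False
  let ?g = "harm_comp (fluct \<Lambda>) l" and ?c = "comp_sq (fluct \<Lambda>) l"
  have g: "?g \<in> sph_harm l" by (rule harm_comp_in[OF n poly_linear_fluct])
  have "?c\<^sup>2 = (\<Lambda> ?g)\<^sup>2"
    using fluct_sph_harm[OF g] False by (simp add: comp_sq_eq_pairing[OF n poly_linear_fluct])
  also have "\<dots> \<le> \<Lambda> (\<lambda>x. (?g x)\<^sup>2)"
    using g by (intro state_square_le) simp
  also have "\<dots> \<le> \<Lambda> (\<lambda>x. sup_const TYPE('n) l * ?c)"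
    using g sph_harm_pointwise[OF g n] comp_sq_eq[OF n poly_linear_fluct]
    by (intro state_mono[OF st]) auto
  finally have "?c * ?c \<le> sup_const TYPE('n) l * ?c"
    by (simp add: state_const[OF st] power2_eq_square)
  then show ?thesis
    using comp_sq_nonneg[OF n poly_linear_fluct, of l] sup_const_ge_1[where 'n='n, of l]
    by (cases "?c = 0") (auto simp: mult_le_cancel_right)
qed

lemma state_inner_flux: "\<Lambda> (\<lambda>x. v \<bullet> x) = v \<bullet> flux \<Lambda>"
  by (simp add: inner_vec_def flux_def state_sum[OF st] state_cmult[OF st])

lemma norm_flux_le: "norm (flux \<Lambda>) \<le> 1"
proof -
  have "(norm (flux \<Lambda>))\<^sup>2 = \<Lambda> (\<lambda>x. flux \<Lambda> \<bullet> x)"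
    by (simp add: state_inner_flux dot_square_norm)
  also have "\<dots> \<le> \<Lambda> (\<lambda>x. norm (flux \<Lambda>))"
    using norm_cauchy_schwarz[of "flux \<Lambda>"] by (intro state_mono[OF st]) (auto, metis mult.right_neutral)
  finally have "norm (flux \<Lambda>) * norm (flux \<Lambda>) \<le> norm (flux \<Lambda>)"
    by (simp add: state_const[OF st] power2_eq_square)
  then show ?thesis
    by (cases "norm (flux \<Lambda>) = 0") (auto simp: mult_le_cancel_right1)
qed

text \<open>Harmonics of degree one are linear forms, since their partial derivatives have degree 0.
  The factor n inverts the second moments of the sphere, which \<open>sph_mean_pd\<close>
  yields.\<close>

lemma harm_comp_1: "harm_comp (fluct \<Lambda>) 1 = (\<lambda>x. real CARD('n) * (flux \<Lambda> \<bullet> x))"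
proof (rule harm_comp_eqI[OF n poly_linear_fluct])
  show "(\<lambda>x. real CARD('n) * (flux \<Lambda> \<bullet> x)) \<in> sph_harm 1"
    by (intro sph_harm_cmult sph_harm_inner)
  fix Z :: "real^'n \<Rightarrow> real" assume Z: "Z \<in> sph_harm 1"
  have h: "homog 1 Z" by (rule sph_harm_homog[OF Z])
  define z where "z = (\<chi> j. pd j Z 0)"
  have pdZ: "pd j Z = (\<lambda>x. z $ j)" for j
    using homog_0_const[OF homog_pd[of 0 Z j]] h by (simp add: z_def fun_eq_iff)
  have Zx: "Z = (\<lambda>x. z \<bullet> x)"
    using euler[OF h] by (simp add: pdZ inner_vec_def fun_eq_iff mult.commute)
  have "sph_mean (\<lambda>x. x $ j * Z x) = z $ j / real CARD('n)" for j
    using sph_mean_pd[OF h, of j] by (simp add: pdZ)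
  moreover have "(\<lambda>x. real CARD('n) * (flux \<Lambda> \<bullet> x) * Z x)
      = (\<lambda>x. \<Sum>j\<in>UNIV. (real CARD('n) * flux \<Lambda> $ j) * (x $ j * Z x))"
    by (simp add: inner_vec_def sum_distrib_left sum_distrib_right algebra_simps)
  ultimately have "sph_mean (\<lambda>x. real CARD('n) * (flux \<Lambda> \<bullet> x) * Z x) = flux \<Lambda> \<bullet> z"
    using h by (simp add: sph_mean_sum sph_mean_cmult inner_vec_def)
  also have "\<dots> = \<Lambda> Z" by (subst Zx) (simp add: state_inner_flux inner_commute)
  also have "\<dots> = fluct \<Lambda> Z" using fluct_sph_harm[OF Z] by simp
  finally show "sph_mean (\<lambda>x. real CARD('n) * (flux \<Lambda> \<bullet> x) * Z x) = fluct \<Lambda> Z" .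
qed

lemma comp_sq_1: "comp_sq (fluct \<Lambda>) 1 = real CARD('n) * (flux \<Lambda> \<bullet> flux \<Lambda>)"
proof -
  have "comp_sq (fluct \<Lambda>) 1 = \<Lambda> (harm_comp (fluct \<Lambda>) 1)"
    using fluct_sph_harm[OF harm_comp_in[OF n poly_linear_fluct, of 1]]
    by (simp add: comp_sq_eq_pairing[OF n poly_linear_fluct])
  then show ?thesis
    by (simp add: harm_comp_1[simplified] state_cmult[OF st] state_inner_flux)
qed

lemma coupling_0: "coupling \<Lambda> 0 = flux \<Lambda> \<bullet> flux \<Lambda>"
proof -
  have "real CARD('n) * coupling \<Lambda> 0 = sph_mean (\<lambda>x. (harm_comp (fluct \<Lambda>) 1 x)\<^sup>2)"
    using sph_mean_cmult[of "\<lambda>x. (flux \<Lambda> \<bullet> x) * harm_comp (fluct \<Lambda>) 1 x" "real CARD('n)"]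
    by (simp add: coupling_def harm_comp_1[simplified] power2_eq_square mult_ac)
  also have "\<dots> = real CARD('n) * (flux \<Lambda> \<bullet> flux \<Lambda>)"
    using comp_sq_1 by (simp add: comp_sq_eq[OF n poly_linear_fluct])
  finally show ?thesis by simp
qed

text \<open>The linear form is at most 1 on the sphere because the flux has norm at most 1; the rest
  is the inequality of arithmetic and geometric means.\<close>

lemma coupling_abs_le:
  assumes "l > 0"
  shows "2 * \<bar>coupling \<Lambda> l\<bar> \<le> comp_sq (fluct \<Lambda>) l + comp_sq (fluct \<Lambda>) (Suc l)"
proof -
  let ?g = "harm_comp (fluct \<Lambda>)"
  have g: "rpoly (?g k)" for k by (rule sph_harm_rpoly[OF harm_comp_in[OF n poly_linear_fluct]])
  have bd: "\<bar>2 * (?g l x * ((flux \<Lambda> \<bullet> x) * ?g (Suc l) x))\<bar> \<le> (?g l x)\<^sup>2 + (?g (Suc l) x)\<^sup>2"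
    if "norm x = 1" for x
  proof -
    have "\<bar>flux \<Lambda> \<bullet> x\<bar> \<le> 1"
      using Cauchy_Schwarz_ineq2[of "flux \<Lambda>" x] norm_flux_le that by simp
    then have "\<bar>flux \<Lambda> \<bullet> x\<bar> * \<bar>?g l x * ?g (Suc l) x\<bar> \<le> 1 * \<bar>?g l x * ?g (Suc l) x\<bar>"
      by (intro mult_right_mono) auto
    moreover have "2 * \<bar>?g l x * ?g (Suc l) x\<bar> \<le> (?g l x)\<^sup>2 + (?g (Suc l) x)\<^sup>2"
      using sum_squares_bound[of "\<bar>?g l x\<bar>" "\<bar>?g (Suc l) x\<bar>"] by (simp add: abs_mult)
    ultimately show ?thesis by (simp add: abs_mult mult_ac)
  qed
  let ?p = "\<lambda>x. 2 * (?g l x * ((flux \<Lambda> \<bullet> x) * ?g (Suc l) x))"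
  have eq: "2 * coupling \<Lambda> l = sph_mean ?p"
    using assms g by (simp add: coupling_def sph_mean_cmult)
  have "sph_mean ?p \<le> sph_mean (\<lambda>x. (?g l x)\<^sup>2 + (?g (Suc l) x)\<^sup>2)"
    using g bd by (intro sph_mean_mono) (auto simp: abs_le_iff)
  moreover have "sph_mean (\<lambda>x. -1 * ?p x) \<le> sph_mean (\<lambda>x. (?g l x)\<^sup>2 + (?g (Suc l) x)\<^sup>2)"
    using g bd by (intro sph_mean_mono) (auto simp: abs_le_iff)
  moreover have "sph_mean (\<lambda>x. -1 * ?p x) = - sph_mean ?p"
    using sph_mean_cmult[of ?p "-1"] g by simp
  moreover have "sph_mean (\<lambda>x. (?g l x)\<^sup>2 + (?g (Suc l) x)\<^sup>2) = comp_sq (fluct \<Lambda>) l + comp_sq (fluct \<Lambda>) (Suc l)"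
    using g by (simp add: sph_mean_add comp_sq_eq[OF n poly_linear_fluct])
  ultimately show ?thesis using eq by linarith
qed

text \<open>Let k = l + 1 and m = n + 2 k - 2, and let g be the component of degree k. On the sphere
  \<open>(J . x) g = P + W / m\<close> with harmonics P of degree k + 1 and W of degree k - 1. By
  orthogonality \<open>\<Lambda> P\<close> is the coupling at k and \<open>\<Lambda> W\<close> is m
  times the coupling at k - 1. The transport term is
  \<open>W - k (J . x) g = (1 - k / m) W - k P\<close>.\<close>

lemma drift_harm_comp:
  "drift \<Lambda> \<sigma> (harm_comp (fluct \<Lambda>) (Suc l)) =
     - \<sigma> * eig TYPE('n) (Suc l) * comp_sq (fluct \<Lambda>) (Suc l)
     - real (Suc l) * coupling \<Lambda> (Suc l) + (real CARD('n) + real (Suc l) - 2) * coupling \<Lambda> l"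
proof -
  let ?J = "flux \<Lambda>"
  let ?g = "harm_comp (fluct \<Lambda>)"
  let ?k = "real (Suc l)"
  let ?m = "real CARD('n) + 2 * ?k - 2"
  define h where "h = (if l = 0 then (\<lambda>x. 1) else ?g l)"
  define W where "W = dird ?J (?g (Suc l))"
  define P where "P = raise ?J (Suc l) (?g (Suc l))"
  have m: "?m > 0" using n by simp
  have gS: "?g k \<in> sph_harm k" for k by (rule harm_comp_in[OF n poly_linear_fluct])
  have W: "W \<in> sph_harm l" unfolding W_def by (rule sph_harm_dird[OF gS])
  have P: "P \<in> sph_harm (Suc (Suc l))" unfolding P_def by (rule sph_harm_raise[OF gS n])
  have hS: "h \<in> sph_harm l" using gS sph_harm_const by (auto simp: h_def)
  have g: "rpoly (?g k)" for k by (rule sph_harm_rpoly[OF gS])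
  have xg: "(?J \<bullet> x) * ?g (Suc l) x = P x + W x / ?m" if "norm x = 1" for x
    using that by (simp add: P_def raise_def W_def dot_square_norm)
  have LW: "\<Lambda> W = sph_mean (\<lambda>x. h x * W x)"
  proof (cases "l = 0")
    case True
    then have "W = (\<lambda>x. W 0)" using homog_0_const sph_harm_homog[OF W] by blast
    then obtain c where "W = (\<lambda>x. c)" by blast
    with True show ?thesis by (simp add: h_def state_const[OF st])
  next
    case False
    then show ?thesis
      using fluct_sph_harm[OF W] harm_comp_represents[OF n poly_linear_fluct W] by (simp add: h_def)
  qed
  have "coupling \<Lambda> l = sph_mean (\<lambda>x. h x * ((?J \<bullet> x) * ?g (Suc l) x))"
    by (simp add: coupling_def h_def)
  also have "\<dots> = sph_mean (\<lambda>x. h x * P x + (1 / ?m) * (h x * W x))"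
    using g W P hS by (intro sph_mean_cong) (auto simp: xg algebra_simps)
  also have "\<dots> = sph_mean (\<lambda>x. h x * P x) + (1 / ?m) * sph_mean (\<lambda>x. h x * W x)"
    using W P hS by (simp add: sph_mean_add sph_mean_cmult del: times_divide_eq_left)
  also have "sph_mean (\<lambda>x. h x * P x) = 0"
    using sph_harm_orthogonal[OF hS P _ n] by simp
  finally have c1: "\<Lambda> W = ?m * coupling \<Lambda> l" using m LW by simp
  have "coupling \<Lambda> (Suc l) = sph_mean (\<lambda>x. ?g (Suc (Suc l)) x * ((?J \<bullet> x) * ?g (Suc l) x))"
    by (simp add: coupling_def mult_ac)
  also have "\<dots> = sph_mean (\<lambda>x. ?g (Suc (Suc l)) x * P x + (1 / ?m) * (?g (Suc (Suc l)) x * W x))"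
    using g W P
    by (intro sph_mean_cong) (auto simp: xg algebra_simps)
  also have "\<dots> = sph_mean (\<lambda>x. ?g (Suc (Suc l)) x * P x) + (1 / ?m) * sph_mean (\<lambda>x. ?g (Suc (Suc l)) x * W x)"
    using W P g by (simp add: sph_mean_add sph_mean_cmult del: times_divide_eq_left)
  also have "sph_mean (\<lambda>x. ?g (Suc (Suc l)) x * W x) = 0"
    using sph_harm_orthogonal[OF gS W _ n] by simp
  also have "sph_mean (\<lambda>x. ?g (Suc (Suc l)) x * P x) = \<Lambda> P"
    using harm_comp_represents[OF n poly_linear_fluct P] fluct_sph_harm[OF P] by simp
  finally have c2: "\<Lambda> P = coupling \<Lambda> (Suc l)" by simp
  have c3: "\<Lambda> (?g (Suc l)) = comp_sq (fluct \<Lambda>) (Suc l)"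
    using fluct_sph_harm[OF gS, of "Suc l"] by (simp add: comp_sq_eq_pairing[OF n poly_linear_fluct])
  have "drift \<Lambda> \<sigma> (?g (Suc l)) = \<Lambda> (\<lambda>x. W x - ?k * ((?J \<bullet> x) * ?g (Suc l) x)
      + (- \<sigma> * eig TYPE('n) (Suc l)) * ?g (Suc l) x)"
    by (simp add: drift_def gradS_sph_harm[OF gS] lapS_sph_harm[OF gS] W_def mult.assoc)
  also have "\<dots> = \<Lambda> (\<lambda>x. (1 - ?k / ?m) * W x - ?k * P x + (- \<sigma> * eig TYPE('n) (Suc l)) * ?g (Suc l) x)"
    using W P g by (intro state_cong[OF st]) (auto simp: xg algebra_simps)
  also have "\<dots> = (1 - ?k / ?m) * \<Lambda> W - ?k * \<Lambda> P + (- \<sigma> * eig TYPE('n) (Suc l)) * \<Lambda> (?g (Suc l))"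
    using W P g by (simp add: state_add[OF st] state_diff[OF st] state_cmult[OF st] del: of_nat_Suc)
  also have "(1 - ?k / ?m) * \<Lambda> W = (real CARD('n) + ?k - 2) * coupling \<Lambda> l"
  proof -
    have "(1 - ?k / ?m) * ?m = real CARD('n) + ?k - 2"
      using m by (simp add: field_simps)
    then show ?thesis unfolding c1 by (simp add: mult.assoc[symmetric] del: of_nat_Suc)
  qed
  finally show ?thesis unfolding c2 c3 by simp
qed

text \<open>Collects the derivatives of the squared basis pairings in \<open>mode_derivative\<close>
  into a single drift of \<open>harm_comp\<close>.\<close>

lemma drift_sum:
  assumes E: "E \<subseteq> sph_harm l"
  shows "drift \<Lambda> \<sigma> (\<lambda>x. \<Sum>e\<in>E. a e * e x) = (\<Sum>e\<in>E. a e * drift \<Lambda> \<sigma> e)"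
proof -
  define D where "D = (\<lambda>\<phi> x. dird (flux \<Lambda>) \<phi> x - real l * ((flux \<Lambda> \<bullet> x) * \<phi> x) + \<sigma> * (- eig TYPE('n) l * \<phi> x))"
  have D: "drift \<Lambda> \<sigma> \<phi> = \<Lambda> (D \<phi>)" if "\<phi> \<in> sph_harm l" for \<phi>
    using that by (simp add: drift_def gradS_sph_harm lapS_sph_harm D_def)
  have rp: "rpoly e" if "e \<in> E" for e using that E by auto
  have DE: "rpoly (D e)" if "e \<in> E" for e
    unfolding D_def using rp[OF that] by simp
  have dsum: "dird v (\<lambda>x. \<Sum>e\<in>E. a e * e x) x = (\<Sum>e\<in>E. a e * dird v e x)" for v x
  proof -
    have "dird v (\<lambda>x. \<Sum>e\<in>E. a e * e x) x = (\<Sum>i\<in>UNIV. \<Sum>e\<in>E. v $ i * (a e * pd i e x))"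
      using rp by (simp add: dird_def sum_distrib_left)
    also have "\<dots> = (\<Sum>e\<in>E. \<Sum>i\<in>UNIV. v $ i * (a e * pd i e x))" by (rule sum.swap)
    finally show ?thesis by (simp add: dird_def sum_distrib_left mult_ac)
  qed
  have "D (\<lambda>x. \<Sum>e\<in>E. a e * e x) = (\<lambda>x. \<Sum>e\<in>E. a e * D e x)"
    unfolding D_def dsum
    by (rule ext) (simp add: sum_distrib_left sum_subtractf sum.distrib sum_negf algebra_simps)
  moreover have "(\<lambda>x. \<Sum>e\<in>E. a e * e x) \<in> sph_harm l"
    using E by (intro sph_harm_sum sph_harm_cmult) auto
  ultimately have "drift \<Lambda> \<sigma> (\<lambda>x. \<Sum>e\<in>E. a e * e x) = \<Lambda> (\<lambda>x. \<Sum>e\<in>E. a e * D e x)"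
    using D by simp
  also have "\<dots> = (\<Sum>e\<in>E. a e * \<Lambda> (D e))"
    using DE by (simp add: state_sum[OF st] state_cmult[OF st])
  finally show ?thesis
    using D E by (simp add: subset_eq)
qed

end

subsection \<open>Solutions of the Doi equation\<close>

context
  fixes \<sigma> :: real and \<mu>0 :: "(real^'n::finite) measure" and f :: "real \<Rightarrow> real^'n \<Rightarrow> real"
  assumes n: "CARD('n) \<ge> 2" and sol: "doi_solution \<sigma> \<mu>0 f"
begin

definition sol_state :: "real \<Rightarrow> (real^'n \<Rightarrow> real) \<Rightarrow> real" where
  "sol_state t p = (if t = 0 then \<integral>x. p x \<partial>\<mu>0 else \<integral>x. p x * f t x \<partial>sph)"

lemma state_sol_state:
  assumes "t \<ge> 0"
  shows "state (sol_state t)"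
proof (cases "t = 0")
  case True
  have m: "emeasure \<mu>0 (space \<mu>0) = 1" "sets \<mu>0 = sets borel" "emeasure \<mu>0 (- sphere 0 1) = 0"
    using sol by (auto simp: doi_solution_def)
  have fm: "finite_measure \<mu>0" using m(1) by (intro finite_measureI) simp
  have "- sphere (0::real^'n) 1 \<in> sets \<mu>0"
    unfolding m(2) by (intro borel_open) (simp add: open_Compl)
  then have "AE x in \<mu>0. x \<in> sphere 0 1"
    using m(3) by (intro AE_I'[of "- sphere 0 1"]) (auto simp: null_sets_def)
  moreover have "measure \<mu>0 (space \<mu>0) = 1" using m(1) by (simp add: measure_def)
  ultimately have "state (\<lambda>p. \<integral>x. p x * 1 \<partial>\<mu>0)"
    using m(2) fm by (intro state_integral) (auto simp: finite_measure.integrable_const)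
  with True show ?thesis by (simp add: sol_state_def[abs_def])
next
  case False
  with assms have f: "\<forall>x\<in>sphere 0 1. f t x > 0" "integrable sph (f t)" "(\<integral>x. f t x \<partial>sph) = 1"
    using sol unfolding doi_solution_def by auto
  have "state (\<lambda>p. \<integral>x. p x * f t x \<partial>sph)"
  proof (rule state_integral)
    show "AE x in sph. 0 \<le> f t x"
      using AE_sph by eventually_elim (use f(1) in \<open>auto intro: less_imp_le\<close>)
  qed (use f AE_sph in auto)
  with False show ?thesis by (simp add: sol_state_def[abs_def])
qed

lemma fluct_sol_state: "fluct (sol_state t) = sol_fun \<mu>0 f t"
  by (auto simp: fun_eq_iff fluct_def sol_fun_def sol_state_def meas_fun_def dens_fun_def sph_mean_def)

lemma flux_sol_state: "t > 0 \<Longrightarrow> flux (sol_state t) = Jf (f t)"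
  by (simp add: flux_def Jf_def sol_state_def)

lemma sol_state_tendsto_0:
  "rpoly \<phi> \<Longrightarrow> ((\<lambda>t. sol_state t \<phi>) \<longlongrightarrow> sol_state 0 \<phi>) (at_right 0)"
proof -
  assume "rpoly \<phi>"
  then have "((\<lambda>t. \<integral>x. \<phi> x * f t x \<partial>sph) \<longlongrightarrow> sol_state 0 \<phi>) (at_right 0)"
    using sol by (simp add: doi_solution_def sol_state_def)
  moreover have "\<forall>\<^sub>F t in at_right 0. (\<integral>x. \<phi> x * f t x \<partial>sph) = sol_state t \<phi>"
    by (intro eventually_at_rightI[of 0 1]) (auto simp: sol_state_def)
  ultimately show ?thesis by (rule Lim_transform_eventually)
qed

lemma sol_state_derivative:
  assumes "rpoly \<phi>" "t > 0"
  shows "((\<lambda>t. sol_state t \<phi>) has_real_derivative drift (sol_state t) \<sigma> \<phi>) (at t)"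
proof -
  have "((\<lambda>\<tau>. \<integral>x. \<phi> x * f \<tau> x \<partial>sph) has_real_derivative drift (sol_state t) \<sigma> \<phi>) (at t)"
    using sol assms flux_sol_state[OF assms(2)]
    by (simp add: doi_solution_def drift_def sol_state_def)
  then show ?thesis
    by (rule has_field_derivative_transform_within_open[where S="{0<..}"])
      (use assms in \<open>auto simp: sol_state_def\<close>)
qed

definition mode :: "nat \<Rightarrow> real \<Rightarrow> real" where
  "mode l t = comp_sq (sol_fun \<mu>0 f t) l"

lemma mode_eq_sum: "t \<ge> 0 \<Longrightarrow> mode l t = (\<Sum>e\<in>harm_basis l. (fluct (sol_state t) e)\<^sup>2)"
  using comp_sq_eq_sum[OF n poly_linear_fluct[OF n state_sol_state]]
  by (simp add: mode_def fluct_sol_state)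

lemma harm_basis_rpoly: "e \<in> harm_basis l \<Longrightarrow> rpoly (e :: real^'n \<Rightarrow> real)"
  using orthonormal_harm_basis[OF n, of l] unfolding orthonormal_def by auto

lemma mode_tendsto_0: "((\<lambda>t. mode l t) \<longlongrightarrow> mode l 0) (at_right 0)"
proof -
  have "((\<lambda>t. \<Sum>e\<in>harm_basis l. (fluct (sol_state t) e)\<^sup>2) \<longlongrightarrow> mode l 0) (at_right 0)"
    unfolding mode_eq_sum[OF order_refl] fluct_def
    by (intro tendsto_intros sol_state_tendsto_0 harm_basis_rpoly)
  moreover have "\<forall>\<^sub>F t in at_right 0. (\<Sum>e\<in>harm_basis l. (fluct (sol_state t) e)\<^sup>2) = mode l t"
    by (intro eventually_at_rightI[of 0 1]) (auto simp: mode_eq_sum)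
  ultimately show ?thesis by (rule Lim_transform_eventually)
qed

lemma mode_derivative:
  assumes t: "t > 0"
  shows "(mode (Suc l) has_real_derivative
     - 2 * \<sigma> * eig TYPE('n) (Suc l) * mode (Suc l) t
     - 2 * real (Suc l) * coupling (sol_state t) (Suc l)
     + 2 * (real CARD('n) + real (Suc l) - 2) * coupling (sol_state t) l) (at t)"
proof -
  let ?E = "harm_basis (Suc l) :: (real^'n \<Rightarrow> real) set"
  have st: "state (sol_state t)" using t by (intro state_sol_state) simp
  have E: "?E \<subseteq> sph_harm (Suc l)"
    using orthonormal_harm_basis[OF n, of "Suc l"] unfolding orthonormal_def by auto
  have "((\<lambda>t. \<Sum>e\<in>?E. (fluct (sol_state t) e)\<^sup>2) has_real_derivative
      (\<Sum>e\<in>?E. 2 * (fluct (sol_state t) e * drift (sol_state t) \<sigma> e))) (at t)"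
    unfolding fluct_def
    by (rule derivative_eq_intros sol_state_derivative harm_basis_rpoly t refl | assumption)+
      (auto simp: algebra_simps)
  also have "(\<Sum>e\<in>?E. 2 * (fluct (sol_state t) e * drift (sol_state t) \<sigma> e))
      = 2 * drift (sol_state t) \<sigma> (harm_comp (fluct (sol_state t)) (Suc l))"
    unfolding harm_comp_eq[OF n poly_linear_fluct[OF n st]] drift_sum[OF n st E]
    by (simp add: sum_distrib_left)
  also have "\<dots> = - 2 * \<sigma> * eig TYPE('n) (Suc l) * mode (Suc l) t
     - 2 * real (Suc l) * coupling (sol_state t) (Suc l)
     + 2 * (real CARD('n) + real (Suc l) - 2) * coupling (sol_state t) l"
    using drift_harm_comp[OF n st, of \<sigma> l]
    by (simp add: mode_def fluct_sol_state[symmetric] algebra_simps)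
  finally show ?thesis
    by (rule has_field_derivative_transform_within_open[where S="{0<..}"])
      (use t in \<open>auto simp: mode_eq_sum\<close>)
qed

lemma mode_0: "t \<ge> 0 \<Longrightarrow> mode 0 t = 0"
  using comp_sq_0[OF n state_sol_state] by (simp add: mode_def fluct_sol_state)

lemma mode_nonneg: "t \<ge> 0 \<Longrightarrow> mode l t \<ge> 0"
  by (simp add: mode_eq_sum sum_nonneg)

lemma mode_le: "t \<ge> 0 \<Longrightarrow> mode l t \<le> sup_const TYPE('n) l"
  using comp_sq_le[OF n state_sol_state] by (simp add: mode_def fluct_sol_state)

lemma mode_1: "t > 0 \<Longrightarrow> mode 1 t = real CARD('n) * (Jf (f t) \<bullet> Jf (f t))"
  using comp_sq_1[OF n state_sol_state, of t]
  by (simp add: mode_def fluct_sol_state flux_sol_state)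

lemma coupling_sol_0: "t > 0 \<Longrightarrow> coupling (sol_state t) 0 = mode 1 t / real CARD('n)"
  using coupling_0[OF n state_sol_state, of t]
  by (simp add: mode_1[simplified] flux_sol_state)

lemma coupling_sol_le:
  "t \<ge> 0 \<Longrightarrow> l > 0 \<Longrightarrow> 2 * \<bar>coupling (sol_state t) l\<bar> \<le> mode l t + mode (Suc l) t"
  using coupling_abs_le[OF n state_sol_state, of t l]
  by (simp add: mode_def fluct_sol_state)

end

subsection \<open>Differential inequalities and series\<close>

lemma gronwall_decay:
  fixes u :: "real \<Rightarrow> real"
  assumes "0 < \<alpha>" "0 \<le> \<beta>" "s \<le> t"
    and der: "\<And>x. s \<le> x \<Longrightarrow> x \<le> t \<Longrightarrow> (u has_real_derivative u' x) (at x)"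
    and le: "\<And>x. s \<le> x \<Longrightarrow> x \<le> t \<Longrightarrow> u' x \<le> - \<alpha> * u x + \<beta>"
  shows "u t \<le> exp (- \<alpha> * (t - s)) * u s + \<beta> / \<alpha>"
proof -
  let ?v = "\<lambda>x. exp (\<alpha> * (x - s)) * (u x - \<beta> / \<alpha>)"
  have "?v s \<ge> ?v t"
  proof (rule DERIV_nonpos_imp_nonincreasing[OF \<open>s \<le> t\<close>])
    fix x assume x: "s \<le> x" "x \<le> t"
    have "(?v has_real_derivative exp (\<alpha> * (x - s)) * (u' x + \<alpha> * u x - \<beta>)) (at x)"
      using \<open>0 < \<alpha>\<close> by (auto intro!: derivative_eq_intros der[OF x] simp: field_simps)
    moreover have "exp (\<alpha> * (x - s)) * (u' x + \<alpha> * u x - \<beta>) \<le> 0"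
      using le[OF x] by (intro mult_nonneg_nonpos) auto
    ultimately show "\<exists>y. (?v has_real_derivative y) (at x) \<and> y \<le> 0" by blast
  qed
  then have "exp (- \<alpha> * (t - s)) * (exp (\<alpha> * (t - s)) * (u t - \<beta> / \<alpha>)) \<le> exp (- \<alpha> * (t - s)) * (u s - \<beta> / \<alpha>)"
    by (intro mult_left_mono) auto
  then have "u t - \<beta> / \<alpha> \<le> exp (- \<alpha> * (t - s)) * (u s - \<beta> / \<alpha>)"
    by (simp add: mult.assoc[symmetric] exp_add[symmetric])
  moreover have "0 \<le> exp (- \<alpha> * (t - s)) * (\<beta> / \<alpha>)" using assms by simp
  ultimately show ?thesis by (simp add: algebra_simps)
qed

text \<open>Derivatives are available for positive times only; the estimate starts at s > 0 and s
  tends to 0.\<close>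

lemma gronwall_decay_0:
  fixes u :: "real \<Rightarrow> real"
  assumes "0 < \<alpha>" "0 \<le> \<beta>" "0 < t"
    and der: "\<And>x. 0 < x \<Longrightarrow> (u has_real_derivative u' x) (at x)"
    and le: "\<And>x. 0 < x \<Longrightarrow> u' x \<le> - \<alpha> * u x + \<beta>"
    and lim: "(u \<longlongrightarrow> u0) (at_right 0)"
  shows "u t \<le> exp (- \<alpha> * t) * u0 + \<beta> / \<alpha>"
proof (rule tendsto_lowerbound)
  have "((\<lambda>s. exp (- \<alpha> * (t - s)) * u s + \<beta> / \<alpha>) \<longlongrightarrow> exp (- \<alpha> * (t - 0)) * u0 + \<beta> / \<alpha>) (at_right 0)"
    by (intro tendsto_intros lim)
  then show "((\<lambda>s. exp (- \<alpha> * (t - s)) * u s + \<beta> / \<alpha>) \<longlongrightarrow> exp (- \<alpha> * t) * u0 + \<beta> / \<alpha>) (at_right 0)"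
    by simp
  show "\<forall>\<^sub>F s in at_right 0. u t \<le> exp (- \<alpha> * (t - s)) * u s + \<beta> / \<alpha>"
    using assms by (intro eventually_at_rightI[of 0 t] gronwall_decay[where u'=u']) auto
qed simp

lemma summable_poly_geometric:
  fixes r :: real
  assumes "0 \<le> r" "r < 1"
  shows "summable (\<lambda>l. r ^ l * (real l + 1) ^ p)"
proof -
  have "((\<lambda>l. r * (1 + inverse (real (Suc l))) ^ p) \<longlongrightarrow> r * (1 + 0) ^ p) sequentially"
    by (intro tendsto_intros LIMSEQ_inverse_real_of_nat)
  then have "\<forall>\<^sub>F l in sequentially. r * (1 + inverse (real (Suc l))) ^ p < (1 + r) / 2"
    using assms by (intro order_tendstoD) auto
  then obtain N where N: "\<And>l. l \<ge> N \<Longrightarrow> r * (1 + inverse (real (Suc l))) ^ p < (1 + r) / 2"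
    unfolding eventually_sequentially by blast
  show ?thesis
  proof (rule summable_ratio_test)
    show "(1 + r) / 2 < 1" using assms by simp
    fix l assume l: "N \<le> l"
    have "(real (Suc l) + 1) = (1 + inverse (real (Suc l))) * (real l + 1)"
      by (simp add: field_simps)
    then have "r ^ Suc l * (real (Suc l) + 1) ^ p
        = (r * (1 + inverse (real (Suc l))) ^ p) * (r ^ l * (real l + 1) ^ p)"
      by (simp only: power_mult_distrib) simp
    also have "\<dots> \<le> (1 + r) / 2 * (r ^ l * (real l + 1) ^ p)"
      using N[OF l] assms by (intro mult_right_mono) auto
    finally show "norm (r ^ Suc l * (real (Suc l) + 1) ^ p) \<le> (1 + r) / 2 * norm (r ^ l * (real l + 1) ^ p)"
      using assms by simp
  qed
qed

text \<open>Removes the damping. Partial sums are used because they pass to the limit r = 1 without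
  any prior summability of the undamped series.\<close>

lemma sum_le_of_damped_le:
  fixes x :: "nat \<Rightarrow> real"
  assumes "r0 < 1" and le: "\<And>r. r0 < r \<Longrightarrow> r < 1 \<Longrightarrow> (\<Sum>l<N. r ^ l * x l) \<le> g r"
    and lim: "(g \<longlongrightarrow> G) (at_left 1)"
  shows "(\<Sum>l<N. x l) \<le> G"
proof (rule tendsto_le[OF _ lim])
  have "((\<lambda>r. \<Sum>l<N. r ^ l * x l) \<longlongrightarrow> (\<Sum>l<N. 1 ^ l * x l)) (at_left 1)"
    by (intro tendsto_intros)
  then show "((\<lambda>r. \<Sum>l<N. r ^ l * x l) \<longlongrightarrow> (\<Sum>l<N. x l)) (at_left 1)" by simp
  show "\<forall>\<^sub>F r in at_left 1. (\<Sum>l<N. r ^ l * x l) \<le> g r"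
    using assms by (intro eventually_at_leftI[of r0]) auto
qed simp

subsection \<open>The mode hierarchy\<close>

text \<open>The hierarchy detached from the sphere: nonnegative modes of polynomial growth, coupled
  to their neighbours, with the lowest coupling expressed by the first mode.\<close>

locale mode_system =
  fixes n :: nat and \<sigma> A :: real and c m :: "nat \<Rightarrow> real \<Rightarrow> real"
  assumes n2: "n \<ge> 2" and sigma: "\<sigma> > 0"
    and c0: "\<And>t. t \<ge> 0 \<Longrightarrow> c 0 t = 0"
    and c_nonneg: "\<And>l t. t \<ge> 0 \<Longrightarrow> 0 \<le> c l t"
    and c_le: "\<And>l t. t \<ge> 0 \<Longrightarrow> c l t \<le> A * (real l + 1) ^ n"
    and c_deriv_Suc: "\<And>l t. t > 0 \<Longrightarrow> (c (Suc l) has_real_derivative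
        - 2 * \<sigma> * (real (Suc l) * (real (Suc l) + real n - 2)) * c (Suc l) t
        - 2 * real (Suc l) * m (Suc l) t + 2 * (real n + real (Suc l) - 2) * m l t) (at t)"
    and m0: "\<And>t. t > 0 \<Longrightarrow> m 0 t = c 1 t / real n"
    and m_le_pos: "\<And>l t. t > 0 \<Longrightarrow> l > 0 \<Longrightarrow> 2 * \<bar>m l t\<bar> \<le> c l t + c (Suc l) t"
    and c_lim: "\<And>l. (c l \<longlongrightarrow> c l 0) (at_right 0)"
begin

section \<open>A priori bounds for the modes and their derivatives\<close>

definition lam :: "nat \<Rightarrow> real" where
  "lam l = real l * (real l + real n - 2)"

definition d :: "nat \<Rightarrow> real \<Rightarrow> real" where
  "d l t = (if l = 0 then 0 else - 2 * \<sigma> * lam l * c l t - 2 * real l * m l t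
     + 2 * (real n + real l - 2) * m (l - 1) t)"

lemma c_deriv: "t > 0 \<Longrightarrow> (c l has_real_derivative d l t) (at t)"
proof (cases l)
  case 0
  assume t: "t > 0"
  have "((\<lambda>t. 0) has_real_derivative d l t) (at t)" using 0 by (simp add: d_def)
  then show ?thesis
    by (rule has_field_derivative_transform_within_open[where S="{0<..}"]) (use t 0 c0 in auto)
next
  case (Suc k)
  assume "t > 0"
  from c_deriv_Suc[OF this, of k] show ?thesis unfolding Suc d_def lam_def by simp
qed

text \<open>Extends \<open>m_le_pos\<close> to degree 0, where \<open>c 0 = 0\<close> and n at least
  2 makes up for it.\<close>

lemma m_le: "t > 0 \<Longrightarrow> 2 * \<bar>m l t\<bar> \<le> c l t + c (Suc l) t"
proof (cases "l = 0")
  case True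
  assume t: "t > 0"
  have "c 1 t \<ge> 0" using c_nonneg[of t 1] t by simp
  then have "2 * (c 1 t / real n) \<le> c 1 t"
    using n2 by (simp add: field_simps) (metis mult_right_mono of_nat_le_iff of_nat_numeral)
  with True t \<open>c 1 t \<ge> 0\<close> show ?thesis by (simp add: m0 c0)
qed (use m_le_pos in auto)

lemma lam_nonneg: "lam l \<ge> 0"
  using n2 by (cases l) (auto simp: lam_def)

lemma lam_ge_sq: "real l * real l \<le> lam l"
  using n2 by (auto simp: lam_def intro: mult_left_mono)

lemma lam_ge: "l > 0 \<Longrightarrow> real n - 1 \<le> lam l"
proof -
  assume "l > 0"
  then have "1 * (1 + real n - 2) \<le> real l * (real l + real n - 2)"
    using n2 by (intro mult_mono) auto
  then show ?thesis by (simp add: lam_def)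
qed

lemma lam_ge_l: "real l \<le> lam l"
  using lam_ge_sq[of l] by (cases l) (auto simp: algebra_simps intro: order_trans[rotated])

lemma lam_le: "lam l \<le> real n * (real l + 1) ^ 2"
proof -
  have "real l * (real l + real n - 2) \<le> (real l + 1) * (real n * (real l + 1))"
  proof (cases l)
    case (Suc k)
    have "real l + real n - 2 \<le> real n * (real l + 1)"
    proof -
      have "1 * real l \<le> real n * real l" using n2 by (intro mult_right_mono) auto
      then show ?thesis by (simp add: algebra_simps)
    qed
    then show ?thesis using n2 Suc by (intro mult_mono) auto
  qed simp
  then show ?thesis by (simp add: lam_def power2_eq_square algebra_simps)
qed

text \<open>The coupling is of first order in l, the diffusion of second order. This gap drives both
  the smoothing and the absorption of high modes.\<close>

lemma d_bound:
  assumes t: "t > 0"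
  shows "\<bar>d l t + 2 * \<sigma> * lam l * c l t\<bar> \<le> real n * real l * (c (l - 1) t + 2 * c l t + c (Suc l) t)"
proof (cases l)
  case 0
  then show ?thesis using c0[of t] t by (simp add: d_def)
next
  case (Suc k)
  have nn: "c j t \<ge> 0" for j using c_nonneg t by simp
  have a: "real n + real l - 2 \<le> real n * real l"
  proof -
    have "0 \<le> (real n - 1) * (real l - 1)" using n2 Suc by (intro mult_nonneg_nonneg) auto
    then show ?thesis by (simp add: algebra_simps)
  qed
  have b: "real l \<le> real n * real l" using n2 by (simp add: mult_le_cancel_right1)
  have "\<bar>d l t + 2 * \<sigma> * lam l * c l t\<bar> = \<bar>(real n + real l - 2) * (2 * m k t) - real l * (2 * m l t)\<bar>"
    using Suc by (simp add: d_def algebra_simps)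
  also have "\<dots> \<le> (real n + real l - 2) * (2 * \<bar>m k t\<bar>) + real l * (2 * \<bar>m l t\<bar>)"
    using abs_triangle_ineq4[of "(real n + real l - 2) * (2 * m k t)" "real l * (2 * m l t)"] n2 Suc
    by (simp add: abs_mult)
  also have "\<dots> \<le> (real n * real l) * (c k t + c l t) + (real n * real l) * (c l t + c (Suc l) t)"
    using m_le[OF t, of k] m_le[OF t, of l] a b nn Suc n2
    by (intro add_mono mult_mono) auto
  finally show ?thesis using Suc by (simp add: algebra_simps)
qed

lemma A_nonneg: "A \<ge> 0"
  using c_nonneg[of 0 0] c_le[of 0 0] by simp

definition dconst :: real where
  "dconst = A * (2 * \<sigma> * real n + 4 * real n * 2 ^ n)"

lemma c_neighbours:
  assumes "t \<ge> 0"
  shows "c (l - 1) t + 2 * c l t + c (Suc l) t \<le> 4 * (A * (2 ^ n * (real l + 1) ^ n))"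
proof -
  have step: "c j t \<le> A * (2 ^ n * (real l + 1) ^ n)" if "real j \<le> real l + 1" for j
  proof -
    have "c j t \<le> A * (real j + 1) ^ n" using c_le assms by simp
    also have "\<dots> \<le> A * (2 * (real l + 1)) ^ n"
      using that A_nonneg by (intro mult_left_mono power_mono) auto
    finally show ?thesis unfolding power_mult_distrib .
  qed
  have "real (l - 1) \<le> real l + 1" by linarith
  from step[OF this] step[of l] step[of "Suc l"] show ?thesis by simp
qed

lemma d_le:
  assumes t: "t > 0"
  shows "\<bar>d l t\<bar> \<le> dconst * (real l + 1) ^ (n + 2)"
proof -
  have "\<bar>d l t\<bar> \<le> \<bar>2 * \<sigma> * lam l * c l t\<bar> + \<bar>d l t + 2 * \<sigma> * lam l * c l t\<bar>" by linarith
  also have "\<bar>2 * \<sigma> * lam l * c l t\<bar> \<le> 2 * \<sigma> * (real n * (real l + 1) ^ 2) * (A * (real l + 1) ^ n)"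
  proof -
    have "2 * \<sigma> * lam l * c l t \<le> 2 * \<sigma> * (real n * (real l + 1) ^ 2) * (A * (real l + 1) ^ n)"
      using sigma lam_le c_le c_nonneg lam_nonneg t by (intro mult_mono) auto
    moreover have "0 \<le> 2 * \<sigma> * lam l * c l t"
      using sigma c_nonneg lam_nonneg t by (intro mult_nonneg_nonneg) auto
    ultimately show ?thesis by simp
  qed
  also have "\<bar>d l t + 2 * \<sigma> * lam l * c l t\<bar> \<le> real n * (real l + 1) ^ 2 * (4 * (A * (2 ^ n * (real l + 1) ^ n)))"
  proof -
    have "real n * real l \<le> real n * (real l + 1) ^ 2"
      by (intro mult_left_mono) (auto simp: power2_eq_square algebra_simps)
    then have "real n * real l * (c (l - 1) t + 2 * c l t + c (Suc l) t)
        \<le> real n * (real l + 1) ^ 2 * (4 * (A * (2 ^ n * (real l + 1) ^ n)))"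
      using c_neighbours[of t l] c_nonneg[of t] t by (intro mult_mono[of "real n * real l"]) auto
    with d_bound[OF t, of l] show ?thesis by linarith
  qed
  finally show ?thesis
    unfolding dconst_def power_add by (simp only: distrib_left distrib_right mult_ac)
qed

text \<open>Weights decaying faster than the a priori polynomial growth of the modes allow
  termwise differentiation for positive times and passage to the limit at time zero.\<close>

definition good :: "(nat \<Rightarrow> real) \<Rightarrow> bool" where
  "good W \<longleftrightarrow> (\<forall>l. 0 \<le> W l) \<and> summable (\<lambda>l. W l * (real l + 1) ^ (n + 2))"

lemma good_nonneg: "good W \<Longrightarrow> 0 \<le> W l"
  by (simp add: good_def)

text \<open>In the exponent \<open>n + 2\<close> of \<open>good\<close>, n pays for the growth of
  the modes and 2 for that of \<open>lam\<close> and similar factors.\<close>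

lemma good_summable:
  assumes W: "good W" and t: "t \<ge> 0" and p: "\<And>l. \<bar>p l\<bar> \<le> K * (real l + 1) ^ 2"
  shows "summable (\<lambda>l. W l * (p l * c l t))"
proof (rule summable_comparison_test')
  show "summable (\<lambda>l. K * A * (W l * (real l + 1) ^ (n + 2)))"
    using W by (intro summable_mult) (simp add: good_def)
  fix l
  have "\<bar>p l\<bar> * c l t \<le> (K * (real l + 1) ^ 2) * (A * (real l + 1) ^ n)"
    using p[of l] c_le[OF t, of l] c_nonneg[OF t, of l] by (intro mult_mono) auto
  then have "W l * (\<bar>p l\<bar> * c l t) \<le> W l * ((K * (real l + 1) ^ 2) * (A * (real l + 1) ^ n))"
    using good_nonneg[OF W] by (intro mult_left_mono) auto
  then show "norm (W l * (p l * c l t)) \<le> K * A * (W l * (real l + 1) ^ (n + 2))"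
    using good_nonneg[OF W, of l] c_nonneg[OF t, of l] unfolding power_add by (simp add: abs_mult mult_ac)
qed

lemma good_summable_c: "good W \<Longrightarrow> t \<ge> 0 \<Longrightarrow> summable (\<lambda>l. W l * c l t)"
  using good_summable[of W t "\<lambda>l. 1" 1] by simp

lemma good_d_le:
  assumes W: "good W" and t: "t > 0"
  shows "norm (W l * d l t) \<le> dconst * (W l * (real l + 1) ^ (n + 2))"
proof -
  have "W l * \<bar>d l t\<bar> \<le> W l * (dconst * (real l + 1) ^ (n + 2))"
    using d_le[OF t] good_nonneg[OF W] by (intro mult_left_mono) auto
  then show ?thesis using good_nonneg[OF W, of l] by (simp add: abs_mult algebra_simps)
qed

lemma good_summable_d:
  assumes W: "good W" and t: "t > 0"
  shows "summable (\<lambda>l. W l * d l t)"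
  using W by (intro summable_comparison_test'[OF _ good_d_le[OF W t]] summable_mult)
    (simp add: good_def)

lemma good_derivative:
  assumes W: "good W" and t: "t > 0"
  shows "((\<lambda>t. \<Sum>l. W l * c l t) has_real_derivative (\<Sum>l. W l * d l t)) (at t)"
proof (rule has_field_derivative_series'(2)[where S="{0<..}" and x0=t])
  show "((\<lambda>t. W l * c l t) has_real_derivative W l * d l x) (at x within {0<..})" if "x \<in> {0<..}" for l x
    using that by (intro DERIV_cmult has_field_derivative_at_within[OF c_deriv]) auto
  show "uniformly_convergent_on {0<..} (\<lambda>k x. \<Sum>i<k. W i * d i x)"
    using W by (intro Weierstrass_m_test'_ev[where M="\<lambda>l. dconst * (W l * (real l + 1) ^ (n + 2))"] summable_mult)
      (auto simp: good_def intro!: always_eventually good_d_le[OF W, simplified])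
qed (use t good_summable_c[OF W, of t] in \<open>auto simp: interior_open\<close>)

text \<open>Tannery's theorem; the majorant is uniform in t because \<open>c_le\<close> is uniform
  down to time zero.\<close>

lemma good_limit_0:
  assumes W: "good W"
  shows "((\<lambda>t. \<Sum>l. W l * c l t) \<longlongrightarrow> (\<Sum>l. W l * c l 0)) (at_right 0)"
proof -
  have "\<forall>\<^sub>F (l, t) in sequentially \<times>\<^sub>F at_right 0. norm (W l * c l t) \<le> A * (W l * (real l + 1) ^ (n + 2))"
  proof -
    have "norm (W l * c l t) \<le> A * (W l * (real l + 1) ^ (n + 2))" if t: "t > 0" for l t
    proof -
      have "c l t \<le> A * (real l + 1) ^ n" using c_le t by simp
      also have "\<dots> \<le> A * (real l + 1) ^ (n + 2)"
        using A_nonneg by (intro mult_left_mono power_increasing) auto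
      finally have "W l * c l t \<le> W l * (A * (real l + 1) ^ (n + 2))"
        using good_nonneg[OF W] by (intro mult_left_mono) auto
      then show ?thesis
        using good_nonneg[OF W, of l] c_nonneg[of t l] t by (simp add: algebra_simps)
    qed
    then show ?thesis
      unfolding eventually_prod_filter
      by (intro exI[of _ "\<lambda>_. True"] exI[of _ "\<lambda>t. t > 0"])
        (auto simp: eventually_at_right_less)
  qed
  moreover have "((\<lambda>t. W l * c l t) \<longlongrightarrow> W l * c l 0) (at_right 0)" for l
    by (intro tendsto_intros c_lim)
  moreover have "summable (\<lambda>l. A * (W l * (real l + 1) ^ (n + 2)))"
    using W unfolding good_def by (intro summable_mult) blast
  ultimately show ?thesis
    using tannerys_theorem[of "\<lambda>l t. W l * c l t" "\<lambda>l. W l * c l 0" "at_right 0"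
        "\<lambda>l. A * (W l * (real l + 1) ^ (n + 2))"] by simp
qed

lemma good_damped:
  assumes r: "0 < r" "r < 1" and v: "\<And>l. 0 \<le> v l" "\<And>l. v l \<le> G * (real l + 1) ^ q"
  shows "good (\<lambda>l. r ^ l * v l)"
  unfolding good_def
proof (intro conjI allI)
  show "0 \<le> r ^ l * v l" for l using r v by simp
  show "summable (\<lambda>l. r ^ l * v l * (real l + 1) ^ (n + 2))"
  proof (rule summable_comparison_test')
    show "summable (\<lambda>l. G * (r ^ l * (real l + 1) ^ (q + (n + 2))))"
      using r by (intro summable_mult summable_poly_geometric) auto
    fix l
    have "r ^ l * v l * (real l + 1) ^ (n + 2) \<le> r ^ l * (G * (real l + 1) ^ q) * (real l + 1) ^ (n + 2)"
      using r v by (intro mult_right_mono mult_left_mono) auto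
    then show "norm (r ^ l * v l * (real l + 1) ^ (n + 2)) \<le> G * (r ^ l * (real l + 1) ^ (q + (n + 2)))"
      using r v by (simp add: abs_mult power_add algebra_simps)
  qed
qed

text \<open>The inverse eigenvalues of the conformal Laplacian: for these weights the coupling terms
  telescope.\<close>

definition w :: "nat \<Rightarrow> real" where
  "w l = 1 / pochhammer (real l) (n - 1)"

text \<open>The Pochhammer symbol vanishes at 0, so this rests on division by zero being 0; it drops
  degree 0 from every weighted sum.\<close>

lemma w_0 [simp]: "w 0 = 0"
  using n2 by (simp add: w_def pochhammer_0_left)

lemma pochhammer_ge_1: "l > 0 \<Longrightarrow> pochhammer (real l) k \<ge> 1"
proof (induction k)
  case (Suc k)
  have "1 * 1 \<le> pochhammer (real l) k * (real l + real k)"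
    using Suc by (intro mult_mono) auto
  then show ?case by (simp add: pochhammer_Suc)
qed simp

lemma w_pos: "l > 0 \<Longrightarrow> w l > 0"
  using pochhammer_ge_1[of l "n - 1"] by (simp add: w_def)

lemma w_nonneg: "w l \<ge> 0"
  using w_pos[of l] by (cases "l = 0") auto

lemma w_le_1: "w l \<le> 1"
  using pochhammer_ge_1[of l "n - 1"] by (cases "l = 0") (simp, auto simp: w_def)

text \<open>The product \<open>l (l + 1) ... (l + n - 1)\<close> is split once at its first and once
  at its last factor.\<close>

lemma w_rec: "l > 0 \<Longrightarrow> real l * w l = (real n + real l - 1) * w (Suc l)"
proof -
  assume l: "l > 0"
  have "real l * pochhammer (real (Suc l)) (n - 1) = (real l + real (n - 1)) * pochhammer (real l) (n - 1)"
    using pochhammer_rec[of "real l" "n - 1"] pochhammer_rec'[of "real l" "n - 1"] by (simp add: add.commute)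
  moreover have "real (n - 1) = real n - 1" using n2 by simp
  ultimately show ?thesis
    using pochhammer_ge_1[OF l, of "n - 1"] pochhammer_ge_1[of "Suc l" "n - 1"]
    by (simp add: w_def field_simps)
qed

text \<open>With the factor \<open>r ^ l\<close>, what degree l + 1 gains is r times what degree l
  loses, so the coupling sum survives with factor 1 - r. The last claim bounds this defect by the
  diffusion sum. At r = 1 this is the exact cancellation.\<close>

lemma w_telescope:
  assumes r: "r > 0" and t: "t > 0"
    and sm: "summable (\<lambda>l. r ^ l * w l * ((real l + 1) ^ 2 * c l t))"
  shows "summable (\<lambda>l. r ^ l * w l * (lam l * c l t))" (is "summable ?q")
    and "summable (\<lambda>l. r ^ l * w l * (real l * m l t))" (is "summable ?x")
    and "(\<lambda>l. r ^ l * w l * d l t) sums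
      (- 2 * \<sigma> * (\<Sum>l. r ^ l * w l * (lam l * c l t))
       - 2 * (1 - r) * (\<Sum>l. r ^ l * w l * (real l * m l t))
       + 2 * r * (w 1 * ((real n - 1) * m 0 t)))"
    and "\<bar>2 * (\<Sum>l. r ^ l * w l * (real l * m l t))\<bar> \<le> (1 + 1 / r) * (\<Sum>l. r ^ l * w l * (lam l * c l t))"
proof -
  have nn: "c l t \<ge> 0" for l using c_nonneg t by simp
  have q0: "?q l \<ge> 0" for l using r w_nonneg lam_nonneg nn by simp
  show sq: "summable ?q"
  proof (rule summable_comparison_test')
    show "summable (\<lambda>l. real n * (r ^ l * w l * ((real l + 1) ^ 2 * c l t)))"
      using sm by (rule summable_mult)
    fix l
    have "?q l \<le> r ^ l * w l * (real n * (real l + 1) ^ 2 * c l t)"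
      using r w_nonneg nn lam_le by (intro mult_left_mono mult_right_mono) auto
    then show "norm (?q l) \<le> real n * (r ^ l * w l * ((real l + 1) ^ 2 * c l t))"
      using q0[of l] by (simp add: algebra_simps)
  qed
  then have sq': "summable (\<lambda>l. ?q (Suc l))" by (subst summable_Suc_iff)
  \<comment> \<open>The half of the bound that involves mode l + 1 is moved to the weight of degree
    l + 1 by \<open>w_rec\<close>; there \<open>lam (Suc l)\<close> dominates
    \<open>n + l - 1\<close>.\<close>
  have xb: "\<bar>2 * ?x l\<bar> \<le> ?q l + (1 / r) * ?q (Suc l)" for l
  proof (cases "l = 0")
    case True
    then show ?thesis using w_nonneg lam_nonneg nn r by simp
  next
    case False
    have "\<bar>2 * ?x l\<bar> = r ^ l * w l * (real l * (2 * \<bar>m l t\<bar>))"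
      using r w_nonneg[of l] by (simp add: abs_mult)
    also have "\<dots> \<le> r ^ l * w l * (real l * (c l t + c (Suc l) t))"
      using r w_nonneg[of l] m_le[OF t] by (intro mult_left_mono) auto
    also have "\<dots> = r ^ l * w l * (real l * c l t) + r ^ l * (real l * w l) * c (Suc l) t"
      by (simp add: algebra_simps)
    also have "\<dots> = r ^ l * w l * (real l * c l t) + r ^ l * w (Suc l) * ((real n + real l - 1) * c (Suc l) t)"
      using False by (simp add: w_rec)
    also have "\<dots> \<le> ?q l + r ^ l * w (Suc l) * (lam (Suc l) * c (Suc l) t)"
    proof -
      have "1 * (real n + real l - 1) \<le> real (Suc l) * (real (Suc l) + real n - 2)"
        using n2 by (intro mult_mono) auto
      then have "real n + real l - 1 \<le> lam (Suc l)" by (simp add: lam_def)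
      then show ?thesis
        using r w_nonneg nn lam_ge_l[of l]
        by (intro add_mono mult_left_mono mult_right_mono) auto
    qed
    also have "r ^ l * w (Suc l) * (lam (Suc l) * c (Suc l) t) = (1 / r) * ?q (Suc l)"
      using r by simp
    finally show ?thesis .
  qed
  have sb: "summable (\<lambda>l. ?q l + (1 / r) * ?q (Suc l))"
    by (intro summable_add summable_mult sq sq')
  have sx2: "summable (\<lambda>l. \<bar>2 * ?x l\<bar>)"
    by (rule summable_comparison_test'[OF sb]) (use xb in auto)
  then have "summable (\<lambda>l. 2 * ?x l)" by (rule summable_rabs_cancel)
  then show sx: "summable ?x" using summable_mult[of "\<lambda>l. 2 * ?x l" "1/2"] by simp
  have "\<bar>2 * suminf ?x\<bar> = \<bar>\<Sum>l. 2 * ?x l\<bar>" using suminf_mult[OF sx, of 2] by simp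
  also have "\<dots> \<le> (\<Sum>l. \<bar>2 * ?x l\<bar>)" using sx2 by (rule summable_rabs)
  also have "\<dots> \<le> (\<Sum>l. ?q l + (1 / r) * ?q (Suc l))"
    using xb sx2 sb by (intro suminf_le) auto
  also have "\<dots> = suminf ?q + (1 / r) * (\<Sum>l. ?q (Suc l))"
    using sq summable_mult[OF sq', of "1 / r"] suminf_mult[OF sq', of "1 / r"] by (simp add: suminf_add[symmetric])
  also have "(\<Sum>l. ?q (Suc l)) = suminf ?q" using suminf_split_head[OF sq] by simp
  finally show "\<bar>2 * suminf ?x\<bar> \<le> (1 + 1 / r) * suminf ?q" by (simp add: algebra_simps)
  \<comment> \<open>The gain terms. Shifted by one index they are r times the loss terms, except for
    a boundary term from the coupling of degree 0.\<close>
  define y where "y = (\<lambda>l. r ^ l * w l * ((real n + real l - 2) * m (l - 1) t))"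
  let ?y0 = "r * (w 1 * ((real n - 1) * m 0 t))"
  have yS: "y (Suc l) = r * ?x l + (if l = 0 then ?y0 else 0)" for l
  proof (cases "l = 0")
    case False
    have "y (Suc l) = r * (r ^ l * ((real n + real l - 1) * w (Suc l)) * m l t)"
      by (simp add: y_def algebra_simps)
    with False show ?thesis by (simp add: w_rec[symmetric])
  qed (simp add: y_def)
  have "(\<lambda>l. r * ?x l + (if l = 0 then ?y0 else 0)) sums (r * suminf ?x + ?y0)"
    by (intro sums_add sums_mult summable_sums sx) (use sums_single[of 0 "\<lambda>_. ?y0"] in simp)
  then have "(\<lambda>l. y (Suc l)) sums (r * suminf ?x + ?y0)" unfolding yS .
  then have ys: "y sums (r * suminf ?x + ?y0)"
    by (subst (asm) sums_Suc_iff) (simp add: y_def)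
  have "(\<lambda>l. - 2 * \<sigma> * ?q l - 2 * ?x l + 2 * y l) sums
      (- 2 * \<sigma> * suminf ?q - 2 * suminf ?x + 2 * (r * suminf ?x + ?y0))"
    by (intro sums_add sums_diff sums_mult summable_sums sq sx ys)
  moreover have "- 2 * \<sigma> * ?q l - 2 * ?x l + 2 * y l = r ^ l * w l * d l t" for l
    by (cases "l = 0") (auto simp: d_def y_def algebra_simps)
  ultimately show "(\<lambda>l. r ^ l * w l * d l t) sums
      (- 2 * \<sigma> * suminf ?q - 2 * (1 - r) * suminf ?x + 2 * r * (w 1 * ((real n - 1) * m 0 t)))"
    by (simp add: algebra_simps)
qed

text \<open>Each power of l is gained on an interval starting at half the given time. The diffusion
  rate is at least of order \<open>l\<^sup>2\<close> and the source is l times a quantity controlled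
  by the induction hypothesis, so their quotient gains 1 / l; the exponential at the start gains at
  least as much.\<close>

lemma smoothing: "a > 0 \<Longrightarrow> \<exists>B\<ge>0. \<forall>t\<ge>a. \<forall>l. (real l + 1) ^ k * c l t \<le> B * (real l + 1) ^ n"
proof (induction k arbitrary: a)
  case 0
  then show ?case using c_le A_nonneg by (intro exI[of _ A]) auto
next
  case (Suc k)
  from Suc.prems have a: "a > 0" .
  obtain B where B: "B \<ge> 0" and "\<forall>t\<ge>a/2. \<forall>l. (real l + 1) ^ k * c l t \<le> B * (real l + 1) ^ n"
    using Suc.IH[of "a/2"] a by auto
  then have cB: "(real l + 1) ^ k * c l t \<le> B * (real l + 1) ^ n" if "t \<ge> a/2" for l t
    using that by blast
  \<comment> \<open>Losses from the neighbours: \<open>2 ^ k\<close> for degree l - 1 since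
    \<open>l + 1 \<le> 2 l\<close>, 2 for degree l, and \<open>2 ^ n\<close> for degree l +
    1.\<close>
  define K where "K = 2 ^ k + 2 + (2::real) ^ n"
  have K: "K \<ge> 0" by (simp add: K_def)
  \<comment> \<open>The first summand bounds the initial term through \<open>exp z \<ge> z\<close>,
    the second is the quotient of source and rate.\<close>
  define M where "M = 1 / (\<sigma> * a) + real n * K / (2 * \<sigma>)"
  have M: "M \<ge> 0" using sigma a K by (simp add: M_def)
  have "(real l + 1) ^ Suc k * c l t \<le> 2 * M * B * (real l + 1) ^ n" if t: "t \<ge> a" for l t
  proof (cases "l = 0")
    case True
    then show ?thesis using c0[of t] t a M B by simp
  next
    case False
    then have l: "real l \<ge> 1" by simp
    let ?L = "real l + 1"
    define \<alpha> where "\<alpha> = 2 * \<sigma> * lam l"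
    define \<beta> where "\<beta> = real n * real l * (K * B * ?L ^ n)"
    have lam1: "lam l \<ge> real l * real l" by (rule lam_ge_sq)
    have ll: "real l * real l \<ge> real l" using l by simp
    have lamp: "lam l > 0" using lam1 ll l by linarith
    have \<alpha>: "\<alpha> > 0" using sigma lamp by (simp add: \<alpha>_def)
    have \<beta>: "\<beta> \<ge> 0" using K B by (simp add: \<beta>_def)
    have nb: "?L ^ k * (c (l - 1) x + 2 * c l x + c (Suc l) x) \<le> K * B * ?L ^ n" if x: "x \<ge> a/2" for x
    proof -
      have x0: "x \<ge> 0" using x a by simp
      have 1: "?L ^ k * c l x \<le> B * ?L ^ n" using cB[OF x] .
      have "?L ^ k * c (l - 1) x \<le> (2 * real l) ^ k * c (l - 1) x"
        using l c_nonneg[OF x0] by (intro mult_right_mono power_mono) auto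
      also have "\<dots> = 2 ^ k * ((real (l - 1) + 1) ^ k * c (l - 1) x)"
        using False by (simp add: power_mult_distrib of_nat_diff)
      also have "\<dots> \<le> 2 ^ k * (B * (real (l - 1) + 1) ^ n)"
        using cB[OF x] by (intro mult_left_mono) auto
      also have "\<dots> \<le> 2 ^ k * (B * ?L ^ n)"
        using B False by (intro mult_left_mono power_mono) auto
      finally have 2: "?L ^ k * c (l - 1) x \<le> 2 ^ k * (B * ?L ^ n)" .
      have "?L ^ k * c (Suc l) x \<le> (real (Suc l) + 1) ^ k * c (Suc l) x"
        using c_nonneg[OF x0] by (intro mult_right_mono power_mono) auto
      also have "\<dots> \<le> B * (real (Suc l) + 1) ^ n" using cB[OF x] .
      also have "\<dots> \<le> B * (2 * ?L) ^ n" using B by (intro mult_left_mono power_mono) auto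
      finally have 3: "?L ^ k * c (Suc l) x \<le> 2 ^ n * (B * ?L ^ n)"
        unfolding power_mult_distrib by (simp add: mult_ac)
      have "?L ^ k * (c (l - 1) x + 2 * c l x + c (Suc l) x)
          = ?L ^ k * c (l - 1) x + 2 * (?L ^ k * c l x) + ?L ^ k * c (Suc l) x"
        by (simp only: distrib_left mult.left_commute)
      also have "\<dots> \<le> 2 ^ k * (B * ?L ^ n) + 2 * (B * ?L ^ n) + 2 ^ n * (B * ?L ^ n)"
        using 1 2 3 by linarith
      also have "\<dots> = K * B * ?L ^ n" unfolding K_def by (simp only: distrib_right mult.assoc)
      finally show ?thesis .
    qed
    have "?L ^ k * c l t \<le> exp (- \<alpha> * (t - a/2)) * (?L ^ k * c l (a/2)) + \<beta> / \<alpha>"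
    proof (rule gronwall_decay[OF \<alpha> \<beta>])
      show "a/2 \<le> t" using t a by simp
      fix x assume x: "a/2 \<le> x" "x \<le> t"
      then have x0: "x > 0" using a by simp
      show "((\<lambda>x. ?L ^ k * c l x) has_real_derivative ?L ^ k * d l x) (at x)"
        by (intro DERIV_cmult c_deriv[OF x0])
      have "d l x \<le> - \<alpha> * c l x + real n * real l * (c (l - 1) x + 2 * c l x + c (Suc l) x)"
        using d_bound[OF x0, of l] by (simp add: \<alpha>_def)
      then have "?L ^ k * d l x \<le> ?L ^ k * (- \<alpha> * c l x + real n * real l * (c (l - 1) x + 2 * c l x + c (Suc l) x))"
        by (intro mult_left_mono) auto
      also have "\<dots> = - \<alpha> * (?L ^ k * c l x) + real n * real l * (?L ^ k * (c (l - 1) x + 2 * c l x + c (Suc l) x))"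
        by (simp only: distrib_left mult_ac)
      also have "\<dots> \<le> - \<alpha> * (?L ^ k * c l x) + \<beta>"
        unfolding \<beta>_def using nb[OF x(1)] by (intro add_left_mono mult_left_mono) auto
      finally show "?L ^ k * d l x \<le> - \<alpha> * (?L ^ k * c l x) + \<beta>" .
    qed
    also have "\<dots> \<le> 1 / (\<sigma> * a * real l) * (B * ?L ^ n) + real n * K / (2 * \<sigma> * real l) * (B * ?L ^ n)"
    proof (rule add_mono)
      have "\<sigma> * a * real l \<le> \<alpha> * (t - a/2)"
      proof -
        have "\<sigma> * a * real l \<le> \<sigma> * a * lam l"
          using sigma a lam1 ll by (intro mult_left_mono) auto
        also have "\<dots> = \<alpha> * (a - a/2)" by (simp add: \<alpha>_def)
        also have "\<dots> \<le> \<alpha> * (t - a/2)" using t \<alpha> by (intro mult_left_mono) auto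
        finally show ?thesis .
      qed
      also have "\<dots> \<le> exp (\<alpha> * (t - a/2))" using exp_ge_add_one_self[of "\<alpha> * (t - a/2)"] by linarith
      finally have le: "\<sigma> * a * real l \<le> exp (\<alpha> * (t - a/2))" .
      have pos: "\<sigma> * a * real l > 0" using sigma a l by simp
      have e: "exp (- \<alpha> * (t - a/2)) \<le> 1 / (\<sigma> * a * real l)"
        using divide_left_mono[OF le, of 1] pos by (simp add: exp_minus inverse_eq_divide)
      show "exp (- \<alpha> * (t - a/2)) * (?L ^ k * c l (a/2)) \<le> 1 / (\<sigma> * a * real l) * (B * ?L ^ n)"
        using pos a c_nonneg[of "a/2" l] by (intro mult_mono[OF e cB[OF order_refl]]) auto
      have "\<beta> / \<alpha> \<le> \<beta> / (2 * \<sigma> * (real l * real l))"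
        unfolding \<alpha>_def using \<beta> sigma lam1 l lamp
        by (intro divide_left_mono mult_left_mono mult_pos_pos) auto
      also have "\<dots> = real n * K / (2 * \<sigma> * real l) * (B * ?L ^ n)"
        using l sigma by (simp add: \<beta>_def)
      finally show "\<beta> / \<alpha> \<le> real n * K / (2 * \<sigma> * real l) * (B * ?L ^ n)" .
    qed
    also have "\<dots> = M * B * ?L ^ n / real l"
      unfolding M_def using l sigma a by (simp add: divide_simps) (simp add: algebra_simps)
    finally have u: "?L ^ k * c l t \<le> M * B * ?L ^ n / real l" .
    have "?L ^ Suc k * c l t = ?L * (?L ^ k * c l t)" by simp
    also have "\<dots> \<le> ?L * (M * B * ?L ^ n / real l)" using u by (intro mult_left_mono) auto
    also have "\<dots> \<le> (2 * real l) * (M * B * ?L ^ n / real l)"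
      using l M B by (intro mult_right_mono) auto
    also have "\<dots> = 2 * M * B * ?L ^ n" using l by simp
    finally show ?thesis .
  qed
  then show ?case using M B by (intro exI[of _ "2 * M * B"]) auto
qed

text \<open>Two powers compensate \<open>lam\<close> and the derivatives, the other two leave a
  convergent series.\<close>

lemma quartic_decay: "a > 0 \<Longrightarrow> \<exists>B\<ge>0. \<forall>t\<ge>a. \<forall>l. c l t \<le> B / (real l + 1) ^ 4"
proof -
  assume "a > 0"
  then obtain B where B: "B \<ge> 0" "\<And>t l. t \<ge> a \<Longrightarrow> (real l + 1) ^ (n + 4) * c l t \<le> B * (real l + 1) ^ n"
    using smoothing[of a "n + 4"] by blast
  have "c l t \<le> B / (real l + 1) ^ 4" if t: "t \<ge> a" for l t
  proof -
    have "(real l + 1) ^ n * (c l t * (real l + 1) ^ 4) \<le> (real l + 1) ^ n * B"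
      using B(2)[OF t, of l] unfolding power_add by (simp only: mult_ac)
    then have "c l t * (real l + 1) ^ 4 \<le> B"
      by (rule mult_left_le_imp_le) simp
    then show ?thesis by (simp add: pos_le_divide_eq)
  qed
  with B(1) show ?thesis by blast
qed

section \<open>Entropy series at positive times\<close>

lemma summable_inverse_square: "summable (\<lambda>l. K / (real l + 1) ^ 2)"
proof -
  have "summable (\<lambda>l. inverse (real (Suc l) ^ 2))"
    using inverse_power_summable[of 2, where 'a=real] by (subst summable_Suc_iff) simp
  from summable_mult[OF this, of K] show ?thesis
    by (simp add: divide_inverse add.commute)
qed

lemma w_summable:
  assumes t: "t > 0"
  shows "summable (\<lambda>l. w l * ((real l + 1) ^ 2 * c l t))"
proof -
  obtain B where B: "B \<ge> 0" "\<And>l. c l t \<le> B / (real l + 1) ^ 4"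
    using quartic_decay[OF t] by blast
  show ?thesis
  proof (rule summable_comparison_test'[OF summable_inverse_square[of B]])
    fix l
    have "w l * ((real l + 1) ^ 2 * c l t) \<le> 1 * ((real l + 1) ^ 2 * (B / (real l + 1) ^ 4))"
      using w_le_1 w_nonneg c_nonneg[of t l] t B by (intro mult_mono) auto
    also have "\<dots> = B / (real l + 1) ^ 2"
      by (simp add: field_simps flip: power_add)
    finally show "norm (w l * ((real l + 1) ^ 2 * c l t)) \<le> B / (real l + 1) ^ 2"
      using w_nonneg[of l] c_nonneg[of t l] t by simp
  qed
qed

lemma w_summable_c:
  assumes t: "t > 0"
  shows "summable (\<lambda>l. w l * c l t)"
proof (rule summable_comparison_test'[OF w_summable[OF t]])
  fix l
  have "1 * c l t \<le> (real l + 1) ^ 2 * c l t"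
    using c_nonneg[of t l] t by (intro mult_right_mono one_le_power) auto
  then have "w l * c l t \<le> w l * ((real l + 1) ^ 2 * c l t)"
    using w_nonneg by (intro mult_left_mono) auto
  then show "norm (w l * c l t) \<le> w l * ((real l + 1) ^ 2 * c l t)"
    using w_nonneg[of l] c_nonneg[of t l] t by simp
qed

text \<open>Smoothing from time t / 2 gives a summable majorant for the differentiated series near
  t; its sum is then \<open>w_telescope\<close> with r = 1.\<close>

lemma entropy_derivative:
  assumes t: "t > 0"
  shows "((\<lambda>t. \<Sum>l. w l * c l t) has_real_derivative
    - 2 * \<sigma> * (\<Sum>l. w l * (lam l * c l t)) + 2 * (w 1 * ((real n - 1) * (c 1 t / real n)))) (at t)"
proof -
  obtain B where B: "B \<ge> 0" and cB: "\<And>x l. x \<ge> t/2 \<Longrightarrow> c l x \<le> B / (real l + 1) ^ 4"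
    using quartic_decay[of "t/2"] t by auto
  \<comment> \<open>19 = 16 + 2 + 1 counts the three neighbouring modes; 16 arises from
    \<open>l \<ge> (l + 1) / 2\<close> to the fourth power for degree l - 1.\<close>
  define K where "K = 2 * \<sigma> * real n * B + real n * (19 * B)"
  have dB: "norm (w l * d l x) \<le> K / (real l + 1) ^ 2" if x: "x > t/2" for l x
  proof (cases "l = 0")
    case True
    then show ?thesis using B sigma by (simp add: K_def)
  next
    case False
    let ?L = "real l + 1"
    have x0: "x > 0" using x t by simp
    have nn: "c j x \<ge> 0" for j using c_nonneg x0 by simp
    have 1: "c l x \<le> B / ?L ^ 4" using cB x by simp
    have 3: "c (Suc l) x \<le> B / ?L ^ 4"
    proof -
      have "c (Suc l) x \<le> B / (real (Suc l) + 1) ^ 4" by (rule cB) (use x in simp)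
      also have "\<dots> \<le> B / ?L ^ 4" using B by (intro divide_left_mono power_mono) auto
      finally show ?thesis .
    qed
    have 2: "c (l - 1) x \<le> 16 * B / ?L ^ 4"
    proof -
      have "c (l - 1) x \<le> B / (real (l - 1) + 1) ^ 4" using cB x by simp
      also have "\<dots> \<le> B / (?L / 2) ^ 4"
        using B False by (intro divide_left_mono power_mono) (auto simp: of_nat_diff)
      finally show ?thesis by (simp add: power_divide mult.commute)
    qed
    have "\<bar>d l x\<bar> \<le> 2 * \<sigma> * lam l * c l x + real n * real l * (c (l - 1) x + 2 * c l x + c (Suc l) x)"
    proof -
      have "0 \<le> 2 * \<sigma> * lam l * c l x" using sigma lam_nonneg nn by simp
      then show ?thesis using d_bound[OF x0, of l] by linarith
    qed
    also have "\<dots> \<le> 2 * \<sigma> * (real n * ?L ^ 2) * (B / ?L ^ 4) + real n * ?L ^ 2 * (19 * B / ?L ^ 4)"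
    proof -
      have "2 * \<sigma> * lam l * c l x \<le> 2 * \<sigma> * (real n * ?L ^ 2) * (B / ?L ^ 4)"
        using sigma lam_le lam_nonneg nn 1 by (intro mult_mono) auto
      moreover have "real n * real l * (c (l - 1) x + 2 * c l x + c (Suc l) x) \<le> real n * ?L ^ 2 * (19 * B / ?L ^ 4)"
      proof (rule mult_mono)
        have "real l \<le> ?L ^ 2" by (simp add: power2_eq_square algebra_simps)
        then show "real n * real l \<le> real n * ?L ^ 2" by (intro mult_left_mono) auto
        have "16 * B / ?L ^ 4 + 2 * (B / ?L ^ 4) + B / ?L ^ 4 = 19 * B / ?L ^ 4"
          by (simp add: field_simps)
        then show "c (l - 1) x + 2 * c l x + c (Suc l) x \<le> 19 * B / ?L ^ 4" using 1 2 3 by linarith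
      qed (use nn in auto)
      ultimately show ?thesis by linarith
    qed
    also have "\<dots> = K * (?L ^ 2 / ?L ^ 4)" by (simp add: K_def algebra_simps add_divide_distrib)
    also have "?L ^ 2 / ?L ^ 4 = 1 / ?L ^ 2" by (simp add: field_simps flip: power_add)
    finally have "\<bar>d l x\<bar> \<le> K / ?L ^ 2" by simp
    moreover have "w l * \<bar>d l x\<bar> \<le> 1 * \<bar>d l x\<bar>" using w_le_1 by (intro mult_right_mono) auto
    ultimately show ?thesis using w_nonneg[of l] by (simp add: abs_mult)
  qed
  have "((\<lambda>t. \<Sum>l. w l * c l t) has_real_derivative (\<Sum>l. w l * d l t)) (at t)"
  proof (rule has_field_derivative_series'(2)[where S="{t/2<..}" and x0=t])
    show "((\<lambda>t. w l * c l t) has_real_derivative w l * d l x) (at x within {t/2<..})" if "x \<in> {t/2<..}" for l x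
      using that t by (intro DERIV_cmult has_field_derivative_at_within[OF c_deriv]) auto
    show "uniformly_convergent_on {t/2<..} (\<lambda>k x. \<Sum>i<k. w i * d i x)"
      by (rule Weierstrass_m_test'[OF _ summable_inverse_square[of K]]) (use dB in auto)
  qed (use t w_summable_c[OF t] in \<open>auto simp: interior_open\<close>)
  moreover have "(\<Sum>l. w l * d l t) = - 2 * \<sigma> * (\<Sum>l. w l * (lam l * c l t))
      + 2 * (w 1 * ((real n - 1) * (c 1 t / real n)))"
    using w_telescope(3)[of 1 t] w_summable[OF t] t by (simp add: m0 sums_iff)
  ultimately show ?thesis by simp
qed

text \<open>The surviving coupling term is 2 / n times the left-hand side, hence at most 2 / n times
  the diffusion sum. This is the source of the threshold 1 / n.\<close>

lemma first_mode_le: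
  assumes "r > 0" "t > 0" "summable (\<lambda>l. r ^ l * w l * (lam l * c l t))"
  shows "r * (w 1 * ((real n - 1) * c 1 t)) \<le> (\<Sum>l. r ^ l * w l * (lam l * c l t))"
proof -
  have "(\<Sum>l\<in>{1}. r ^ l * w l * (lam l * c l t)) \<le> (\<Sum>l. r ^ l * w l * (lam l * c l t))"
    using assms w_nonneg lam_nonneg c_nonneg by (intro sum_le_suminf) auto
  then show ?thesis by (simp add: lam_def mult_ac)
qed

lemma dissipation_nonneg:
  assumes t: "t > 0" and \<sigma>: "\<sigma> \<ge> 1 / real n"
  shows "- 2 * \<sigma> * (\<Sum>l. w l * (lam l * c l t)) + 2 * (w 1 * ((real n - 1) * (c 1 t / real n))) \<le> 0"
proof -
  let ?Q = "\<Sum>l. w l * (lam l * c l t)"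
  have sq: "summable (\<lambda>l. w l * (lam l * c l t))"
    using w_telescope(1)[of 1 t] w_summable[OF t] t by simp
  have q0: "?Q \<ge> 0"
    using w_nonneg lam_nonneg c_nonneg t by (intro suminf_nonneg sq) auto
  have "(1 / real n) * (w 1 * ((real n - 1) * c 1 t)) \<le> (1 / real n) * ?Q"
    using first_mode_le[of 1 t] sq t by (intro mult_left_mono) auto
  also have "\<dots> \<le> \<sigma> * ?Q" using \<sigma> q0 by (rule mult_right_mono)
  finally show ?thesis by simp
qed

text \<open>At time zero only the entropy itself is known to be finite, so the differential
  inequality is run for the damped series and the damping is removed from partial sums.\<close>

lemma entropy_decay:
  assumes \<sigma>: "\<sigma> > 1 / real n" and H0: "summable (\<lambda>l. w l * c l 0)" and t: "t \<ge> 0"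
  shows "(\<Sum>l<N. w l * c l t) \<le> exp (- 2 * (real n - 1) * (\<sigma> - 1 / real n) * t) * (\<Sum>l. w l * c l 0)"
proof (cases "t = 0")
  case True
  then show ?thesis
    using H0 w_nonneg c_nonneg by (auto intro!: sum_le_suminf)
next
  case False
  then have t: "t > 0" using t by simp
  \<comment> \<open>The bound 1/2 ensures \<open>1 + 1 / r \<le> 3\<close>, which is the 3 in
    \<open>\<rho>\<close>; the other bound is equivalent to \<open>\<rho> r > 0\<close>.\<close>
  define r0 where "r0 = max (1/2) (1 - 2/3 * (\<sigma> - 1 / real n))"
  define \<rho> where "\<rho> = (\<lambda>r. \<sigma> - 3 * (1 - r) / 2 - 1 / real n)"
  let ?H0 = "\<Sum>l. w l * c l 0"
  show ?thesis
  proof (rule sum_le_of_damped_le)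
    show "r0 < 1" using \<sigma> by (simp add: r0_def)
    have "((\<lambda>r. exp (- 2 * (real n - 1) * \<rho> r * t) * ?H0) \<longlongrightarrow> exp (- 2 * (real n - 1) * \<rho> 1 * t) * ?H0) (at_left 1)"
      unfolding \<rho>_def by (intro tendsto_intros) auto
    then show "((\<lambda>r. exp (- 2 * (real n - 1) * \<rho> r * t) * ?H0) \<longlongrightarrow>
        exp (- 2 * (real n - 1) * (\<sigma> - 1 / real n) * t) * ?H0) (at_left 1)"
      by (simp add: \<rho>_def)
  next
    fix r assume r: "r0 < r" "r < 1"
    then have r12: "r > 1/2" and "1 - 2/3 * (\<sigma> - 1 / real n) < r" by (auto simp: r0_def)
    then have \<rho>: "\<rho> r > 0" unfolding \<rho>_def by argo
    have r0': "r > 0" using r12 by simp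
    have good: "good (\<lambda>l. r ^ l * w l)"
      using r0' r w_nonneg w_le_1 by (intro good_damped[where G=1 and q=0]) auto
    let ?S = "\<lambda>t. \<Sum>l. r ^ l * w l * c l t"
    let ?D = "\<lambda>t. \<Sum>l. r ^ l * w l * d l t"
    have le: "?D x \<le> - (2 * (real n - 1) * \<rho> r) * ?S x + 0" if x: "x > 0" for x
    proof -
      let ?Q = "\<Sum>l. r ^ l * w l * (lam l * c l x)"
      let ?X = "\<Sum>l. r ^ l * w l * (real l * m l x)"
      let ?c1 = "r * (w 1 * ((real n - 1) * c 1 x))"
      have sm: "summable (\<lambda>l. r ^ l * w l * ((real l + 1) ^ 2 * c l x))"
        using good_summable[OF good, of x "\<lambda>l. (real l + 1) ^ 2" 1] x by simp
      note tel = w_telescope[OF r0' x sm]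
      have Q0: "?Q \<ge> 0"
        using w_nonneg lam_nonneg c_nonneg x r0' by (intro suminf_nonneg tel(1)) auto
      have "\<bar>2 * ?X\<bar> \<le> 3 * ?Q"
      proof -
        have "1 + 1 / r \<le> 3" using r12 by (simp add: field_simps)
        then have "(1 + 1 / r) * ?Q \<le> 3 * ?Q" using Q0 by (rule mult_right_mono)
        with tel(4) show ?thesis by linarith
      qed
      then have "(1 - r) * (- (2 * ?X)) \<le> (1 - r) * (3 * ?Q)"
        using r by (intro mult_left_mono) auto
      then have X: "- 2 * (1 - r) * ?X \<le> 3 * (1 - r) * ?Q" by (simp add: algebra_simps)
      have "?D x = - 2 * \<sigma> * ?Q - 2 * (1 - r) * ?X + 2 * r * (w 1 * ((real n - 1) * m 0 x))"
        using tel(3) by (simp add: sums_iff)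
      also have "2 * r * (w 1 * ((real n - 1) * m 0 x)) = 2 / real n * ?c1"
        using x by (simp add: m0)
      finally have "?D x \<le> - 2 * \<sigma> * ?Q + 3 * (1 - r) * ?Q + 2 / real n * ?c1"
        using X by linarith
      also have "\<dots> \<le> - 2 * \<sigma> * ?Q + 3 * (1 - r) * ?Q + 2 / real n * ?Q"
        using first_mode_le[OF r0' x tel(1)] by (intro add_left_mono mult_left_mono) auto
      also have "\<dots> = - (2 * \<sigma> - 3 * (1 - r) - 2 / real n) * ?Q" by (simp add: algebra_simps)
      also have "\<dots> = - (2 * \<rho> r) * ?Q"
        by (rule arg_cong[where f="\<lambda>z. - z * ?Q"]) (unfold \<rho>_def, argo)
      \<comment> \<open>The spectral gap: \<open>lam l \<ge> n - 1\<close> for every positive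
        degree, and degree 0 has weight zero.\<close>
      also have "\<dots> \<le> - (2 * \<rho> r) * ((real n - 1) * ?S x)"
      proof -
        have "(real n - 1) * ?S x = (\<Sum>l. (real n - 1) * (r ^ l * w l * c l x))"
          using good_summable_c[OF good, of x] x by (simp add: suminf_mult)
        also have "\<dots> \<le> ?Q"
        proof (rule suminf_le)
          fix l
          show "(real n - 1) * (r ^ l * w l * c l x) \<le> r ^ l * w l * (lam l * c l x)"
          proof (cases "l = 0")
            case False
            then have "(real n - 1) * (r ^ l * w l * c l x) \<le> lam l * (r ^ l * w l * c l x)"
              using lam_ge[of l] r0' w_nonneg c_nonneg x by (intro mult_right_mono) auto
            then show ?thesis by (simp add: mult_ac)
          qed simp
        qed (use good_summable_c[OF good, of x] x tel(1) in \<open>auto intro: summable_mult\<close>)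
        finally show ?thesis using \<rho> by simp
      qed
      also have "\<dots> = - (2 * (real n - 1) * \<rho> r) * ?S x + 0" by (simp add: algebra_simps)
      finally show ?thesis .
    qed
    have "(\<Sum>l<N. r ^ l * (w l * c l t)) \<le> ?S t"
      using good_summable_c[OF good, of t] t r0' w_nonneg c_nonneg
      by (subst mult.assoc[symmetric]) (intro sum_le_suminf; simp)
    also have "?S t \<le> exp (- (2 * (real n - 1) * \<rho> r) * t) * ?S 0 + 0 / (2 * (real n - 1) * \<rho> r)"
      using n2 \<rho> by (intro gronwall_decay_0[OF _ _ t good_derivative[OF good] le good_limit_0[OF good]]) auto
    also have "\<dots> \<le> exp (- 2 * (real n - 1) * \<rho> r * t) * ?H0"
    proof -
      have "?S 0 \<le> ?H0"
      proof (rule suminf_le)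
        fix l
        have "r ^ l * (w l * c l 0) \<le> 1 * (w l * c l 0)"
          using r r0' w_nonneg c_nonneg by (intro mult_right_mono power_le_one) auto
        then show "r ^ l * w l * c l 0 \<le> w l * c l 0" by (simp add: mult.assoc)
      qed (use H0 good_summable_c[OF good, of 0] in auto)
      moreover have "- (2 * (real n - 1) * \<rho> r) * t = - 2 * (real n - 1) * \<rho> r * t"
        by (simp add: algebra_simps)
      ultimately show ?thesis by (simp only:) simp
    qed
    finally show "(\<Sum>l<N. r ^ l * (w l * c l t)) \<le> exp (- 2 * (real n - 1) * \<rho> r * t) * ?H0" .
  qed
qed

text \<open>The weight v may vary by a factor \<kappa> between neighbours, so the coupling is
  bounded by v-weighted terms linear in l. \<open>low\<close> says that diffusion dominates them
  beyond M, while below M the excess is charged to the entropy. The summand 1 in \<open>low\<close>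
  buys the damping rate \<open>\<rho> + 1\<close>; against a source decaying at rate \<rho> this
  avoids a factor growing in t.\<close>

lemma energy_decay:
  assumes \<sigma>: "\<sigma> > 1 / real n" and t: "t \<ge> 0"
    and v: "\<And>l. 0 \<le> v l" "\<And>l. v l \<le> G * (real l + 1) ^ q" "v 0 = 0"
    and comp: "\<And>l. l > 0 \<Longrightarrow> v (Suc l) \<le> \<kappa> * v l" "\<And>l. l > 0 \<Longrightarrow> v l \<le> \<kappa> * v (Suc l)"
    and \<kappa>: "\<kappa> \<ge> 0" and \<kappa>2: "\<kappa>2 \<ge> 0" and wv: "\<And>l. w l \<le> \<kappa>2 * v l" and K: "K \<ge> 0"
    and low: "\<And>l. l > 0 \<Longrightarrow> v l * (real n * (4 * \<kappa> + 2) * real l - 2 / real n * (real l * real l) + 1)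
        \<le> (if l < M then K * w l else 0)"
    and E0: "summable (\<lambda>l. v l * c l 0)"
  shows "(\<Sum>l<N. v l * c l t) \<le> (1 + K * \<kappa>2) * (\<Sum>l. v l * c l 0)
      * exp (- 2 * (real n - 1) * (\<sigma> - 1 / real n) * t)"
proof (cases "t = 0")
  case True
  have "(\<Sum>l<N. v l * c l 0) \<le> (\<Sum>l. v l * c l 0)"
    using E0 v c_nonneg by (intro sum_le_suminf) auto
  also have "\<dots> \<le> (1 + K * \<kappa>2) * (\<Sum>l. v l * c l 0)"
    using K \<kappa>2 v c_nonneg by (simp add: distrib_right) (intro mult_nonneg_nonneg suminf_nonneg E0; simp)
  finally show ?thesis using True by simp
next
  case False
  then have t: "t > 0" using t by simp
  define \<rho> where "\<rho> = 2 * (real n - 1) * (\<sigma> - 1 / real n)"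
  have \<rho>_eq: "\<rho> = (2 * (\<sigma> - 1 / real n)) * (real n - 1)" unfolding \<rho>_def by (simp only: mult_ac)
  have \<rho>_exp: "- 2 * (real n - 1) * (\<sigma> - 1 / real n) * x = - \<rho> * x" for x
    by (simp add: \<rho>_def algebra_simps)
  let ?E0 = "\<Sum>l. v l * c l 0" and ?H0 = "\<Sum>l. w l * c l 0"
  have wc: "w l * c l 0 \<le> \<kappa>2 * (v l * c l 0)" for l
    using mult_right_mono[OF wv c_nonneg[of 0 l]] by (simp add: mult.assoc)
  have H0: "summable (\<lambda>l. w l * c l 0)"
    by (rule summable_comparison_test'[OF summable_mult[OF E0, of \<kappa>2]])
      (use wc w_nonneg c_nonneg in \<open>auto simp: abs_mult\<close>)
  have H0E0: "?H0 \<le> \<kappa>2 * ?E0"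
    using suminf_le[OF wc H0 summable_mult[OF E0]] suminf_mult[OF E0, of \<kappa>2] by simp
  have H0nn: "?H0 \<ge> 0" using w_nonneg c_nonneg by (intro suminf_nonneg H0) auto
  show ?thesis
  proof (rule sum_le_of_damped_le[where ?r0.0="1/2"
      and g="\<lambda>r. (1 + K * \<kappa>2) * ?E0 * exp (- 2 * (real n - 1) * (\<sigma> - 1 / real n) * t)"])
    fix r :: real assume r: "1/2 < r" "r < 1"
    have r0: "r > 0" using r by simp
    have good: "good (\<lambda>l. r ^ l * v l)"
      using r0 r v by (intro good_damped) auto
    let ?S = "\<lambda>t. \<Sum>l. r ^ l * v l * c l t"
    let ?D = "\<lambda>t. \<Sum>l. r ^ l * v l * d l t"
    have le: "?D x \<le> - (\<rho> + 1) * ?S x + K * (exp (- \<rho> * x) * ?H0)" if x: "x > 0" for x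
    proof -
      have nn: "c l x \<ge> 0" for l using c_nonneg x by simp
      define a where "a = (\<lambda>l. r ^ l * v l * (real l * c l x))"
      have a0: "a l \<ge> 0" for l using r0 v nn by (simp add: a_def)
      have sa: "summable a"
        unfolding a_def using x
        by (intro good_summable[OF good, where K=1]) (auto simp: power2_eq_square algebra_simps)
      have ql: "summable (\<lambda>l. r ^ l * v l * (lam l * c l x))"
        using x lam_le lam_nonneg by (intro good_summable[OF good, where K="real n"]) auto
      have sc: "summable (\<lambda>l. r ^ l * v l * c l x)" using good_summable_c[OF good] x by simp
      \<comment> \<open>The two factors 2 come from \<open>l \<le> 2 (l - 1)\<close> for l at least
        2, and from \<open>r > 1/2\<close> when \<open>r ^ l\<close> is replaced by
        \<open>r ^ Suc l\<close>. Their total with the middle term is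
        \<open>4 * \<kappa> + 2\<close>.\<close>
      define b where "b = (\<lambda>l. - 2 * \<sigma> * (r ^ l * v l * (lam l * c l x))
        + real n * (2 * \<kappa> * a (l - 1) + 2 * a l + 2 * \<kappa> * a (Suc l)))"
      have db: "r ^ l * v l * d l x \<le> b l" for l
      proof (cases "l = 0")
        case True
        then show ?thesis using v a0[of 0] a0[of 1] \<kappa> by (simp add: b_def)
      next
        case False
        have "r ^ l * v l * d l x \<le> r ^ l * v l * (- 2 * \<sigma> * lam l * c l x
            + real n * real l * (c (l - 1) x + 2 * c l x + c (Suc l) x))"
          using d_bound[OF x, of l] r0 v by (intro mult_left_mono) auto
        also have "\<dots> = - 2 * \<sigma> * (r ^ l * v l * (lam l * c l x))
            + real n * (r ^ l * v l * (real l * c (l - 1) x) + 2 * a l + r ^ l * v l * (real l * c (Suc l) x))"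
          by (simp add: a_def algebra_simps)
        also have "\<dots> \<le> b l"
        proof -
          have "r ^ l * v l * (real l * c (l - 1) x) \<le> 2 * \<kappa> * a (l - 1)"
          proof (cases "l = 1")
            case True
            then show ?thesis using c0[of x] x by (simp add: a_def)
          next
            case l1: False
            then obtain k where k: "l = Suc k" "k > 0" using False by (cases l) auto
            have "r ^ Suc k * v (Suc k) * real (Suc k) \<le> r ^ k * (\<kappa> * v k) * (2 * real k)"
              using comp(1)[OF k(2)] k r0 r v \<kappa>
              by (intro mult_mono power_decreasing) auto
            then have "r ^ Suc k * v (Suc k) * real (Suc k) * c k x \<le> r ^ k * (\<kappa> * v k) * (2 * real k) * c k x"
              using nn by (rule mult_right_mono)
            then show ?thesis unfolding k(1) a_def by (simp add: mult_ac)
          qed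
          moreover have "r ^ l * v l * (real l * c (Suc l) x) \<le> 2 * \<kappa> * a (Suc l)"
          proof -
            have "r ^ l * v l * real l \<le> (2 * r) * r ^ l * (\<kappa> * v (Suc l)) * real (Suc l)"
            proof (intro mult_mono)
              have "1 * r ^ l \<le> (2 * r) * r ^ l" using r by (intro mult_right_mono) auto
              then show "r ^ l \<le> 2 * r * r ^ l" by simp
            qed (use comp(2)[of l] False r0 v \<kappa> in auto)
            then have "r ^ l * v l * real l * c (Suc l) x \<le> (2 * r) * r ^ l * (\<kappa> * v (Suc l)) * real (Suc l) * c (Suc l) x"
              using nn by (rule mult_right_mono)
            then show ?thesis unfolding a_def by (simp add: mult_ac)
          qed
          ultimately show ?thesis
            unfolding b_def by (intro add_left_mono mult_left_mono) linarith+
        qed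
        finally show ?thesis .
      qed
      \<comment> \<open>As \<open>a 0 = 0\<close>, and \<open>0 - 1 = 0\<close> on naturals,
        shifting the index in either direction keeps the sum.\<close>
      have "(\<lambda>l. a (Suc l - 1)) sums suminf a" using sa by (simp add: summable_sums)
      then have sa1: "(\<lambda>l. a (l - 1)) sums suminf a"
        using sums_Suc_iff[of "\<lambda>l. a (l - 1)" "suminf a"] by (simp add: a_def)
      have sa2: "(\<lambda>l. a (Suc l)) sums suminf a"
        using sums_Suc_iff[of a "suminf a"] summable_sums[OF sa] by (simp add: a_def)
      have sb: "b sums (- 2 * \<sigma> * (\<Sum>l. r ^ l * v l * (lam l * c l x))
          + real n * (2 * \<kappa> * suminf a + 2 * suminf a + 2 * \<kappa> * suminf a))"
        unfolding b_def by (intro sums_add sums_mult sa1 sa2 summable_sums sa ql)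
      have sd: "(\<lambda>l. - 2 * \<sigma> * (r ^ l * v l * (lam l * c l x)) + real n * (4 * \<kappa> + 2) * a l) sums suminf b"
      proof -
        have "(\<lambda>l. - 2 * \<sigma> * (r ^ l * v l * (lam l * c l x)) + real n * (4 * \<kappa> + 2) * a l) sums
            (- 2 * \<sigma> * (\<Sum>l. r ^ l * v l * (lam l * c l x)) + real n * (4 * \<kappa> + 2) * suminf a)"
          by (intro sums_add sums_mult summable_sums sa ql)
        moreover have "suminf b = - 2 * \<sigma> * (\<Sum>l. r ^ l * v l * (lam l * c l x)) + real n * (4 * \<kappa> + 2) * suminf a"
          using sums_unique[OF sb] by (simp add: algebra_simps)
        ultimately show ?thesis by simp
      qed
      have se: "(\<lambda>l. - (\<rho> + 1) * (r ^ l * v l * c l x) + (if l \<in> {..<M} then K * (w l * c l x) else 0)) sums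
          (- (\<rho> + 1) * ?S x + (\<Sum>l<M. K * (w l * c l x)))"
        by (intro sums_add sums_mult summable_sums sc sums_If_finite_set) simp
      have "?D x \<le> suminf b"
        using good_summable_d[OF good x] sb by (intro suminf_le db) (auto simp: sums_iff)
      also have "suminf b \<le> - (\<rho> + 1) * ?S x + (\<Sum>l<M. K * (w l * c l x))"
      proof (rule sums_le[OF _ sd se])
        fix l
        show "- 2 * \<sigma> * (r ^ l * v l * (lam l * c l x)) + real n * (4 * \<kappa> + 2) * a l
          \<le> - (\<rho> + 1) * (r ^ l * v l * c l x) + (if l \<in> {..<M} then K * (w l * c l x) else 0)"
        proof (cases "l = 0")
          case True
          then show ?thesis using v by (simp add: a_def)
        next
          case False
          let ?P = "r ^ l * c l x"
          have P: "?P \<ge> 0" using r0 nn by simp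
          \<comment> \<open>The \<sigma>-dependent share of the diffusion pays for \<rho>; the share
            \<open>(2/n) lam l\<close>, at least \<open>(2/n) l\<^sup>2\<close>, is the one that
            occurs in \<open>low\<close>.\<close>
          have "(2 * (\<sigma> - 1 / real n)) * (real n - 1) \<le> (2 * (\<sigma> - 1 / real n)) * lam l"
            using \<sigma> lam_ge[of l] False by (intro mult_left_mono) auto
          moreover have "2 / real n * (real l * real l) \<le> 2 / real n * lam l"
            using lam_ge_sq by (intro mult_left_mono) auto
          moreover have "2 * \<sigma> * lam l = (2 * (\<sigma> - 1 / real n)) * lam l + 2 / real n * lam l"
            by (simp add: algebra_simps)
          ultimately have "- 2 * \<sigma> * lam l + real n * (4 * \<kappa> + 2) * real l
              \<le> - (\<rho> + 1) + (real n * (4 * \<kappa> + 2) * real l - 2 / real n * (real l * real l) + 1)"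
            using \<rho>_eq by linarith
          then have "v l * (- 2 * \<sigma> * lam l + real n * (4 * \<kappa> + 2) * real l)
              \<le> v l * (- (\<rho> + 1) + (real n * (4 * \<kappa> + 2) * real l - 2 / real n * (real l * real l) + 1))"
            using v(1)[of l] by (rule mult_left_mono)
          also have "\<dots> = v l * (- (\<rho> + 1)) + v l * (real n * (4 * \<kappa> + 2) * real l - 2 / real n * (real l * real l) + 1)"
            by (rule distrib_left)
          also have "\<dots> \<le> v l * (- (\<rho> + 1)) + (if l < M then K * w l else 0)"
            using low[of l] False by simp
          finally have "?P * (v l * (- 2 * \<sigma> * lam l + real n * (4 * \<kappa> + 2) * real l))
              \<le> ?P * (v l * (- (\<rho> + 1)) + (if l < M then K * w l else 0))"
            using P by (rule mult_left_mono)
          also have "\<dots> \<le> - (\<rho> + 1) * (r ^ l * v l * c l x) + (if l \<in> {..<M} then K * (w l * c l x) else 0)"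
          proof -
            have "r ^ l * (K * (w l * c l x)) \<le> 1 * (K * (w l * c l x))"
              using r r0 K w_nonneg nn by (intro mult_right_mono power_le_one) auto
            then show ?thesis by (simp add: algebra_simps)
          qed
          finally show ?thesis by (simp add: a_def algebra_simps)
        qed
      qed
      also have "(\<Sum>l<M. K * (w l * c l x)) \<le> K * (exp (- \<rho> * x) * ?H0)"
        using entropy_decay[OF \<sigma> H0, of x M] x K
        unfolding \<rho>_exp sum_distrib_left[symmetric] by (intro mult_left_mono) auto
      finally show ?thesis by simp
    qed
    \<comment> \<open>Multiplication by \<open>exp (\<rho> * t)\<close> makes the source constant
      and leaves damping rate 1.\<close>
    have "exp (\<rho> * t) * ?S t \<le> exp (- 1 * t) * ?S 0 + K * ?H0 / 1"
    proof (rule gronwall_decay_0[where u'="\<lambda>x. exp (\<rho> * x) * (?D x + \<rho> * ?S x)"])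
      show "((\<lambda>t. exp (\<rho> * t) * ?S t) has_real_derivative exp (\<rho> * x) * (?D x + \<rho> * ?S x)) (at x)"
        if "x > 0" for x
      proof -
        have "((\<lambda>t. exp (\<rho> * t)) has_real_derivative exp (\<rho> * x) * \<rho>) (at x)"
          by (auto intro!: derivative_eq_intros)
        from DERIV_mult[OF this good_derivative[OF good that]]
        show ?thesis by (simp add: algebra_simps)
      qed
      show "exp (\<rho> * x) * (?D x + \<rho> * ?S x) \<le> - 1 * (exp (\<rho> * x) * ?S x) + K * ?H0" if x: "x > 0" for x
      proof -
        have "exp (\<rho> * x) * (?D x + \<rho> * ?S x) \<le> exp (\<rho> * x) * (- ?S x + K * (exp (- \<rho> * x) * ?H0))"
          using le[OF x] by (intro mult_left_mono) (auto simp: algebra_simps)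
        also have "\<dots> = - 1 * (exp (\<rho> * x) * ?S x) + K * ?H0"
          by (simp add: algebra_simps exp_minus)
        finally show ?thesis .
      qed
      have "((\<lambda>t. exp (\<rho> * t) * ?S t) \<longlongrightarrow> exp (\<rho> * 0) * ?S 0) (at_right 0)"
        by (intro tendsto_intros good_limit_0[OF good])
      then show "((\<lambda>t. exp (\<rho> * t) * ?S t) \<longlongrightarrow> ?S 0) (at_right 0)" by simp
    qed (use K H0nn t in auto)
    also have "\<dots> \<le> ?E0 + K * (\<kappa>2 * ?E0)"
    proof -
      have S0: "?S 0 \<le> ?E0"
      proof (rule suminf_le)
        fix l
        have "r ^ l * (v l * c l 0) \<le> 1 * (v l * c l 0)"
          using r r0 v c_nonneg by (intro mult_right_mono power_le_one) auto
        then show "r ^ l * v l * c l 0 \<le> v l * c l 0" by (simp add: mult.assoc)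
      qed (use E0 good_summable_c[OF good, of 0] in auto)
      have S0nn: "?S 0 \<ge> 0" using r0 v c_nonneg by (intro suminf_nonneg good_summable_c[OF good]) auto
      have "exp (- 1 * t) * ?S 0 \<le> 1 * ?S 0" using t S0nn by (intro mult_right_mono) auto
      with S0 mult_left_mono[OF H0E0 K] show ?thesis by simp
    qed
    finally have "exp (- \<rho> * t) * (exp (\<rho> * t) * ?S t) \<le> exp (- \<rho> * t) * ((1 + K * \<kappa>2) * ?E0)"
      by (intro mult_left_mono) (auto simp: algebra_simps)
    moreover have "exp (- \<rho> * t) * (exp (\<rho> * t) * ?S t) = ?S t"
      by (simp add: mult.assoc[symmetric] exp_add[symmetric])
    ultimately have "?S t \<le> (1 + K * \<kappa>2) * ?E0 * exp (- \<rho> * t)"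
      by (simp only: mult.commute[of "exp (- \<rho> * t)" "(1 + K * \<kappa>2) * ?E0"])
    moreover have "(\<Sum>l<N. r ^ l * (v l * c l t)) \<le> ?S t"
      using good_summable_c[OF good, of t] t r0 v c_nonneg
      by (subst mult.assoc[symmetric]) (intro sum_le_suminf; simp)
    ultimately show "(\<Sum>l<N. r ^ l * (v l * c l t)) \<le> (1 + K * \<kappa>2) * ?E0 * exp (- 2 * (real n - 1) * (\<sigma> - 1 / real n) * t)"
      unfolding \<rho>_exp by linarith
  qed simp_all
qed

end

subsection \<open>Sobolev weights\<close>

definition sob_weight :: "nat \<Rightarrow> real \<Rightarrow> nat \<Rightarrow> real" where
  "sob_weight n s l = (if l = 0 then 0 else (real l * (real l + real n - 2)) powr s)"

lemma powr_le_powr_abs: "(x::real) \<ge> 1 \<Longrightarrow> x powr s \<le> x powr \<bar>s\<bar>"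
  by (intro powr_mono) auto

lemma powr_comparable:
  fixes x y :: real
  assumes "x \<ge> 1" "x \<le> y" "y \<le> 4 * x"
  shows "y powr s \<le> 4 powr \<bar>s\<bar> * x powr s" and "x powr s \<le> 4 powr \<bar>s\<bar> * y powr s"
proof -
  have one: "(1::real) \<le> 4 powr \<bar>s\<bar>" by (simp add: ge_one_powr_ge_zero)
  show "y powr s \<le> 4 powr \<bar>s\<bar> * x powr s"
  proof (cases "s \<ge> 0")
    case True
    have "y powr s \<le> (4 * x) powr s" using assms True by (intro powr_mono2) auto
    then show ?thesis using True assms by (simp add: powr_mult)
  next
    case False
    have "y powr s \<le> 1 * x powr s" using assms False by (simp add: powr_mono2')
    also have "\<dots> \<le> 4 powr \<bar>s\<bar> * x powr s" using one by (intro mult_right_mono) auto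
    finally show ?thesis .
  qed
  show "x powr s \<le> 4 powr \<bar>s\<bar> * y powr s"
  proof (cases "s \<ge> 0")
    case True
    have "x powr s \<le> 1 * y powr s" using assms True by (simp add: powr_mono2)
    also have "\<dots> \<le> 4 powr \<bar>s\<bar> * y powr s" using one by (intro mult_right_mono) auto
    finally show ?thesis .
  next
    case False
    have "(4 * x) powr s \<le> y powr s" using assms False by (intro powr_mono2') auto
    then have "4 powr \<bar>s\<bar> * (4 powr s * x powr s) \<le> 4 powr \<bar>s\<bar> * y powr s"
      using assms by (intro mult_left_mono) (auto simp: powr_mult)
    then show ?thesis using False by (simp add: mult.assoc[symmetric] flip: powr_add)
  qed
qed

lemma pochhammer_ge_power: "l > 0 \<Longrightarrow> real l ^ k \<le> pochhammer (real l) k"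
proof (induction k)
  case (Suc k)
  have "real l ^ k * real l \<le> pochhammer (real l) k * (real l + real k)"
    using Suc by (intro mult_mono) (auto simp: pochhammer_nonneg)
  then show ?case by (simp add: pochhammer_Suc mult.commute)
qed simp

context
  fixes n :: nat and s :: real
  assumes n2: "n \<ge> 2"
begin

private abbreviation "ev l \<equiv> real l * (real l + real n - 2)"

lemma ev_ge_1: "l > 0 \<Longrightarrow> ev l \<ge> 1"
proof -
  assume "l > 0"
  then have "1 * 1 \<le> real l * (real l + real n - 2)" using n2 by (intro mult_mono) auto
  then show ?thesis by simp
qed

lemma sob_weight_nonneg: "sob_weight n s l \<ge> 0"
  by (simp add: sob_weight_def)

text \<open>Polynomial growth of any order suffices for the damped weights to be
  \<open>good\<close>.\<close>

lemma sob_weight_le: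
  "sob_weight n s l \<le> real n ^ nat \<lceil>\<bar>s\<bar>\<rceil> * (real l + 1) ^ (2 * nat \<lceil>\<bar>s\<bar>\<rceil>)"
proof (cases "l = 0")
  case False
  let ?k = "nat \<lceil>\<bar>s\<bar>\<rceil>"
  have e1: "ev l \<ge> 1" using ev_ge_1 False by simp
  have "ev l \<le> (real l + 1) * (real n * (real l + 1))"
  proof (rule mult_mono)
    have "1 * real l \<le> real n * real l" using n2 by (intro mult_right_mono) auto
    then show "real l + real n - 2 \<le> real n * (real l + 1)" by (simp add: algebra_simps)
  qed (use n2 False in auto)
  then have ev_le: "ev l \<le> real n * (real l + 1) ^ 2" by (simp add: power2_eq_square algebra_simps)
  have "sob_weight n s l = ev l powr s" using False by (simp add: sob_weight_def)
  also have "\<dots> \<le> ev l powr \<bar>s\<bar>" using e1 by (rule powr_le_powr_abs)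
  also have "\<dots> \<le> ev l powr real ?k" using e1 by (intro powr_mono) linarith+
  also have "\<dots> = ev l ^ ?k" using e1 by (intro powr_realpow) simp
  also have "\<dots> \<le> (real n * (real l + 1) ^ 2) ^ ?k" using ev_le e1 by (intro power_mono) auto
  finally show ?thesis by (simp add: power_mult_distrib power_mult)
qed (simp add: sob_weight_def)

lemma sob_weight_comparable:
  assumes "l > 0"
  shows "sob_weight n s (Suc l) \<le> 4 powr \<bar>s\<bar> * sob_weight n s l"
    and "sob_weight n s l \<le> 4 powr \<bar>s\<bar> * sob_weight n s (Suc l)"
proof -
  have 1: "ev l \<ge> 1" using ev_ge_1 assms by simp
  \<comment> \<open>Both factors of the eigenvalue at most double from l to l + 1, hence the base
    4.\<close>
  have 2: "ev l \<le> ev (Suc l)" using assms n2 by (intro mult_mono) auto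
  have "ev (Suc l) \<le> (2 * real l) * (2 * (real l + real n - 2))"
    using assms n2 by (intro mult_mono) auto
  also have "\<dots> = 4 * ev l" by (simp only: mult_ac)
  finally have 3: "ev (Suc l) \<le> 4 * ev l" .
  show "sob_weight n s (Suc l) \<le> 4 powr \<bar>s\<bar> * sob_weight n s l"
    "sob_weight n s l \<le> 4 powr \<bar>s\<bar> * sob_weight n s (Suc l)"
    using powr_comparable[OF 1 2 3, of s] assms by (simp_all add: sob_weight_def)
qed

text \<open>The place where the lower bound on s enters: \<open>pochhammer\<close> is at least
  \<open>l ^ (n - 1)\<close> and the eigenvalue at most \<open>(n - 1) l\<^sup>2\<close>, so the
  conformal weight is of order at most the Sobolev weight with exponent
  \<open>- (n - 1) / 2\<close>.\<close>

lemma conf_weight_le: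
  assumes s: "s \<ge> - (real n - 1) / 2"
  shows "(if l = 0 then 0 else 1 / pochhammer (real l) (n - 1))
    \<le> (real n - 1) powr ((real n - 1) / 2) * sob_weight n s l"
proof (cases "l = 0")
  case False
  then have l: "l > 0" by simp
  let ?h = "(real n - 1) / 2"
  have e1: "ev l \<ge> 1" using ev_ge_1 l by simp
  have "0 \<le> (real n - 2) * (real l - 1)" using n2 l by (intro mult_nonneg_nonneg) auto
  then have "real l + real n - 2 \<le> (real n - 1) * real l" by (simp add: algebra_simps)
  then have "ev l \<le> real l * ((real n - 1) * real l)" by (intro mult_left_mono) auto
  then have ev_le: "ev l \<le> (real n - 1) * (real l)\<^sup>2" by (simp add: power2_eq_square mult_ac)
  have "ev l powr (- s) \<le> ev l powr ?h" using e1 s by (intro powr_mono) auto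
  also have "\<dots> \<le> ((real n - 1) * (real l)\<^sup>2) powr ?h" using ev_le e1 n2 by (intro powr_mono2) auto
  also have "\<dots> = (real n - 1) powr ?h * real l powr (2 * ?h)"
    using n2 l by (simp add: powr_mult powr_powr flip: powr_numeral)
  also have "real l powr (2 * ?h) = real l ^ (n - 1)"
  proof -
    have "2 * ?h = real (n - 1)" using n2 by (simp add: of_nat_diff field_simps)
    then show ?thesis using l by (simp only: powr_realpow of_nat_0_less_iff)
  qed
  also have "(real n - 1) powr ?h * real l ^ (n - 1) \<le> (real n - 1) powr ?h * pochhammer (real l) (n - 1)"
    using pochhammer_ge_power[OF l] by (intro mult_left_mono) auto
  finally have "ev l powr (- s) * ev l powr s \<le> (real n - 1) powr ?h * pochhammer (real l) (n - 1) * ev l powr s"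
    by (intro mult_right_mono) auto
  moreover have "ev l powr (- s) * ev l powr s = 1" using l n2 by (simp flip: powr_add)
  moreover have "pochhammer (real l) (n - 1) > 0" using l by (intro pochhammer_pos) simp
  ultimately show ?thesis using l by (simp add: sob_weight_def divide_le_eq mult_ac)
qed (simp add: sob_weight_def)

end

text \<open>K and M are determined by n, \<kappa> and the two weights alone, which makes the final
  constant uniform in \<sigma>.\<close>

lemma high_modes_damped:
  fixes v w :: "nat \<Rightarrow> real" and \<kappa> :: real
  assumes "n \<ge> 2" "\<kappa> \<ge> 0" and v: "\<And>l. v l \<ge> 0" and w: "\<And>l. l > 0 \<Longrightarrow> w l > 0"
  shows "\<exists>K\<ge>0. \<exists>M. \<forall>l>0. v l * (real n * (4 * \<kappa> + 2) * real l - 2 / real n * (real l * real l) + 1)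
        \<le> (if l < M then K * w l else 0)"
proof -
  define K1 where "K1 = real n * (4 * \<kappa> + 2)"
  have K1: "K1 \<ge> 0" using assms by (simp add: K1_def)
  \<comment> \<open>From M on, \<open>(2/n) l \<ge> K1 + 1\<close>, and
    \<open>(K1 + 1) l \<ge> K1 * l + 1\<close>.\<close>
  define M where "M = nat \<lceil>real n * (K1 + 1) / 2\<rceil>"
  \<comment> \<open>A sum of the finitely many ratios needed, in place of their maximum.\<close>
  define K where "K = (\<Sum>l\<in>{0<..<M}. v l * (K1 * real l + 1) / w l)"
  have K: "K \<ge> 0" unfolding K_def
    using v w K1 by (intro sum_nonneg divide_nonneg_nonneg mult_nonneg_nonneg) (auto simp: less_imp_le)
  have "v l * (K1 * real l - 2 / real n * (real l * real l) + 1) \<le> (if l < M then K * w l else 0)"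
    if l: "l > 0" for l
  proof (cases "l < M")
    case True
    have "v l * (K1 * real l - 2 / real n * (real l * real l) + 1) \<le> v l * (K1 * real l + 1)"
      using v by (intro mult_left_mono) auto
    also have "\<dots> = v l * (K1 * real l + 1) / w l * w l" using w[OF l] by simp
    also have "\<dots> \<le> K * w l"
    proof (rule mult_right_mono)
      show "v l * (K1 * real l + 1) / w l \<le> K"
        unfolding K_def using True l v w K1
        by (intro member_le_sum[where f="\<lambda>l. v l * (K1 * real l + 1) / w l"])
          (auto simp: less_imp_le intro!: divide_nonneg_nonneg mult_nonneg_nonneg)
    qed (use w[OF l] in simp)
    finally show ?thesis using True by simp
  next
    case False
    have "real n * (K1 + 1) / 2 \<le> real l" using False by (simp add: M_def) linarith
    then have "K1 + 1 \<le> 2 / real n * real l" using assms(1) by (simp add: field_simps)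
    then have "(K1 + 1) * real l \<le> 2 / real n * real l * real l" by (intro mult_right_mono) auto
    moreover have "1 \<le> real l" using l by simp
    ultimately have "K1 * real l - 2 / real n * (real l * real l) + 1 \<le> 0"
      by (simp add: algebra_simps)
    then have "v l * (K1 * real l - 2 / real n * (real l * real l) + 1) \<le> 0"
      using v by (intro mult_nonneg_nonpos) auto
    with False show ?thesis by simp
  qed
  with K show ?thesis unfolding K1_def by blast
qed

subsection \<open>Entropy and Sobolev norms of solutions\<close>

context
  fixes \<sigma> :: real and \<mu>0 :: "(real^'n::finite) measure" and f :: "real \<Rightarrow> real^'n \<Rightarrow> real"
  assumes n: "CARD('n) \<ge> 2" and sol: "doi_solution \<sigma> \<mu>0 f" and \<sigma>0: "\<sigma> > 0"
begin

interpretation ms: mode_system "CARD('n)" \<sigma> "exp 2 * 2 ^ CARD('n)" "mode \<mu>0 f"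
  "\<lambda>l t. coupling (sol_state \<mu>0 f t) l"
proof
  show "(mode \<mu>0 f l \<longlongrightarrow> mode \<mu>0 f l 0) (at_right 0)" for l
    by (rule mode_tendsto_0[OF n sol])
  fix l and t :: real
  show "(mode \<mu>0 f (Suc l) has_real_derivative
        - 2 * \<sigma> * (real (Suc l) * (real (Suc l) + real CARD('n) - 2)) * mode \<mu>0 f (Suc l) t
        - 2 * real (Suc l) * coupling (sol_state \<mu>0 f t) (Suc l)
        + 2 * (real CARD('n) + real (Suc l) - 2) * coupling (sol_state \<mu>0 f t) l) (at t)" if "t > 0"
    using mode_derivative[OF n sol that, of l] by (simp only: eig_def)
  show "mode \<mu>0 f l t \<le> exp 2 * 2 ^ CARD('n) * (real l + 1) ^ CARD('n)" if "t \<ge> 0"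
    using mode_le[OF n sol that, of l] unfolding sup_const_def power_mult_distrib by (simp only: mult_ac)
qed (use n \<sigma>0 mode_0[OF n sol] mode_nonneg[OF n sol] coupling_sol_0[OF n sol]
      coupling_sol_le[OF n sol] in auto)

lemma sol_w_eq: "ms.w l * mode \<mu>0 f l t = (if l = 0 then 0 else comp_sq (sol_fun \<mu>0 f t) l / conf_eig TYPE('n) l)"
  by (cases "l = 0") (simp, simp add: ms.w_def conf_eig_def mode_def[OF n sol])

lemma Hent_eq: "t > 0 \<Longrightarrow> Hent (f t) = (\<Sum>l. ms.w l * mode \<mu>0 f l t)"
  unfolding sol_w_eq Hent_def tildeA_sq_def by (intro suminf_cong) (simp add: sol_fun_def)

lemma Dtil_eq:
  assumes t: "t > 0"
  shows "- Dtil \<sigma> (f t) = - 2 * \<sigma> * (\<Sum>l. ms.w l * (ms.lam l * mode \<mu>0 f l t))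
    + 2 * (ms.w 1 * ((real CARD('n) - 1) * (mode \<mu>0 f 1 t / real CARD('n))))"
proof -
  have "tildeB_sq (dens_fun (f t)) = (\<Sum>l. ms.w l * (ms.lam l * mode \<mu>0 f l t))"
    unfolding tildeB_sq_def using t
    by (intro suminf_cong) (simp add: ms.w_def ms.lam_def conf_eig_def eig_def mode_def[OF n sol] sol_fun_def)
  \<comment> \<open>The origin of the factor in \<open>Dtil\<close>: \<open>ms.w 1\<close> is
    \<open>1 / (n - 1)!\<close>, and \<open>lam 1 = n - 1\<close> cancels one factor of the
    factorial.\<close>
  moreover have "ms.w 1 * (real CARD('n) - 1) = 1 / fact (CARD('n) - 2)"
  proof -
    obtain k where k: "CARD('n) = Suc (Suc k)" using n by (metis add_2_eq_Suc le_Suc_ex)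
    have "ms.w 1 = 1 / fact (CARD('n) - 1)" by (simp add: ms.w_def pochhammer_fact)
    moreover have "fact (CARD('n) - 1) = (real CARD('n) - 1) * fact (CARD('n) - 2)"
      using k by simp
    ultimately show ?thesis using n by simp
  qed
  then have "ms.w 1 * ((real CARD('n) - 1) * (Jf (f t) \<bullet> Jf (f t))) = (Jf (f t) \<bullet> Jf (f t)) / fact (CARD('n) - 2)"
    by (simp add: mult.assoc[symmetric])
  moreover have "mode \<mu>0 f 1 t / real CARD('n) = Jf (f t) \<bullet> Jf (f t)"
    using mode_1[OF n sol t] by simp
  ultimately show ?thesis by (simp add: Dtil_def)
qed

lemma Hent_derivative: "t > 0 \<Longrightarrow> ((\<lambda>\<tau>. Hent (f \<tau>)) has_real_derivative - Dtil \<sigma> (f t)) (at t)"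
proof -
  assume t: "t > 0"
  show ?thesis
    using ms.entropy_derivative[OF t, folded Dtil_eq[OF t]]
    by (rule has_field_derivative_transform_within_open[where S="{0<..}"]) (use t Hent_eq in auto)
qed

lemma Dtil_nonneg: "t > 0 \<Longrightarrow> \<sigma> \<ge> 1 / real CARD('n) \<Longrightarrow> Dtil \<sigma> (f t) \<ge> 0"
  using ms.dissipation_nonneg[of t] Dtil_eq[of t] by linarith

lemma Hs_sq_sol:
  assumes "t \<ge> 0"
  shows "Hs_sq s (sol_fun \<mu>0 f t) = (\<Sum>l. ennreal (sob_weight CARD('n) s l * mode \<mu>0 f l t))"
proof -
  have "sol_fun \<mu>0 f t (\<lambda>_. 1) = 0"
    using fluct_const[OF n state_sol_state[OF n sol assms], of 1] by (simp add: fluct_sol_state[OF n sol])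
  then show ?thesis
    unfolding Hs_sq_def Hdot_sq_def
    by (auto intro!: suminf_cong simp: sob_weight_def eig_def mode_def[OF n sol])
qed

text \<open>K and M are parameters, so that they can be fixed before \<sigma>, the initial measure
  and the solution.\<close>

lemma Hs_decay:
  assumes \<sigma>: "\<sigma> > 1 / real CARD('n)" and t: "t \<ge> 0"
    and s: "s \<ge> - (real CARD('n) - 1) / 2"
    and K: "K \<ge> 0" and low: "\<And>l. l > 0 \<Longrightarrow> sob_weight CARD('n) s l *
        (real CARD('n) * (4 * 4 powr \<bar>s\<bar> + 2) * real l - 2 / real CARD('n) * (real l * real l) + 1)
        \<le> (if l < M then K * (1 / pochhammer (real l) (CARD('n) - 1)) else 0)"
    and fin: "Hs_sq s (meas_fun \<mu>0) < \<infinity>"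
  shows "Hs_sq s (sol_fun \<mu>0 f t) \<le>
    ennreal ((1 + K * (real CARD('n) - 1) powr ((real CARD('n) - 1) / 2))
      * exp (- 2 * (real CARD('n) - 1) * (\<sigma> - 1 / real CARD('n)) * t)) * Hs_sq s (meas_fun \<mu>0)"
proof -
  let ?v = "sob_weight CARD('n) s" and ?c = "mode \<mu>0 f"
  let ?k = "1 + K * (real CARD('n) - 1) powr ((real CARD('n) - 1) / 2)"
  let ?e = "exp (- 2 * (real CARD('n) - 1) * (\<sigma> - 1 / real CARD('n)) * t)"
  have nn: "?v l * ?c l x \<ge> 0" if "x \<ge> 0" for l x
    using sob_weight_nonneg ms.c_nonneg[OF that] by (intro mult_nonneg_nonneg) (auto simp: sob_weight_def)
  have k: "?k \<ge> 0" using K by simp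
  have E: "Hs_sq s (meas_fun \<mu>0) = (\<Sum>l. ennreal (?v l * ?c l 0))"
    using Hs_sq_sol[of 0 s] by (simp add: sol_fun_def)
  have E0: "summable (\<lambda>l. ?v l * ?c l 0)"
    using fin nn[of 0] unfolding E by (intro summable_suminf_not_top) auto
  have E0nn: "(\<Sum>l. ?v l * ?c l 0) \<ge> 0" using nn by (intro suminf_nonneg E0) auto
  have E': "Hs_sq s (meas_fun \<mu>0) = ennreal (\<Sum>l. ?v l * ?c l 0)"
    unfolding E using nn E0 by (intro suminf_ennreal2) auto
  have "(\<Sum>l<N. ?v l * ?c l t) \<le> ?k * (\<Sum>l. ?v l * ?c l 0) * ?e" for N
  proof (rule ms.energy_decay[OF \<sigma> t])
    show "ms.w l \<le> (real CARD('n) - 1) powr ((real CARD('n) - 1) / 2) * ?v l" for l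
      using conf_weight_le[OF n s, of l] by (cases "l = 0") (simp, simp add: ms.w_def)
    show "?v l * (real CARD('n) * (4 * 4 powr \<bar>s\<bar> + 2) * real l - 2 / real CARD('n) * (real l * real l) + 1)
        \<le> (if l < M then K * ms.w l else 0)" if "l > 0" for l
      using low[OF that] unfolding ms.w_def .
    show "?v 0 = 0" by (simp add: sob_weight_def)
  qed (use E0 K sob_weight_nonneg[OF n] sob_weight_le[OF n] sob_weight_comparable[OF n] in auto)
  then have "(\<Sum>l<N. ennreal (?v l * ?c l t)) \<le> ennreal (?k * (\<Sum>l. ?v l * ?c l 0) * ?e)" for N
    using nn[OF t] by (subst sum_ennreal) (auto intro: ennreal_leI)
  then have "Hs_sq s (sol_fun \<mu>0 f t) \<le> ennreal (?k * (\<Sum>l. ?v l * ?c l 0) * ?e)"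
    unfolding Hs_sq_sol[OF t] by (intro suminf_le_const) auto
  also have "\<dots> = ennreal (?k * ?e) * ennreal (\<Sum>l. ?v l * ?c l 0)"
    using k E0nn by (subst ennreal_mult[symmetric]) (auto simp: mult_ac)
  finally show ?thesis unfolding E' .
qed

end

theorem theorem2:
  fixes dummy :: "'n::finite itself"
  assumes n2: "CARD('n) \<ge> 2"
  shows
   "(\<forall>\<sigma>>0. \<forall>(\<mu>0 :: (real^'n) measure) f. doi_solution \<sigma> \<mu>0 f \<longrightarrow>
       (\<forall>t>0. ((\<lambda>\<tau>. Hent (f \<tau>)) has_real_derivative (- Dtil \<sigma> (f t))) (at t)))
  \<and> (\<forall>\<sigma>\<ge>1 / real CARD('n). \<forall>(\<mu>0 :: (real^'n) measure) f. doi_solution \<sigma> \<mu>0 f \<longrightarrow>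
       (\<forall>t>0. Dtil \<sigma> (f t) \<ge> 0) \<and>
       (\<forall>t1 t2. 0 < t1 \<and> t1 \<le> t2 \<longrightarrow> Hent (f t2) \<le> Hent (f t1)))
  \<and> (\<forall>s\<ge>- (real CARD('n) - 1) / 2. \<exists>C\<ge>0. \<forall>\<sigma>>1 / real CARD('n).
       \<forall>(\<mu>0 :: (real^'n) measure) f. doi_solution \<sigma> \<mu>0 f \<and> Hs_sq s (meas_fun \<mu>0) < \<infinity> \<longrightarrow>
       (\<forall>t\<ge>0. Hs_sq s (sol_fun \<mu>0 f t) \<le>
          ennreal (C\<^sup>2 * exp (- 2 * (real CARD('n) - 1) * (\<sigma> - 1 / real CARD('n)) * t))
          * Hs_sq s (meas_fun \<mu>0)))"
proof (intro conjI allI impI)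
  have pos: "\<sigma> > 0" if "\<sigma> \<ge> 1 / real CARD('n)" for \<sigma>
    using that by (rule less_le_trans[rotated]) simp
  {
    fix \<sigma> t :: real and \<mu>0 :: "(real^'n) measure" and f
    assume "\<sigma> > 0" "doi_solution \<sigma> \<mu>0 f" "t > 0"
    then show "((\<lambda>\<tau>. Hent (f \<tau>)) has_real_derivative (- Dtil \<sigma> (f t))) (at t)"
      using Hent_derivative[OF n2] by blast
  }
  {
    fix \<sigma> and \<mu>0 :: "(real^'n) measure" and f
    assume \<sigma>: "\<sigma> \<ge> 1 / real CARD('n)" and sol: "doi_solution \<sigma> \<mu>0 f"
    show D: "Dtil \<sigma> (f t) \<ge> 0" if "t > 0" for t
      by (rule Dtil_nonneg[OF n2 sol pos[OF \<sigma>] that \<sigma>])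
    show "Hent (f t2) \<le> Hent (f t1)" if t: "0 < t1 \<and> t1 \<le> t2" for t1 t2
    proof (rule DERIV_nonpos_imp_nonincreasing[of t1 t2 "\<lambda>t. Hent (f t)"])
      fix x assume "t1 \<le> x" "x \<le> t2"
      then have x: "x > 0" using t by linarith
      show "\<exists>y. ((\<lambda>t. Hent (f t)) has_real_derivative y) (at x) \<and> y \<le> 0"
        using Hent_derivative[OF n2 sol pos[OF \<sigma>] x] D[OF x] by (intro exI[of _ "- Dtil \<sigma> (f x)"]) auto
    qed (use t in simp)
  }
  fix s assume s: "s \<ge> - (real CARD('n) - 1) / 2"
  \<comment> \<open>Here \<kappa> is \<open>4 powr \<bar>s\<bar>\<close>, the variation of the
    Sobolev weights between neighbours.\<close>
  have "\<exists>K\<ge>0. \<exists>M. \<forall>l>0. sob_weight CARD('n) s l *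
      (real CARD('n) * (4 * 4 powr \<bar>s\<bar> + 2) * real l - 2 / real CARD('n) * (real l * real l) + 1)
      \<le> (if l < M then K * (1 / pochhammer (real l) (CARD('n) - 1)) else 0)"
    using n2 by (intro high_modes_damped) (auto simp: sob_weight_def intro: pochhammer_pos)
  then obtain K M where K: "K \<ge> 0" and low: "\<forall>l>0. sob_weight CARD('n) s l *
      (real CARD('n) * (4 * 4 powr \<bar>s\<bar> + 2) * real l - 2 / real CARD('n) * (real l * real l) + 1)
      \<le> (if l < M then K * (1 / pochhammer (real l) (CARD('n) - 1)) else 0)"
    by blast
  \<comment> \<open>The estimate concerns squared norms, so C is the square root of this
    number.\<close>
  let ?k = "1 + K * (real CARD('n) - 1) powr ((real CARD('n) - 1) / 2)"
  have k: "(sqrt ?k)\<^sup>2 = ?k" using K by (intro real_sqrt_pow2) simp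
  show "\<exists>C\<ge>0. \<forall>\<sigma>>1 / real CARD('n).
     \<forall>(\<mu>0 :: (real^'n) measure) f. doi_solution \<sigma> \<mu>0 f \<and> Hs_sq s (meas_fun \<mu>0) < \<infinity> \<longrightarrow>
     (\<forall>t\<ge>0. Hs_sq s (sol_fun \<mu>0 f t) \<le>
        ennreal (C\<^sup>2 * exp (- 2 * (real CARD('n) - 1) * (\<sigma> - 1 / real CARD('n)) * t))
        * Hs_sq s (meas_fun \<mu>0))"
    unfolding conj_imp_eq_imp_imp
    by (intro exI[of _ "sqrt ?k"] conjI allI impI)
      (use K in simp, unfold k, rule Hs_decay[OF n2 _ pos _ _ s K low[rule_format]], auto)
qed

end
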